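(* Let $\varepsilon>0$ and $N\in\mathbb{N}$, $N\ge 1$. For $i=1,\dots,N$ let $\mathbb{X}_i\neq\emptyset$ be a compact Polish space, let $\mu_i\in\mathcal{M}^+(\mathbb{X}_i)$ be fully supported, let $\gamma_i\in\mathcal{M}^+(\mathbb{X}_i)$ be reference measures for $\mu=(\mu_1,\dots,\mu_N)$, i.e. $\mathrm{KL}(\mu^\otimes,\gamma^\otimes)<\infty$, and let $\varphi_i\in\Gamma_0(\mathbb{R})$ be an entropy function. Let $c\in C(\mathbb{X})$ be non-negative, where $\mathbb{X}=\mathbb{X}_1\times\dots\times\mathbb{X}_N$. Assume that $\ln(\sigma_{\mu_i})\in L^\infty(\mathbb{X}_i,\gamma_i)$ for $i=1,\dots,N$, that $[0,\infty)\subset\mathrm{dom}\,\varphi_i$ for all $i=1,\dots,N-1$, and that $f^{(0)}\in L^{\infty,\times}(\mathbb{X},\gamma)$ satisfies $\mathcal{D}_\varepsilon^\varphi(f^{(0)})>-\infty$. Let $(f^{(n)})_{n\in\mathbb{N}}$ be the Sinkhorn sequence started at $f^{(0)}$. Then for any optimal solution $\hat f\in L^{\infty,\times}(\mathbb{X},\gamma)$ of the dual problem $$\sup_{f\in L^{\infty,\times}(\mathbb{X},\gamma)}\mathcal{D}_\varepsilon^\varphi(f)+\varepsilon\gamma^\otimes(\mathbb{X})$$ and every $p\in[1,\infty)$ it holds $$\bigl\|(f^{(n)})^\oplus-\hat f^\oplus\bigr\|_{p}\to 0\quad\text{as }n\to\infty .$$ Moreover, if $N-1$ of the functions $\varphi_i^*$,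 $i=1,\dots,N$, are strictly convex, then the optimal $\hat f$ is unique and $\|f^{(n)}-\hat f\|_p\to 0$ for every $p\in[1,\infty)$.
   Context: $\mathcal{M}^+(\mathbb{Y})$ denotes the finite non-negative Borel measures on a compact Polish space $\mathbb{Y}$. $\mu_i$ is fully supported if $\mathrm{supp}(\mu_i)=\mathbb{X}_i$. $\gamma=(\gamma_1,\dots,\gamma_N)$, $\mu^\otimes=\bigotimes_i\mu_i$, $\gamma^\otimes=\bigotimes_i\gamma_i$, $\gamma_{\setminus j}^\otimes=\bigotimes_{i\ne j}\gamma_i$, $\mathbb{X}_{\setminus j}=\prod_{i\neq j}\mathbb{X}_i$. $\mathrm{KL}(\mu,\nu)=\int\ln(\tfrac{\mathrm{d}\mu}{\mathrm{d}\nu})\mathrm{d}\mu+\nu(\mathbb{Y})-\mu(\mathbb{Y})$ if $\mu\ll\nu$, $+\infty$ otherwise. $\sigma_{\mu_i}=\mathrm{d}\mu_i/\mathrm{d}\gamma_i$ is the Radon–Nikodym derivative. $L^{p,\times}(\mathbb{X},\gamma)=L^p(\mathbb{X}_1,\gamma_1)\times\dots\times L^p(\mathbb{X}_N,\gamma_N)$, $p\in[1,\infty]$, equipped with the $L^p$ norm of the components. $\|\cdot\|_p$ denotes the norm of the relevant space: $L^p(\mathbb{X},\gamma^\otimes)$ for $f^\oplus$ and $L^{p,\times}(\mathbb{X},\gamma)$ for tuples $f$. For $f=(f_1,\dots,f_N)$: $f^\oplus(x)=\sum_{i}f_i(x_i)$ and $f_{\setminus j}^\oplus(x)=\sum_{i\ne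 j}f_i(x_i)$. $\Gamma_0(\mathbb{R})$: proper, convex, lower semi-continuous functions $\mathbb{R}\to(-\infty,+\infty]$; $\mathrm{dom}\,\varphi=\{x:\varphi(x)\in\mathbb{R}\}$. An entropy function is a non-negative $\varphi\in\Gamma_0(\mathbb{R})$ with $\varphi(1)=0$ and $\varphi|_{(-\infty,0)}=\infty$. $\varphi^*(q)=\sup_{x\in\mathbb{R}}\{qx-\varphi(x)\}$. Dual functional: $\mathcal{D}_\varepsilon^\varphi(f)=-\sum_{i=1}^N\int_{\mathbb{X}_i}\varphi_i^*\circ(-f_i)\,\mathrm{d}\mu_i-\varepsilon\int_{\mathbb{X}}\exp\bigl(\frac{f^\oplus-c}{\varepsilon}\bigr)\mathrm{d}\gamma^\otimes$ for $f\in L^{\infty,\times}(\mathbb{X},\gamma)$. $j$-th $(c,\varepsilon)$-transform: $f^{(c,\varepsilon,j)}=\varepsilon\ln(\sigma_{\mu_j})-\varepsilon\ln\Bigl(\int_{\mathbb{X}_{\setminus j}}\exp\bigl(\frac{f_{\setminus j}^\oplus-c}{\varepsilon}\bigr)\mathrm{d}\gamma_{\setminus j}^\otimes\Bigr)\in L^\infty(\mathbb{X}_j,\gamma_j)$. Anisotropic proximity operator: $\mathrm{aprox}_{\varphi^*}^{\varepsilon}:\mathbb{R}\to\mathbb{R}$, $\mathrm{aprox}_{\varphi^*}^{\varepsilon}(p)=\operatorname{argmin}_{q\in\mathbb{R}}\{\varepsilon e^{(p-q)/\varepsilon}+\varphi^*(q)\}$ (well-defined, i.e. the minimizer is unique).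 $j$-th Sinkhorn mapping: $f^{(c,\varepsilon,\varphi,j)}=-\mathrm{aprox}_{\varphi_j^*}^\varepsilon\bigl(-f^{(c,\varepsilon,j)}\bigr)$, applied pointwise. Sinkhorn sequence started at $f^{(0)}$: for $r=0,1,2,\dots$ and $j=1,\dots,N$, $f_j^{(rN+j)}=\bigl(f^{(rN+j-1)}\bigr)^{(c,\varepsilon,\varphi,j)}$ and $f_i^{(rN+j)}=f_i^{(rN+j-1)}$ for $i\neq j$. *)

theory Defs
  imports "HOL-Analysis.Analysis"
begin

definition polish_topology :: "'a topology \<Rightarrow> bool" where
  "polish_topology X \<longleftrightarrow> completely_metrizable_space X \<and> separable_space X"

definition borel_of :: "'a topology \<Rightarrow> 'a measure" where
  "borel_of X = sigma (topspace X) {U. openin X U}"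

definition finite_borel_measures :: "'a topology \<Rightarrow> 'a measure set" where
  "finite_borel_measures X = {M. sets M = sets (borel_of X) \<and> finite_measure M}"

definition support_of :: "'a topology \<Rightarrow> 'a measure \<Rightarrow> 'a set" where
  "support_of X M = {x \<in> topspace X. \<forall>U. openin X U \<and> x \<in> U \<longrightarrow> emeasure M U > 0}"

text \<open>Integral of an extended real function as the difference of the integrals of its positive and
  negative part. All uses below are to functions at least one of whose parts has a finite integral.\<close>

definition ext_integral :: "'a measure \<Rightarrow> ('a \<Rightarrow> ereal) \<Rightarrow> ereal" where
  "ext_integral M g =
     enn2ereal (\<integral>\<^sup>+x. e2ennreal (g x) \<partial>M) - enn2ereal (\<integral>\<^sup>+x. e2ennreal (- g x) \<partial>M)"

definition ext_ln :: "ennreal \<Rightarrow> ereal" where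
  "ext_ln a = (if a = 0 then -\<infinity> else if a = \<infinity> then \<infinity> else ereal (ln (enn2real a)))"

text \<open>\<open>RN_deriv \<nu> \<mu>\<close> is the density of \<open>\<mu>\<close> with respect to \<open>\<nu>\<close>, and
  \<open>absolutely_continuous \<nu> \<mu>\<close> says that \<open>\<mu>\<close> is absolutely continuous with respect to \<open>\<nu>\<close>.\<close>

definition KL :: "'a measure \<Rightarrow> 'a measure \<Rightarrow> ereal" where
  "KL \<mu> \<nu> =
     (if absolutely_continuous \<nu> \<mu>
      then ext_integral \<mu> (\<lambda>x. ext_ln (RN_deriv \<nu> \<mu> x))
             + ereal (measure \<nu> (space \<nu>)) - ereal (measure \<mu> (space \<mu>))
      else \<infinity>)"

text \<open>Elements of \<open>L\<^sup>p\<close> are represented by functions, so that equality in \<open>L\<^sup>p\<close> is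
  equality almost everywhere. \<open>Linf\<close> is stated for extended real functions because the
  logarithm of a density takes the value \<open>-\<infinity>\<close> where the density vanishes.\<close>

definition Linf :: "'a measure \<Rightarrow> ('a \<Rightarrow> ereal) set" where
  "Linf M = {g \<in> borel_measurable M. \<exists>C::real. AE x in M. \<bar>g x\<bar> \<le> ereal C}"

definition Linf_tuples :: "nat set \<Rightarrow> (nat \<Rightarrow> 'a measure) \<Rightarrow> (nat \<Rightarrow> 'a \<Rightarrow> real) set" where
  "Linf_tuples I \<gamma> = {f. \<forall>i\<in>I. (\<lambda>x. ereal (f i x)) \<in> Linf (\<gamma> i)}"

text \<open>The norms below are only used for essentially bounded functions and finite measures, where
  the Bochner integral exists.\<close>

definition Lp_norm :: "real \<Rightarrow> 'a measure \<Rightarrow> ('a \<Rightarrow> real) \<Rightarrow> real" where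
  "Lp_norm p M f = (\<integral>x. \<bar>f x\<bar> powr p \<partial>M) powr (1 / p)"

definition Lp_norm_tuple ::
  "real \<Rightarrow> nat set \<Rightarrow> (nat \<Rightarrow> 'a measure) \<Rightarrow> (nat \<Rightarrow> 'a \<Rightarrow> real) \<Rightarrow> real" where
  "Lp_norm_tuple p I \<gamma> f = (\<Sum>i\<in>I. Lp_norm p (\<gamma> i) (f i) powr p) powr (1 / p)"

definition oplus :: "nat set \<Rightarrow> (nat \<Rightarrow> 'a \<Rightarrow> real) \<Rightarrow> (nat \<Rightarrow> 'a) \<Rightarrow> real" where
  "oplus I f x = (\<Sum>i\<in>I. f i (x i))"

definition edom :: "(real \<Rightarrow> ereal) \<Rightarrow> real set" where
  "edom \<phi> = {x. \<bar>\<phi> x\<bar> \<noteq> \<infinity>}"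

definition Gamma0 :: "(real \<Rightarrow> ereal) set" where
  "Gamma0 = {\<phi>.
     (\<forall>x. \<phi> x \<noteq> -\<infinity>) \<and> (\<exists>x. \<phi> x \<noteq> \<infinity>) \<and>
     (\<forall>x y t. 0 < t \<and> t < 1 \<longrightarrow>
        \<phi> ((1 - t) * x + t * y) \<le> ereal (1 - t) * \<phi> x + ereal t * \<phi> y) \<and>
     (\<forall>x. \<phi> x \<le> Liminf (at x) \<phi>)}"

definition entropy_function :: "(real \<Rightarrow> ereal) \<Rightarrow> bool" where
  "entropy_function \<phi> \<longleftrightarrow>
     \<phi> \<in> Gamma0 \<and> (\<forall>x. 0 \<le> \<phi> x) \<and> \<phi> 1 = 0 \<and> (\<forall>x<0. \<phi> x = \<infinity>)"

definition conj_fun :: "(real \<Rightarrow> ereal) \<Rightarrow> real \<Rightarrow> ereal" where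
  "conj_fun \<phi> q = (SUP x. ereal (q * x) - \<phi> x)"

text \<open>As usual for extended real functions, strictness is required on the effective domain.\<close>

definition strictly_convex :: "(real \<Rightarrow> ereal) \<Rightarrow> bool" where
  "strictly_convex \<psi> \<longleftrightarrow>
     (\<forall>x\<in>edom \<psi>. \<forall>y\<in>edom \<psi>. \<forall>t. x \<noteq> y \<and> 0 < t \<and> t < 1 \<longrightarrow>
        \<psi> ((1 - t) * x + t * y) < ereal (1 - t) * \<psi> x + ereal t * \<psi> y)"

text \<open>The argument \<open>\<psi>\<close> is the conjugate itself, so \<open>aprox \<epsilon> (conj_fun \<phi>)\<close> is the
  anisotropic proximity operator of the conjugate of \<open>\<phi>\<close>.\<close>

definition aprox :: "real \<Rightarrow> (real \<Rightarrow> ereal) \<Rightarrow> real \<Rightarrow> real" where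
  "aprox \<epsilon> \<psi> p = arg_min (\<lambda>q. ereal (\<epsilon> * exp ((p - q) / \<epsilon>)) + \<psi> q) (\<lambda>_. True)"

definition dual_functional ::
  "nat set \<Rightarrow> real \<Rightarrow> (nat \<Rightarrow> real \<Rightarrow> ereal) \<Rightarrow> (nat \<Rightarrow> 'a measure) \<Rightarrow> (nat \<Rightarrow> 'a measure) \<Rightarrow>
   ((nat \<Rightarrow> 'a) \<Rightarrow> real) \<Rightarrow> (nat \<Rightarrow> 'a \<Rightarrow> real) \<Rightarrow> ereal" where
  "dual_functional I \<epsilon> \<phi> \<mu> \<gamma> c f =
     - (\<Sum>i\<in>I. ext_integral (\<mu> i) (\<lambda>x. conj_fun (\<phi> i) (- f i x)))
     - ereal (\<epsilon> * (\<integral>x. exp ((oplus I f x - c x) / \<epsilon>) \<partial>PiM I \<gamma>))"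

definition dual_objective ::
  "nat set \<Rightarrow> real \<Rightarrow> (nat \<Rightarrow> real \<Rightarrow> ereal) \<Rightarrow> (nat \<Rightarrow> 'a measure) \<Rightarrow> (nat \<Rightarrow> 'a measure) \<Rightarrow>
   ((nat \<Rightarrow> 'a) \<Rightarrow> real) \<Rightarrow> (nat \<Rightarrow> 'a \<Rightarrow> real) \<Rightarrow> ereal" where
  "dual_objective I \<epsilon> \<phi> \<mu> \<gamma> c f =
     dual_functional I \<epsilon> \<phi> \<mu> \<gamma> c f + ereal (\<epsilon> * measure (PiM I \<gamma>) (space (PiM I \<gamma>)))"

definition dual_optimal ::
  "nat set \<Rightarrow> real \<Rightarrow> (nat \<Rightarrow> real \<Rightarrow> ereal) \<Rightarrow> (nat \<Rightarrow> 'a measure) \<Rightarrow> (nat \<Rightarrow> 'a measure) \<Rightarrow>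
   ((nat \<Rightarrow> 'a) \<Rightarrow> real) \<Rightarrow> (nat \<Rightarrow> 'a \<Rightarrow> real) \<Rightarrow> bool" where
  "dual_optimal I \<epsilon> \<phi> \<mu> \<gamma> c f \<longleftrightarrow>
     f \<in> Linf_tuples I \<gamma> \<and>
     dual_objective I \<epsilon> \<phi> \<mu> \<gamma> c f = (SUP g\<in>Linf_tuples I \<gamma>. dual_objective I \<epsilon> \<phi> \<mu> \<gamma> c g)"

text \<open>\<open>ln 0 = 0\<close> plays no role here: under the assumption that the logarithms of the
  densities are essentially bounded, the densities vanish only on null sets.\<close>

definition c_transform ::
  "nat set \<Rightarrow> real \<Rightarrow> (nat \<Rightarrow> 'a measure) \<Rightarrow> (nat \<Rightarrow> 'a measure) \<Rightarrow> ((nat \<Rightarrow> 'a) \<Rightarrow> real) \<Rightarrow>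
   nat \<Rightarrow> (nat \<Rightarrow> 'a \<Rightarrow> real) \<Rightarrow> 'a \<Rightarrow> real" where
  "c_transform I \<epsilon> \<mu> \<gamma> c j f x =
     \<epsilon> * ln (enn2real (RN_deriv (\<gamma> j) (\<mu> j) x))
     - \<epsilon> * ln (\<integral>y. exp ((oplus (I - {j}) f y - c (y(j := x))) / \<epsilon>) \<partial>PiM (I - {j}) \<gamma>)"

definition sinkhorn_map ::
  "nat set \<Rightarrow> real \<Rightarrow> (nat \<Rightarrow> real \<Rightarrow> ereal) \<Rightarrow> (nat \<Rightarrow> 'a measure) \<Rightarrow> (nat \<Rightarrow> 'a measure) \<Rightarrow>
   ((nat \<Rightarrow> 'a) \<Rightarrow> real) \<Rightarrow> nat \<Rightarrow> (nat \<Rightarrow> 'a \<Rightarrow> real) \<Rightarrow> 'a \<Rightarrow> real" where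
  "sinkhorn_map I \<epsilon> \<phi> \<mu> \<gamma> c j f x =
     - aprox \<epsilon> (conj_fun (\<phi> j)) (- c_transform I \<epsilon> \<mu> \<gamma> c j f x)"

text \<open>Step \<open>n + 1 = r N + j\<close> with \<open>1 \<le> j \<le> N\<close> updates component \<open>j = n mod N + 1\<close>.\<close>

primrec sinkhorn_seq ::
  "nat \<Rightarrow> real \<Rightarrow> (nat \<Rightarrow> real \<Rightarrow> ereal) \<Rightarrow> (nat \<Rightarrow> 'a measure) \<Rightarrow> (nat \<Rightarrow> 'a measure) \<Rightarrow>
   ((nat \<Rightarrow> 'a) \<Rightarrow> real) \<Rightarrow> (nat \<Rightarrow> 'a \<Rightarrow> real) \<Rightarrow> nat \<Rightarrow> nat \<Rightarrow> 'a \<Rightarrow> real" where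
  "sinkhorn_seq N \<epsilon> \<phi> \<mu> \<gamma> c f0 0 = f0"
| "sinkhorn_seq N \<epsilon> \<phi> \<mu> \<gamma> c f0 (Suc n) =
     (let f = sinkhorn_seq N \<epsilon> \<phi> \<mu> \<gamma> c f0 n; j = n mod N + 1
      in f(j := sinkhorn_map {1..N} \<epsilon> \<phi> \<mu> \<gamma> c j f))"

end

theory Submission
  imports Defs
begin

text \<open>Write \<open>\<psi>\<^sub>i\<close> for the conjugate of \<open>\<phi>\<^sub>i\<close>. Up to sign the dual functional is the convex cost
\<open>\<Sum>i. \<integral> \<psi>\<^sub>i(- f\<^sub>i) d\<mu>\<^sub>i + \<epsilon> \<integral> E\<^sub>f d\<gamma>\<close> with the plan density \<open>E\<^sub>f = exp ((f\<^sup>\<oplus> - c) / \<epsilon>)\<close>, and a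
Sinkhorn step is exact minimisation of the cost in one component. The proof is a quantitative version of
the convergence proof for cyclic block coordinate descent. It needs no compactness in function space,
because a minimiser \<open>h\<close> is given and every iterate can be compared with it directly.

A step in component \<open>j\<close> is pointwise minimisation of \<open>\<epsilon> exp ((p - q) / \<epsilon>) + \<psi>\<^sub>j(q)\<close>. Its optimality
condition says that \<open>exp ((p - q) / \<epsilon>)\<close> is a subgradient of \<open>\<psi>\<^sub>j\<close> at \<open>q\<close> (\<open>aprox_subgradient\<close>);
integrated, it says that the \<open>j\<close>-th marginal of the new plan density is a subgradient of
the \<open>j\<close>-th cost (\<open>skmap_variational\<close>). Together with the strong convexity of \<open>exp\<close> on bounded sets this gives
a decrease of the cost by at least a multiple of the squared \<open>L\<^sup>2\<close> distance between the sums before and after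
the step (\<open>skmap_decrease\<close>).

Strong convexity is only available with uniform bounds. The proximity operator is nonexpansive, so after an
update a component oscillates by at most a constant depending on \<open>c\<close> and the densities (\<open>skmap_osc_le\<close>), and it is
controlled by one real number. For these numbers the cost is coercive: \<open>\<psi>\<^sub>i\<close> grows faster than any linear
function for \<open>i < N\<close>, \<open>\<psi>\<^sub>N(q) \<ge> q\<close>, and the exponential term prevents the sum from escaping
(\<open>apriori_bound\<close>). As the cost decreases along the iteration, all iterates are bounded, hence the increments
of the sums tend to zero (\<open>increments_null\<close>).

At step \<open>n\<close> every component was updated at most \<open>N\<close> steps ago, so it satisfies its optimality condition up to
an error that tends to zero (\<open>gap_window\<close>). Adding these conditions, tested against \<open>h\<close>, to the strong
convexity inequality for the exponential gives
\<open>cost h \<ge> cost f\<^sup>n + \<kappa> \<parallel>f\<^sup>n\<^sup>\<oplus> - h\<^sup>\<oplus>\<parallel>\<^sub>2\<^sup>2 - o(1)\<close>, and \<open>cost h \<le> cost f\<^sup>n\<close> yields the convergence of the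
sums (\<open>oplus_L1_null\<close>).

If the sums converge, Fubini shows that each component converges up to an additive constant
(\<open>component_deviation\<close>). A nonzero limit \<open>\<tau>\<close> of these constants for an index with strictly convex \<open>\<psi>\<^sub>i\<close>
is impossible: lower semicontinuity and the optimality conditions give
\<open>\<integral> \<psi>\<^sub>i(- h\<^sub>i - \<tau>) d\<mu>\<^sub>i \<le> \<integral> \<psi>\<^sub>i(- h\<^sub>i) d\<mu>\<^sub>i - \<tau> m\<close>, where \<open>m\<close> is the mass of the plan of \<open>h\<close>, and by strict
convexity the value at \<open>\<tau> / 2\<close> falls below the tangent at \<open>h\<close>, against the optimality of \<open>h\<close>
(\<open>shift_null\<close>). As the constants sum to \<open>o(1)\<close>, strict convexity for \<open>N - 1\<close> indices is enough. Uniqueness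
follows from convergence, since the same sequence converges to every minimiser.\<close>

section \<open>Conjugates of entropy functions\<close>

text \<open>Upper bounds are the convenient way to work with the conjugate: they reduce to affine inequalities
over the points where \<open>\<phi>\<close> is finite, which avoids all arithmetic with infinite values.\<close>

lemma conj_fun_le_iff:
  assumes "\<And>x. 0 \<le> \<phi> x"
  shows "conj_fun \<phi> q \<le> ereal K \<longleftrightarrow> (\<forall>z r. \<phi> z = ereal r \<longrightarrow> q * z - r \<le> K)"
proof -
  have "conj_fun \<phi> q \<le> ereal K \<longleftrightarrow> (\<forall>z. ereal (q * z) - \<phi> z \<le> ereal K)"
    unfolding conj_fun_def by (simp add: SUP_le_iff)
  also have "\<dots> \<longleftrightarrow> (\<forall>z r. \<phi> z = ereal r \<longrightarrow> q * z - r \<le> K)"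
  proof (intro iffI allI impI)
    fix z r assume "\<forall>z. ereal (q * z) - \<phi> z \<le> ereal K" "\<phi> z = ereal r"
    then have "ereal (q * z) - ereal r \<le> ereal K" by metis
    then show "q * z - r \<le> K" by simp
  next
    fix z assume *: "\<forall>z r. \<phi> z = ereal r \<longrightarrow> q * z - r \<le> K"
    show "ereal (q * z) - \<phi> z \<le> ereal K"
      using * assms[of z] by (cases "\<phi> z") auto
  qed
  finally show ?thesis .
qed

lemma conj_fun_leD:
  assumes "entropy_function \<phi>" "conj_fun \<phi> q \<le> ereal K" "\<phi> z = ereal r"
  shows "q * z - r \<le> K"
  using assms conj_fun_le_iff[of \<phi> q K] by (simp add: entropy_function_def)

text \<open>The affine minorant comes from the point 1, where an entropy function vanishes. It keeps the
conjugate away from \<open>-\<infinity>\<close> and makes the negative parts of all integrals below finite.\<close>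

lemma conj_fun_ge:
  assumes "entropy_function \<phi>"
  shows "ereal q \<le> conj_fun \<phi> q"
proof -
  have "ereal (q * 1) - \<phi> 1 \<le> conj_fun \<phi> q"
    unfolding conj_fun_def by (rule SUP_upper) simp
  then show ?thesis using assms by (simp add: entropy_function_def zero_ereal_def)
qed

lemma entropy_nonneg: "entropy_function \<phi> \<Longrightarrow> 0 \<le> \<phi> x"
  by (simp add: entropy_function_def)

lemma entropy_dom: "entropy_function \<phi> \<Longrightarrow> \<phi> z = ereal r \<Longrightarrow> 0 \<le> z \<and> 0 \<le> r"
  using entropy_nonneg[of \<phi> z] by (cases "z < 0") (auto simp: entropy_function_def)

lemma conj_fun_mono:
  assumes "entropy_function \<phi>" "q \<le> q'"
  shows "conj_fun \<phi> q \<le> conj_fun \<phi> q'"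
  unfolding conj_fun_def
proof (rule SUP_mono)
  fix z
  show "\<exists>z'\<in>UNIV. ereal (q * z) - \<phi> z \<le> ereal (q' * z') - \<phi> z'"
  proof (intro bexI[of _ z])
    show "ereal (q * z) - \<phi> z \<le> ereal (q' * z) - \<phi> z"
      using assms entropy_dom[OF assms(1), of z] entropy_nonneg[OF assms(1), of z]
      by (cases "\<phi> z") (auto intro: mult_right_mono)
  qed simp
qed

lemma conj_fun_real:
  assumes "entropy_function \<phi>" "conj_fun \<phi> q < \<infinity>"
  shows "conj_fun \<phi> q = ereal (real_of_ereal (conj_fun \<phi> q))"
  using conj_fun_ge[OF assms(1), of q] assms(2) by (cases "conj_fun \<phi> q") auto

lemma conj_fun_nonpos:
  assumes "entropy_function \<phi>" "q \<le> 0"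
  shows "conj_fun \<phi> q \<le> 0"
proof -
  have "conj_fun \<phi> q \<le> ereal 0"
  proof (subst conj_fun_le_iff[OF entropy_nonneg[OF assms(1)]], intro allI impI)
    fix z r assume "\<phi> z = ereal r"
    then have "0 \<le> z" "0 \<le> r" using entropy_dom[OF assms(1)] by auto
    then show "q * z - r \<le> 0" using assms(2) mult_nonpos_nonneg[of q z] by linarith
  qed
  then show ?thesis by (simp add: zero_ereal_def)
qed

lemma conj_fun_convex:
  assumes "entropy_function \<phi>" "0 \<le> t" "t \<le> 1"
    and "conj_fun \<phi> x \<le> ereal a" "conj_fun \<phi> y \<le> ereal b"
  shows "conj_fun \<phi> ((1 - t) * x + t * y) \<le> ereal ((1 - t) * a + t * b)"
proof (subst conj_fun_le_iff[OF entropy_nonneg[OF assms(1)]], intro allI impI)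
  fix z r assume z: "\<phi> z = ereal r"
  have "x * z - r \<le> a" "y * z - r \<le> b"
    by (rule conj_fun_leD[OF assms(1,4) z], rule conj_fun_leD[OF assms(1,5) z])
  then have "(1 - t) * (x * z - r) + t * (y * z - r) \<le> (1 - t) * a + t * b"
    using assms by (intro add_mono mult_left_mono) auto
  then show "((1 - t) * x + t * y) * z - r \<le> (1 - t) * a + t * b"
    by (simp add: algebra_simps)
qed

text \<open>A supremum of affine functions is lower semicontinuous; the sequential form with varying bounds is
the one needed for minimising sequences and for Fatou's lemma.\<close>

lemma conj_fun_lsc:
  assumes "entropy_function \<phi>" "q \<longlonglongrightarrow> l" "k \<longlonglongrightarrow> K"
    and "\<And>n::nat. conj_fun \<phi> (q n) \<le> ereal (k n)"
  shows "conj_fun \<phi> l \<le> ereal K"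
proof (subst conj_fun_le_iff[OF entropy_nonneg[OF assms(1)]], intro allI impI)
  fix z r assume z: "\<phi> z = ereal r"
  have "q n * z - r \<le> k n" for n
    by (rule conj_fun_leD[OF assms(1,4) z])
  moreover have "(\<lambda>n. q n * z - r) \<longlonglongrightarrow> l * z - r"
    by (intro tendsto_intros assms)
  ultimately show "l * z - r \<le> K"
    using LIMSEQ_le assms(3) by blast
qed

text \<open>If \<open>\<phi>\<close> is finite on the whole half line, every slope \<open>L\<close> is admissible in the supremum, so the
conjugate is superlinear at \<open>\<infinity>\<close>; finiteness at 0 bounds it from below.\<close>

lemma conj_fun_coercive:
  assumes "entropy_function \<phi>" "{0..} \<subseteq> edom \<phi>" "0 \<le> L"
  shows "\<exists>C. \<forall>q. ereal (L * max q 0 - C) \<le> conj_fun \<phi> q"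
proof -
  obtain r0 where r0: "\<phi> 0 = ereal r0" using assms(2) by (cases "\<phi> 0") (auto simp: edom_def)
  obtain r1 where r1: "\<phi> L = ereal r1"
    using assms(2,3) by (cases "\<phi> L") (auto simp: edom_def)
  have "ereal (L * max q 0 - (\<bar>r0\<bar> + \<bar>r1\<bar>)) \<le> conj_fun \<phi> q" for q
  proof (cases "q \<le> 0")
    case True
    have "ereal (q * 0) - \<phi> 0 \<le> conj_fun \<phi> q"
      unfolding conj_fun_def by (rule SUP_upper) simp
    moreover have "ereal (L * max q 0 - (\<bar>r0\<bar> + \<bar>r1\<bar>)) \<le> ereal (q * 0) - \<phi> 0"
      using True r0 by simp
    ultimately show ?thesis by (rule order_trans[rotated])
  next
    case False
    have "ereal (q * L) - \<phi> L \<le> conj_fun \<phi> q"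
      unfolding conj_fun_def by (rule SUP_upper) simp
    moreover have "ereal (L * max q 0 - (\<bar>r0\<bar> + \<bar>r1\<bar>)) \<le> ereal (q * L) - \<phi> L"
      using False r1 by (simp add: mult.commute)
    ultimately show ?thesis by (rule order_trans[rotated])
  qed
  then show ?thesis by blast
qed

lemma conj_fun_borel [measurable]:
  assumes "entropy_function \<phi>"
  shows "conj_fun \<phi> \<in> borel_measurable borel"
proof (rule borel_measurableI_le)
  fix y
  let ?S = "{x \<in> space borel. conj_fun \<phi> x \<le> y}"
  have "is_interval ?S"
    unfolding is_interval_1 by (auto intro: order_trans[OF conj_fun_mono[OF assms]])
  then show "?S \<in> sets borel"
    by (rule real_interval_borel_measurable)
qed

section \<open>The anisotropic proximity operator\<close>

text \<open>Compare with the tangent of the exponential of slope \<open>\<alpha>\<close>.\<close>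

lemma exp_dominates_linear:
  fixes A \<epsilon> \<alpha> :: real
  assumes "0 < A" "0 < \<epsilon>" "0 < \<alpha>"
  shows "\<exists>C. \<forall>y. \<alpha> * y - C \<le> A * exp (y / \<epsilon>)"
proof -
  define s where "s = ln (\<alpha> * \<epsilon> / A)"
  have "\<alpha> * y - (\<alpha> * \<epsilon> * s - \<alpha> * \<epsilon>) \<le> A * exp (y / \<epsilon>)" for y
  proof -
    have "1 + (y / \<epsilon> - s) \<le> exp (y / \<epsilon> - s)" by (rule exp_ge_add_one_self)
    then have "\<alpha> * \<epsilon> * (1 + (y / \<epsilon> - s)) \<le> \<alpha> * \<epsilon> * exp (y / \<epsilon> - s)"
      using assms by (intro mult_left_mono) auto
    also have "\<dots> = A * exp (y / \<epsilon>)"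
      using assms by (simp add: exp_diff s_def)
    finally have "\<alpha> * \<epsilon> * (1 + (y / \<epsilon> - s)) \<le> A * exp (y / \<epsilon>)" .
    moreover have "\<alpha> * \<epsilon> * (1 + (y / \<epsilon> - s)) = \<alpha> * y - (\<alpha> * \<epsilon> * s - \<alpha> * \<epsilon>)"
      using assms by (simp add: algebra_simps)
    ultimately show ?thesis by simp
  qed
  then show ?thesis by blast
qed

text \<open>The first order condition for minimising a convex function plus an exponential. The hypothesis is
minimality along a segment, where \<open>A\<close> is the increment of the convex function along the whole segment; dividing
by \<open>\<theta>\<close> and letting \<open>\<theta> \<rightarrow> 0\<close> leaves the derivative of the exponential. It is used twice: pointwise for
the proximity operator and for constant shifts of an optimal potential.\<close>

lemma tangent_of_exp_bound:
  fixes A E \<epsilon> \<tau> :: real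
  assumes "0 < \<epsilon>"
    and "\<And>\<theta>. 0 < \<theta> \<Longrightarrow> \<theta> < 1 \<Longrightarrow> \<epsilon> * E \<le> \<theta> * A + \<epsilon> * E * exp (\<theta> * \<tau> / \<epsilon>)"
  shows "- (\<tau> * E) \<le> A"
proof -
  have "((\<lambda>\<theta>. exp (\<theta> * \<tau> / \<epsilon>)) has_real_derivative \<tau> / \<epsilon>) (at 0)"
    using assms(1) by (auto intro!: derivative_eq_intros)
  then have "((\<lambda>\<theta>. (exp (\<theta> * \<tau> / \<epsilon>) - 1) / \<theta>) \<longlongrightarrow> \<tau> / \<epsilon>) (at 0)"
    by (simp add: has_field_derivative_iff)
  then have "((\<lambda>\<theta>. (exp (\<theta> * \<tau> / \<epsilon>) - 1) / \<theta>) \<longlongrightarrow> \<tau> / \<epsilon>) (at_right 0)"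
    by (rule filterlim_mono) (auto simp: at_within_le_at)
  then have "((\<lambda>\<theta>. - (\<epsilon> * E) * ((exp (\<theta> * \<tau> / \<epsilon>) - 1) / \<theta>)) \<longlongrightarrow> - (\<epsilon> * E) * (\<tau> / \<epsilon>)) (at_right 0)"
    by (intro tendsto_mult_left)
  moreover have "\<forall>\<^sub>F \<theta> in at_right 0. - (\<epsilon> * E) * ((exp (\<theta> * \<tau> / \<epsilon>) - 1) / \<theta>) \<le> A"
    unfolding eventually_at_right_field
  proof (intro exI[of _ 1] conjI allI impI)
    fix \<theta> :: real assume "0 < \<theta>" "\<theta> < 1"
    with assms(2)[of \<theta>] show "- (\<epsilon> * E) * ((exp (\<theta> * \<tau> / \<epsilon>) - 1) / \<theta>) \<le> A"
      by (simp add: field_simps)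
  qed simp
  ultimately have "- (\<epsilon> * E) * (\<tau> / \<epsilon>) \<le> A"
    by (rule tendsto_upperbound) simp
  then show ?thesis using assms(1) by (simp add: field_simps)
qed

text \<open>The direct method: the exponential forces minimising sequences to be bounded below, the bound
\<open>\<psi>(q) \<ge> q\<close> forces them to be bounded above, and lower semicontinuity applies to a convergent
subsequence.\<close>

lemma aprox_exists:
  assumes ent: "entropy_function \<phi>" and eps: "0 < \<epsilon>"
  shows "\<exists>q. \<forall>q'. ereal (\<epsilon> * exp ((p - q) / \<epsilon>)) + conj_fun \<phi> q
                \<le> ereal (\<epsilon> * exp ((p - q') / \<epsilon>)) + conj_fun \<phi> q'"
proof -
  let ?e = "\<lambda>q. \<epsilon> * exp ((p - q) / \<epsilon>)"
  let ?h = "\<lambda>q. ereal (?e q) + conj_fun \<phi> q"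
  define K where "K = {k. \<exists>q. ?h q \<le> ereal k}"
  have hk: "?h q \<le> ereal k \<longleftrightarrow> conj_fun \<phi> q \<le> ereal (k - ?e q)" for q k
    using conj_fun_ge[OF ent, of q] by (cases "conj_fun \<phi> q") auto
  have lower: "?e q + q \<le> k" if "?h q \<le> ereal k" for q k
    using that[unfolded hk] conj_fun_ge[OF ent, of q]
    by (metis add.commute ereal_less_eq(3) le_diff_eq order_trans)
  have "?h 0 \<le> ereal (?e 0)"
    unfolding hk using conj_fun_nonpos[OF ent, of 0] by (simp add: zero_ereal_def)
  then have "?e 0 \<in> K"
    unfolding K_def by blast
  then have ne: "K \<noteq> {}" by blast
  have bdd: "bdd_below K"
  proof (rule bdd_belowI[of _ "\<epsilon> + p"])
    fix k assume "k \<in> K"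
    then obtain q where "?e q + q \<le> k" using lower by (auto simp: K_def)
    moreover have "\<epsilon> * (1 + (p - q) / \<epsilon>) \<le> ?e q"
      using eps by (intro mult_left_mono exp_ge_add_one_self) auto
    moreover have "\<epsilon> * (1 + (p - q) / \<epsilon>) = \<epsilon> + p - q"
      using eps by (simp add: field_simps)
    ultimately show "\<epsilon> + p \<le> k" by linarith
  qed
  define m where "m = Inf K"
  have "\<exists>q. ?h q \<le> ereal (m + inverse (real (Suc n)))" for n
  proof -
    have "\<exists>k\<in>K. k < m + inverse (real (Suc n))"
      using cInf_lessD[OF ne, of "m + inverse (real (Suc n))"] unfolding m_def by simp
    then obtain k q where k: "k < m + inverse (real (Suc n))" "?h q \<le> ereal k"
      by (auto simp: K_def)
    show ?thesis
      by (rule exI[of _ q], rule order_trans[OF k(2)]) (use k(1) in simp)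
  qed
  then obtain q where q: "\<And>n. ?h (q n) \<le> ereal (m + inverse (real (Suc n)))"
    by metis
  obtain C where C: "\<And>y. 2 * y - C \<le> \<epsilon> * exp (y / \<epsilon>)"
    using exp_dominates_linear[of \<epsilon> \<epsilon> 2] eps by auto
  have q1: "?e (q n) + q n \<le> m + 1" for n
  proof -
    have "inverse (real (Suc n)) \<le> 1" by (simp add: field_simps)
    then show ?thesis using lower[OF q[of n]] by linarith
  qed
  have "q n \<in> {2 * p - C - m - 1 .. m + 1}" for n
  proof -
    have "0 < ?e (q n)" using eps by simp
    then show ?thesis using q1[of n] C[of "p - q n"] by auto
  qed
  then obtain l r where l: "strict_mono r" "(q \<circ> r) \<longlonglongrightarrow> l"
    using compact_Icc[unfolded compact_def, rule_format, of q] by metis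
  have "conj_fun \<phi> l \<le> ereal (m - ?e l)"
  proof (rule conj_fun_lsc[OF ent l(2)])
    have "(\<lambda>n. inverse (real (Suc (r n)))) \<longlonglongrightarrow> 0"
      using LIMSEQ_subseq_LIMSEQ[OF LIMSEQ_inverse_real_of_nat l(1)] by (simp add: o_def)
    then have "(\<lambda>n. m + inverse (real (Suc (r n))) - ?e ((q \<circ> r) n)) \<longlonglongrightarrow> m + 0 - ?e l"
      by (intro tendsto_intros l(2)) (use eps in auto)
    then show "(\<lambda>n. m + inverse (real (Suc (r n))) - ?e ((q \<circ> r) n)) \<longlonglongrightarrow> m - ?e l"
      by simp
    show "conj_fun \<phi> ((q \<circ> r) n) \<le> ereal (m + inverse (real (Suc (r n))) - ?e ((q \<circ> r) n))" for n
      using q[of "r n"] unfolding hk by (simp add: o_def)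
  qed
  then have min: "?h l \<le> ereal m" unfolding hk by simp
  show ?thesis
  proof (intro exI[of _ l] allI)
    fix q'
    show "?h l \<le> ?h q'"
    proof (cases "?h q'")
      case (real k)
      then have "k \<in> K" unfolding K_def by (auto intro!: exI[of _ q'])
      then have "m \<le> k" unfolding m_def using bdd by (rule cInf_lower)
      then show ?thesis using min real by (simp add: order_trans)
    next
      case MInf
      then show ?thesis using conj_fun_ge[OF ent, of q'] by (cases "conj_fun \<phi> q'") auto
    qed simp
  qed
qed

lemma aprox_min:
  assumes "entropy_function \<phi>" "0 < \<epsilon>"
  shows "ereal (\<epsilon> * exp ((p - aprox \<epsilon> (conj_fun \<phi>) p) / \<epsilon>)) + conj_fun \<phi> (aprox \<epsilon> (conj_fun \<phi>) p)
       \<le> ereal (\<epsilon> * exp ((p - q') / \<epsilon>)) + conj_fun \<phi> q'"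
proof -
  let ?h = "\<lambda>q. ereal (\<epsilon> * exp ((p - q) / \<epsilon>)) + conj_fun \<phi> q"
  obtain q where "\<forall>q'. ?h q \<le> ?h q'" using aprox_exists[OF assms] by blast
  then have "is_arg_min ?h (\<lambda>_. True) q"
    by (auto simp: is_arg_min_def not_less)
  then have "is_arg_min ?h (\<lambda>_. True) (aprox \<epsilon> (conj_fun \<phi>) p)"
    unfolding aprox_def arg_min_def by (rule someI)
  then show ?thesis by (auto simp: is_arg_min_def not_less)
qed

lemma aprox_conj_le:
  assumes "entropy_function \<phi>" "0 < \<epsilon>"
  shows "conj_fun \<phi> (aprox \<epsilon> (conj_fun \<phi>) p) \<le> ereal (\<epsilon> * exp (p / \<epsilon>))"
proof -
  let ?q = "aprox \<epsilon> (conj_fun \<phi>) p"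
  have "ereal (\<epsilon> * exp ((p - ?q) / \<epsilon>)) + conj_fun \<phi> ?q \<le> ereal (\<epsilon> * exp (p / \<epsilon>))"
    using aprox_min[OF assms, of p 0] conj_fun_nonpos[OF assms(1), of 0]
    by (cases "conj_fun \<phi> 0") (auto intro: order_trans)
  moreover have "0 < \<epsilon> * exp ((p - ?q) / \<epsilon>)" using assms(2) by simp
  ultimately show ?thesis
    by (cases "conj_fun \<phi> ?q") auto
qed

lemma aprox_subgradient:
  assumes "entropy_function \<phi>" "0 < \<epsilon>" "q = aprox \<epsilon> (conj_fun \<phi>) p"
    and "conj_fun \<phi> q' \<le> ereal b"
  shows "conj_fun \<phi> q \<le> ereal (b - exp ((p - q) / \<epsilon>) * (q' - q))"
proof -
  have fin: "conj_fun \<phi> q < \<infinity>"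
    using aprox_conj_le[OF assms(1,2), of p] assms(3) by (auto simp: less_top[symmetric] top_ereal_def)
  then obtain a where a: "conj_fun \<phi> q = ereal a" using conj_fun_real[OF assms(1)] by blast
  have "- ((q - q') * exp ((p - q) / \<epsilon>)) \<le> b - a"
  proof (rule tangent_of_exp_bound[OF assms(2)])
    fix \<theta> :: real assume \<theta>: "0 < \<theta>" "\<theta> < 1"
    let ?q = "(1 - \<theta>) * q + \<theta> * q'"
    have "ereal (\<epsilon> * exp ((p - q) / \<epsilon>)) + ereal a \<le> ereal (\<epsilon> * exp ((p - ?q) / \<epsilon>)) + conj_fun \<phi> ?q"
      using aprox_min[OF assms(1,2), of p ?q] a assms(3) by simp
    also have "conj_fun \<phi> ?q \<le> ereal ((1 - \<theta>) * a + \<theta> * b)"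
      using conj_fun_convex[OF assms(1), of \<theta>] \<theta> a assms(4) by simp
    finally have "\<epsilon> * exp ((p - q) / \<epsilon>) + a \<le> \<epsilon> * exp ((p - ?q) / \<epsilon>) + ((1 - \<theta>) * a + \<theta> * b)"
      by (simp add: add_left_mono)
    moreover have "exp ((p - ?q) / \<epsilon>) = exp ((p - q) / \<epsilon>) * exp (\<theta> * (q - q') / \<epsilon>)"
      by (simp add: exp_add[symmetric] add_divide_distrib[symmetric] algebra_simps)
    ultimately show "\<epsilon> * exp ((p - q) / \<epsilon>) \<le> \<theta> * (b - a) + \<epsilon> * exp ((p - q) / \<epsilon>) * exp (\<theta> * (q - q') / \<epsilon>)"
      by (simp add: algebra_simps)
  qed
  then show ?thesis using a by (simp add: algebra_simps)
qed

text \<open>Subgradients of a convex function increase. For the subgradients \<open>exp ((p - q) / \<epsilon>)\<close> this means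
that \<open>p - q\<close> increases with \<open>q\<close>, which contains both the monotonicity and the nonexpansiveness of the operator.\<close>

lemma aprox_subgradients_monotone:
  assumes "entropy_function \<phi>" "0 < \<epsilon>"
    and "q = aprox \<epsilon> (conj_fun \<phi>) p" "q' = aprox \<epsilon> (conj_fun \<phi>) p'" "q < q'"
  shows "p - q \<le> p' - q'"
proof -
  obtain a where a: "conj_fun \<phi> q = ereal a"
    using conj_fun_real[OF assms(1)] aprox_conj_le[OF assms(1,2), of p] assms(3)
    by (metis ereal_less_PInfty less_ereal.simps(2) order_le_less_trans)
  obtain b where b: "conj_fun \<phi> q' = ereal b"
    using conj_fun_real[OF assms(1)] aprox_conj_le[OF assms(1,2), of p'] assms(4)
    by (metis ereal_less_PInfty less_ereal.simps(2) order_le_less_trans)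
  have "a \<le> b - exp ((p - q) / \<epsilon>) * (q' - q)"
    using aprox_subgradient[OF assms(1,2,3), of q' b] a b by simp
  moreover have "b \<le> a - exp ((p' - q') / \<epsilon>) * (q - q')"
    using aprox_subgradient[OF assms(1,2,4), of q a] a b by simp
  ultimately have "exp ((p - q) / \<epsilon>) * (q' - q) \<le> exp ((p' - q') / \<epsilon>) * (q' - q)"
    by (simp add: algebra_simps)
  then have "exp ((p - q) / \<epsilon>) \<le> exp ((p' - q') / \<epsilon>)"
    using assms(5) by simp
  then show ?thesis using assms(2) by (simp add: divide_le_cancel)
qed

lemma aprox_mono:
  assumes "entropy_function \<phi>" "0 < \<epsilon>" "p \<le> p'"
  shows "aprox \<epsilon> (conj_fun \<phi>) p \<le> aprox \<epsilon> (conj_fun \<phi>) p'"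
  using aprox_subgradients_monotone[OF assms(1,2) refl refl, of p' p] assms(3)
  by (cases "aprox \<epsilon> (conj_fun \<phi>) p' < aprox \<epsilon> (conj_fun \<phi>) p") auto

lemma aprox_nonexpansive:
  assumes "entropy_function \<phi>" "0 < \<epsilon>" "p \<le> p'"
  shows "aprox \<epsilon> (conj_fun \<phi>) p' - aprox \<epsilon> (conj_fun \<phi>) p \<le> p' - p"
  using aprox_subgradients_monotone[OF assms(1,2) refl refl, of p p'] assms(3)
  by (cases "aprox \<epsilon> (conj_fun \<phi>) p < aprox \<epsilon> (conj_fun \<phi>) p'") auto

lemma aprox_borel [measurable]:
  assumes "entropy_function \<phi>" "0 < \<epsilon>"
  shows "aprox \<epsilon> (conj_fun \<phi>) \<in> borel_measurable borel"
  by (rule borel_measurable_mono) (auto simp: mono_def intro: aprox_mono[OF assms])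

section \<open>Essentially bounded functions\<close>

text \<open>Membership in \<open>L\<^sup>\<infinity>\<close> for real functions. Its closure properties discharge nearly all integrability
obligations below, because all measures involved are finite.\<close>

definition ess_bounded :: "'b measure \<Rightarrow> ('b \<Rightarrow> real) \<Rightarrow> bool" where
  "ess_bounded M h \<longleftrightarrow> h \<in> borel_measurable M \<and> (\<exists>B. AE x in M. \<bar>h x\<bar> \<le> B)"

lemma ess_boundedI:
  "h \<in> borel_measurable M \<Longrightarrow> (AE x in M. \<bar>h x\<bar> \<le> B) \<Longrightarrow> ess_bounded M h"
  by (auto simp: ess_bounded_def)

lemma ess_bounded_measurable: "ess_bounded M h \<Longrightarrow> h \<in> borel_measurable M"
  by (simp add: ess_bounded_def)

lemma ess_bounded_const: "ess_bounded M (\<lambda>_. k)"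
  by (rule ess_boundedI[of _ _ "\<bar>k\<bar>"]) auto

lemma ess_bounded_add:
  assumes "ess_bounded M f" "ess_bounded M g"
  shows "ess_bounded M (\<lambda>x. f x + g x)"
proof -
  obtain A B where "AE x in M. \<bar>f x\<bar> \<le> A" "AE x in M. \<bar>g x\<bar> \<le> B"
    using assms by (auto simp: ess_bounded_def)
  then have "AE x in M. \<bar>f x + g x\<bar> \<le> A + B" by eventually_elim auto
  then show ?thesis
    by (rule ess_boundedI[rotated]) (use assms in \<open>auto simp: ess_bounded_def\<close>)
qed

lemma ess_bounded_mult:
  assumes "ess_bounded M f" "ess_bounded M g"
  shows "ess_bounded M (\<lambda>x. f x * g x)"
proof -
  obtain A B where "AE x in M. \<bar>f x\<bar> \<le> A" "AE x in M. \<bar>g x\<bar> \<le> B"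
    using assms by (auto simp: ess_bounded_def)
  then have "AE x in M. \<bar>f x * g x\<bar> \<le> A * B"
    by eventually_elim (auto simp: abs_mult intro!: mult_mono intro: order_trans[OF abs_ge_zero])
  then show ?thesis
    by (rule ess_boundedI[rotated]) (use assms in \<open>auto simp: ess_bounded_def\<close>)
qed

lemma ess_bounded_uminus: "ess_bounded M f \<Longrightarrow> ess_bounded M (\<lambda>x. - f x)"
  using ess_bounded_mult[OF ess_bounded_const[of M "-1"]] by fastforce

lemma ess_bounded_diff:
  assumes "ess_bounded M f" "ess_bounded M g"
  shows "ess_bounded M (\<lambda>x. f x - g x)"
  using ess_bounded_add[OF assms(1) ess_bounded_uminus[OF assms(2)]] by simp

lemma ess_bounded_divide: "ess_bounded M f \<Longrightarrow> ess_bounded M (\<lambda>x. f x / k)"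
  using ess_bounded_mult[OF _ ess_bounded_const[of M "inverse k"]] by (simp add: divide_inverse)

lemma ess_bounded_exp:
  assumes "ess_bounded M f"
  shows "ess_bounded M (\<lambda>x. exp (f x))"
proof -
  obtain A where "AE x in M. \<bar>f x\<bar> \<le> A"
    using assms by (auto simp: ess_bounded_def)
  then have "AE x in M. \<bar>exp (f x)\<bar> \<le> exp A" by eventually_elim auto
  then show ?thesis
    by (rule ess_boundedI[rotated]) (use assms in \<open>auto simp: ess_bounded_def\<close>)
qed

lemma ess_bounded_power2:
  "ess_bounded M f \<Longrightarrow> ess_bounded M (\<lambda>x. (f x)\<^sup>2)"
  unfolding power2_eq_square by (rule ess_bounded_mult)

lemma ess_bounded_abs:
  "ess_bounded M f \<Longrightarrow> ess_bounded M (\<lambda>x. \<bar>f x\<bar>)"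
  by (auto simp: ess_bounded_def)

lemma ess_bounded_sum:
  assumes "\<And>i. i \<in> A \<Longrightarrow> ess_bounded M (f i)"
  shows "ess_bounded M (\<lambda>x. \<Sum>i\<in>A. f i x)"
  using assms
  by (induction A rule: infinite_finite_induct) (auto intro: ess_bounded_const ess_bounded_add)

lemmas ess_bounded_intros =
  ess_bounded_const ess_bounded_add ess_bounded_mult ess_bounded_uminus ess_bounded_diff
  ess_bounded_divide ess_bounded_exp ess_bounded_power2 ess_bounded_abs ess_bounded_sum

lemma (in finite_measure) ess_bounded_integrable: "ess_bounded M h \<Longrightarrow> integrable M h"
  unfolding ess_bounded_def real_norm_def[symmetric] by (elim conjE exE) (rule integrable_const_bound)

section \<open>Product measures and their marginals\<close>

text \<open>The product measure only sees the factors with index in \<open>J\<close>, while its values on boxes are known for families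
that are \<open>\<sigma>\<close>-finite at every index. Factors outside \<open>J\<close> are therefore replaced by a trivial measure.\<close>

lemma emeasure_PiM_box:
  assumes "finite J" "\<And>i. i \<in> J \<Longrightarrow> finite_measure (M i)" "\<And>i. i \<in> J \<Longrightarrow> A i \<in> sets (M i)"
  shows "emeasure (PiM J M) (Pi\<^sub>E J A) = (\<Prod>i\<in>J. emeasure (M i) (A i))"
proof -
  let ?M = "\<lambda>i. if i \<in> J then M i else count_space {}"
  have "sigma_finite_measure (?M i)" for i
    using assms(2)[of i] sigma_finite_measure_count_space_finite[of "{}"]
    by (auto simp: finite_measure_def)
  then interpret product_sigma_finite ?M by (rule product_sigma_finite.intro)
  have "emeasure (PiM J ?M) (Pi\<^sub>E J A) = (\<Prod>i\<in>J. emeasure (?M i) (A i))"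
    using assms by (intro emeasure_PiM) auto
  moreover have "PiM J ?M = PiM J M" by (intro PiM_cong) auto
  ultimately show ?thesis by simp
qed

text \<open>The data of the dual problem in the form used by the analytic argument: \<open>\<mu>\<^sub>i\<close> is given by a density
\<open>\<sigma>\<^sub>i\<close> that is bounded away from zero and infinity, and the distinguished index \<open>N\<close> is the one at which the
entropy function may fail to be finite on the half line. The index set is kept abstract.\<close>

locale entropic_dual =
  fixes I :: "nat set" and N :: nat and \<epsilon> :: real and \<phi> :: "nat \<Rightarrow> real \<Rightarrow> ereal"
    and \<mu> \<gamma> :: "nat \<Rightarrow> 'a measure" and c :: "(nat \<Rightarrow> 'a) \<Rightarrow> real" and S C :: real
    and \<sigma> :: "nat \<Rightarrow> 'a \<Rightarrow> real"
  defines "\<sigma> \<equiv> \<lambda>i x. enn2real (RN_deriv (\<gamma> i) (\<mu> i) x)"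
  assumes finite_I: "finite I" and N_in_I: "N \<in> I" and eps_pos: "0 < \<epsilon>"
    and finite_gamma: "i \<in> I \<Longrightarrow> finite_measure (\<gamma> i)"
    and gamma_pos: "i \<in> I \<Longrightarrow> 0 < measure (\<gamma> i) (space (\<gamma> i))"
    and mu_density: "i \<in> I \<Longrightarrow> \<mu> i = density (\<gamma> i) (\<lambda>x. ennreal (\<sigma> i x))"
    and sigma_bounds: "i \<in> I \<Longrightarrow> AE x in \<gamma> i. 0 < \<sigma> i x \<and> \<bar>ln (\<sigma> i x)\<bar> \<le> S"
    and c_measurable: "c \<in> borel_measurable (PiM I \<gamma>)"
    and c_bounds: "x \<in> space (PiM I \<gamma>) \<Longrightarrow> 0 \<le> c x \<and> c x \<le> C"
    and entropy: "i \<in> I \<Longrightarrow> entropy_function (\<phi> i)"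
    and full_domain: "i \<in> I - {N} \<Longrightarrow> {0..} \<subseteq> edom (\<phi> i)"
begin

abbreviation "P \<equiv> PiM I \<gamma>"

text \<open>Agrees with \<open>\<gamma>\<close> on the index set and is \<open>\<sigma>\<close>-finite at every index, so that Fubini's theorem for
product measures applies.\<close>

definition gamma_ext :: "nat \<Rightarrow> 'a measure" where
  "gamma_ext i = (if i \<in> I then \<gamma> i else count_space {})"

lemma PiM_gamma_ext: "J \<subseteq> I \<Longrightarrow> PiM J \<gamma> = PiM J gamma_ext"
  by (intro PiM_cong) (auto simp: gamma_ext_def)

lemma gamma_ext_sigma_finite: "sigma_finite_measure (gamma_ext i)"
  using finite_gamma[of i]
  using sigma_finite_measure_count_space_finite[of "{}"]
  by (auto simp: gamma_ext_def finite_measure_def)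

sublocale G: product_sigma_finite gamma_ext
  by (rule product_sigma_finite.intro) (rule gamma_ext_sigma_finite)

lemma emeasure_box:
  assumes "J \<subseteq> I" "\<And>i. i \<in> J \<Longrightarrow> A i \<in> sets (\<gamma> i)"
  shows "emeasure (PiM J \<gamma>) (Pi\<^sub>E J A) = (\<Prod>i\<in>J. emeasure (\<gamma> i) (A i))"
  using assms finite_subset[OF _ finite_I] finite_gamma by (intro emeasure_PiM_box) auto

lemma finite_PiM:
  assumes "J \<subseteq> I"
  shows "finite_measure (PiM J \<gamma>)"
proof
  have "emeasure (PiM J \<gamma>) (space (PiM J \<gamma>)) = (\<Prod>i\<in>J. emeasure (\<gamma> i) (space (\<gamma> i)))"
    unfolding space_PiM using assms by (intro emeasure_box) auto
  then show "emeasure (PiM J \<gamma>) (space (PiM J \<gamma>)) \<noteq> \<infinity>"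
    using assms finite_gamma
    by (auto simp: ennreal_prod_eq_top finite_measure.emeasure_finite)
qed

lemma measure_PiM_pos:
  assumes "J \<subseteq> I"
  shows "0 < measure (PiM J \<gamma>) (space (PiM J \<gamma>))"
proof -
  have "emeasure (PiM J \<gamma>) (space (PiM J \<gamma>)) = (\<Prod>i\<in>J. emeasure (\<gamma> i) (space (\<gamma> i)))"
    unfolding space_PiM using assms by (intro emeasure_box) auto
  moreover have "emeasure (\<gamma> i) (space (\<gamma> i)) \<noteq> 0" if "i \<in> J" for i
    using gamma_pos[of i] that assms by (auto simp: measure_def)
  ultimately have "emeasure (PiM J \<gamma>) (space (PiM J \<gamma>)) \<noteq> 0"
    using finite_subset[OF assms finite_I] by (simp add: prod_zero_iff)
  then show ?thesis
    using finite_measure.emeasure_eq_measure[OF finite_PiM[OF assms]]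
    by (simp add: zero_less_measure_iff)
qed

text \<open>The exceptional set is contained in a box with one null factor.\<close>

lemma AE_component:
  assumes "J \<subseteq> I" "i \<in> J" "AE x in \<gamma> i. Q x"
  shows "AE y in PiM J \<gamma>. Q (y i)"
proof -
  obtain A where A: "A \<in> null_sets (\<gamma> i)" "{x \<in> space (\<gamma> i). \<not> Q x} \<subseteq> A"
    using assms(3) by (auto simp: eventually_ae_filter)
  let ?B = "\<lambda>k. if k = i then A else space (\<gamma> k)"
  have sets: "?B k \<in> sets (\<gamma> k)" for k using A(1) by auto
  have "emeasure (PiM J \<gamma>) (Pi\<^sub>E J ?B) = (\<Prod>k\<in>J. emeasure (\<gamma> k) (?B k))"
    by (rule emeasure_box[OF assms(1) sets])
  also have "\<dots> = 0"
    using assms(1,2) A(1) finite_subset[OF _ finite_I] by (auto intro!: prod_zero bexI[of _ i])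
  finally have "Pi\<^sub>E J ?B \<in> null_sets (PiM J \<gamma>)"
    using sets finite_subset[OF assms(1) finite_I] by (intro null_setsI sets_PiM_I_finite) auto
  then show ?thesis
    by (rule AE_I') (use assms(2) A(2) in \<open>auto simp: space_PiM PiE_iff extensional_def\<close>)
qed

lemma update_measurable:
  assumes "j \<in> I"
  shows "(\<lambda>(x, y). y(j := x)) \<in> \<gamma> j \<Otimes>\<^sub>M PiM (I - {j}) \<gamma> \<rightarrow>\<^sub>M P"
proof -
  have "(\<lambda>(y, x). y(j := x)) \<in> PiM (I - {j}) \<gamma> \<Otimes>\<^sub>M \<gamma> j \<rightarrow>\<^sub>M PiM (insert j (I - {j})) \<gamma>"
    by (rule measurable_add_dim)
  then have "(\<lambda>(y, x). y(j := x)) \<in> PiM (I - {j}) \<gamma> \<Otimes>\<^sub>M \<gamma> j \<rightarrow>\<^sub>M P"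
    using assms by (simp add: insert_absorb)
  from measurable_comp[OF measurable_pair_swap' this] show ?thesis
    by (simp add: comp_def case_prod_beta')
qed

lemma marginal_measurable:
  fixes h :: "(nat \<Rightarrow> 'a) \<Rightarrow> real"
  assumes "j \<in> I" "h \<in> borel_measurable P"
  shows "(\<lambda>x. \<integral>y. h (y(j := x)) \<partial>PiM (I - {j}) \<gamma>) \<in> borel_measurable (\<gamma> j)"
proof -
  interpret Q: finite_measure "PiM (I - {j}) \<gamma>" by (rule finite_PiM) auto
  have "(\<lambda>(x, y). h (y(j := x))) \<in> borel_measurable (\<gamma> j \<Otimes>\<^sub>M PiM (I - {j}) \<gamma>)"
    using measurable_comp[OF update_measurable[OF assms(1)] assms(2)]
    by (simp add: comp_def case_prod_beta')
  then show ?thesis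
    using Q.borel_measurable_lebesgue_integral[of "\<lambda>x y. h (y(j := x))" "\<gamma> j"] by simp
qed

text \<open>Fubini's theorem with the distinguished coordinate as the outer variable, the order that matches
the integral over the other coordinates in the Sinkhorn map.\<close>

lemma
  fixes h :: "(nat \<Rightarrow> 'a) \<Rightarrow> real"
  assumes j: "j \<in> I" and h: "integrable P h"
  shows integral_marginal: "(\<integral>x. (\<integral>y. h (y(j := x)) \<partial>PiM (I - {j}) \<gamma>) \<partial>\<gamma> j) = (\<integral>x. h x \<partial>P)"
    and integrable_marginal: "integrable (\<gamma> j) (\<lambda>x. \<integral>y. h (y(j := x)) \<partial>PiM (I - {j}) \<gamma>)"
proof -
  let ?J = "I - {j}" and ?Q = "PiM (I - {j}) \<gamma>"
  have ins: "insert j ?J = I" using j by auto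
  have gj: "gamma_ext j = \<gamma> j" using j by (simp add: gamma_ext_def)
  have PJ: "PiM ?J gamma_ext = ?Q" and PI: "PiM (insert j ?J) gamma_ext = P"
    using PiM_gamma_ext[of ?J] PiM_gamma_ext[of I] ins by auto
  interpret Q: finite_measure ?Q by (rule finite_PiM) auto
  interpret g: finite_measure "\<gamma> j" using j by (rule finite_gamma)
  interpret pair_sigma_finite "\<gamma> j" ?Q ..
  let ?u = "\<lambda>(x, y). h (y(j := x))"
  have hm: "h \<in> borel_measurable P" using h by auto
  have um: "?u \<in> borel_measurable (\<gamma> j \<Otimes>\<^sub>M ?Q)"
    using measurable_comp[OF update_measurable[OF j] hm] by (simp add: comp_def case_prod_beta')
  have "(\<integral>\<^sup>+z. ennreal (norm (?u z)) \<partial>(\<gamma> j \<Otimes>\<^sub>M ?Q)) = (\<integral>\<^sup>+x. \<integral>\<^sup>+y. ennreal (norm (h (y(j := x)))) \<partial>?Q \<partial>\<gamma> j)"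
    using Q.nn_integral_fst[of "\<lambda>z. ennreal (norm (?u z))" "\<gamma> j"] um by simp
  also have "\<dots> = (\<integral>\<^sup>+z. ennreal (norm (h z)) \<partial>P)"
    using G.product_nn_integral_insert_rev[of ?J j "\<lambda>z. ennreal (norm (h z))"] hm finite_I
    unfolding PI PJ gj by simp
  also have "\<dots> < \<infinity>" using h by (simp add: integrable_iff_bounded)
  finally have u: "integrable (\<gamma> j \<Otimes>\<^sub>M ?Q) ?u"
    using um by (simp add: integrable_iff_bounded)
  have "(\<integral>x. h x \<partial>P) = (\<integral>y. (\<integral>x. h (y(j := x)) \<partial>\<gamma> j) \<partial>?Q)"
    using G.product_integral_insert[of ?J j h] h finite_I unfolding PI PJ gj by simp
  also have "\<dots> = (\<integral>x. (\<integral>y. h (y(j := x)) \<partial>?Q) \<partial>\<gamma> j)"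
    using Fubini_integral[OF u] by simp
  finally show "(\<integral>x. (\<integral>y. h (y(j := x)) \<partial>?Q) \<partial>\<gamma> j) = (\<integral>x. h x \<partial>P)" ..
  show "integrable (\<gamma> j) (\<lambda>x. \<integral>y. h (y(j := x)) \<partial>?Q)" using integrable_fst[OF u] by simp
qed

lemma component_measurable:
  assumes "J \<subseteq> I" "i \<in> J" "h \<in> borel_measurable (\<gamma> i)"
  shows "(\<lambda>x. h (x i)) \<in> borel_measurable (PiM J \<gamma>)"
  by (rule measurable_compose[OF _ assms(3)]) (rule measurable_component_singleton[OF assms(2)])

lemma ess_bounded_component:
  assumes "J \<subseteq> I" "i \<in> J" "ess_bounded (\<gamma> i) h"
  shows "ess_bounded (PiM J \<gamma>) (\<lambda>x. h (x i))"
proof -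
  obtain B where "AE x in \<gamma> i. \<bar>h x\<bar> \<le> B" using assms(3) by (auto simp: ess_bounded_def)
  then have "AE x in PiM J \<gamma>. \<bar>h (x i)\<bar> \<le> B" by (rule AE_component[OF assms(1,2)])
  then show ?thesis
    by (rule ess_boundedI[rotated]) (rule component_measurable[OF assms(1,2) ess_bounded_measurable[OF assms(3)]])
qed

lemma integrable_P: "ess_bounded P h \<Longrightarrow> integrable P h"
  by (rule finite_measure.ess_bounded_integrable[OF finite_PiM[OF subset_refl]])

lemma integrable_gamma: "i \<in> I \<Longrightarrow> ess_bounded (\<gamma> i) h \<Longrightarrow> integrable (\<gamma> i) h"
  by (rule finite_measure.ess_bounded_integrable[OF finite_gamma])

lemma sigma_measurable [measurable]: "\<sigma> i \<in> borel_measurable (\<gamma> i)"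
  unfolding \<sigma>_def by measurable

lemma sets_mu: "i \<in> I \<Longrightarrow> sets (\<mu> i) = sets (\<gamma> i)"
  by (subst mu_density) auto

lemma space_mu: "i \<in> I \<Longrightarrow> space (\<mu> i) = space (\<gamma> i)"
  using sets_mu sets_eq_imp_space_eq by blast

lemma measurable_mu: "i \<in> I \<Longrightarrow> borel_measurable (\<mu> i) = borel_measurable (\<gamma> i)"
  using sets_mu by (intro measurable_cong_sets) auto

lemma sigma_exp_bounds:
  assumes "i \<in> I"
  shows "AE x in \<gamma> i. exp (- S) \<le> \<sigma> i x \<and> \<sigma> i x \<le> exp S"
  using sigma_bounds[OF assms]
proof eventually_elim
  case (elim x)
  then have "exp (- S) \<le> exp (ln (\<sigma> i x))" "exp (ln (\<sigma> i x)) \<le> exp S"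
    by (simp_all only: exp_le_cancel_iff) linarith+
  moreover have "exp (ln (\<sigma> i x)) = \<sigma> i x" using elim by simp
  ultimately show ?case by simp
qed

lemma ess_bounded_sigma: "i \<in> I \<Longrightarrow> ess_bounded (\<gamma> i) (\<sigma> i)"
proof (rule ess_boundedI[OF sigma_measurable])
  assume "i \<in> I"
  from sigma_exp_bounds[OF this] show "AE x in \<gamma> i. \<bar>\<sigma> i x\<bar> \<le> exp S"
    by eventually_elim (simp add: \<sigma>_def)
qed

lemma AE_mu:
  assumes "i \<in> I" "AE x in \<gamma> i. Q x"
  shows "AE x in \<mu> i. Q x"
  using assms(2) by (subst mu_density[OF assms(1)], subst AE_density) auto

text \<open>As the densities are positive, \<open>\<mu>\<^sub>i\<close> and \<open>\<gamma>\<^sub>i\<close> have the same null sets.\<close>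

lemma AE_gamma_of_AE_mu:
  assumes "i \<in> I" "AE x in \<mu> i. Q x"
  shows "AE x in \<gamma> i. Q x"
proof -
  have "AE x in \<gamma> i. 0 < ennreal (\<sigma> i x) \<longrightarrow> Q x"
    using assms(2) by (subst (asm) mu_density[OF assms(1)], subst (asm) AE_density) auto
  with sigma_bounds[OF assms(1)] show ?thesis by eventually_elim auto
qed

lemma finite_mu: "i \<in> I \<Longrightarrow> finite_measure (\<mu> i)"
proof
  assume i: "i \<in> I"
  interpret finite_measure "\<gamma> i" using i by (rule finite_gamma)
  have "emeasure (\<mu> i) (space (\<mu> i)) = (\<integral>\<^sup>+x. ennreal (\<sigma> i x) \<partial>\<gamma> i)"
    using i by (simp add: space_mu, subst mu_density[OF i], subst emeasure_density)
      (auto intro!: nn_integral_cong)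
  also have "\<dots> = ennreal (\<integral>x. \<sigma> i x \<partial>\<gamma> i)"
    using integrable_gamma[OF i ess_bounded_sigma[OF i]]
    by (intro nn_integral_eq_integral) (auto simp: \<sigma>_def)
  finally show "emeasure (\<mu> i) (space (\<mu> i)) \<noteq> \<infinity>" by simp
qed

lemma integral_mu:
  assumes "i \<in> I" "h \<in> borel_measurable (\<gamma> i)"
  shows "(\<integral>x. h x \<partial>\<mu> i) = (\<integral>x. \<sigma> i x * h x \<partial>\<gamma> i)"
  using assms(2) by (subst mu_density[OF assms(1)], subst integral_density) (auto simp: \<sigma>_def)

lemma ess_bounded_mu: "i \<in> I \<Longrightarrow> ess_bounded (\<gamma> i) h \<Longrightarrow> ess_bounded (\<mu> i) h"
  unfolding ess_bounded_def using measurable_mu[of i] AE_mu[of i] by blast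

lemma integrable_mu: "i \<in> I \<Longrightarrow> ess_bounded (\<gamma> i) h \<Longrightarrow> integrable (\<mu> i) h"
  by (rule finite_measure.ess_bounded_integrable[OF finite_mu ess_bounded_mu])

lemma measure_mu_pos:
  assumes "i \<in> I"
  shows "0 < measure (\<mu> i) (space (\<mu> i))"
proof -
  have "emeasure (\<mu> i) (space (\<mu> i)) \<noteq> 0"
  proof
    assume "emeasure (\<mu> i) (space (\<mu> i)) = 0"
    then have "AE x in \<mu> i. False" by (intro AE_I[of _ _ "space (\<mu> i)"]) auto
    then have "AE x in \<gamma> i. False" by (rule AE_gamma_of_AE_mu[OF assms])
    then show False
      using gamma_pos[OF assms] by (auto simp: measure_def AE_iff_null null_sets_def)
  qed
  then show ?thesis
    using finite_measure.emeasure_eq_measure[OF finite_mu[OF assms]]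
    by (simp add: zero_less_measure_iff)
qed

end

section \<open>The dual problem as a convex minimisation problem\<close>

lemma exp_second_order_bound:
  fixes a b :: real
  shows "exp b + exp b * (a - b) + exp b * exp (- \<bar>a - b\<bar>) / 2 * (a - b)\<^sup>2 \<le> exp a"
proof -
  obtain t where t: "\<bar>t\<bar> \<le> \<bar>a - b\<bar>"
    "exp (a - b) = (\<Sum>m<2. (a - b) ^ m / fact m) + exp t / fact 2 * (a - b) ^ 2"
    using Maclaurin_exp_le[of "a - b" 2] by blast
  have "exp (- \<bar>a - b\<bar>) / 2 * (a - b)\<^sup>2 \<le> exp t / 2 * (a - b)\<^sup>2"
    using t(1) by (intro mult_right_mono divide_right_mono) auto
  then have "1 + (a - b) + exp (- \<bar>a - b\<bar>) / 2 * (a - b)\<^sup>2 \<le> exp (a - b)"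
    using t(2) by (simp add: numeral_2_eq_2)
  then have "exp b * (1 + (a - b) + exp (- \<bar>a - b\<bar>) / 2 * (a - b)\<^sup>2) \<le> exp b * exp (a - b)"
    by (intro mult_left_mono) auto
  then show ?thesis by (simp add: exp_diff distrib_left mult.assoc)
qed

context entropic_dual
begin

text \<open>The density with respect to \<open>\<gamma>\<^sup>\<otimes>\<close> of the transport plan that belongs to the potentials.\<close>

definition plan :: "(nat \<Rightarrow> 'a \<Rightarrow> real) \<Rightarrow> (nat \<Rightarrow> 'a) \<Rightarrow> real" where
  "plan f x = exp ((oplus I f x - c x) / \<epsilon>)"

definition bounded_tuple :: "(nat \<Rightarrow> 'a \<Rightarrow> real) \<Rightarrow> bool" where
  "bounded_tuple f \<longleftrightarrow> (\<forall>i\<in>I. ess_bounded (\<gamma> i) (f i))"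

definition conj_val :: "nat \<Rightarrow> ('a \<Rightarrow> real) \<Rightarrow> 'a \<Rightarrow> real" where
  "conj_val i h x = real_of_ereal (conj_fun (\<phi> i) (- h x))"

definition marginal_cost :: "nat \<Rightarrow> ('a \<Rightarrow> real) \<Rightarrow> real" where
  "marginal_cost i h = (\<integral>x. conj_val i h x \<partial>\<mu> i)"

text \<open>The components at which the \<open>i\<close>-th integral of the dual functional is finite. The conjugate is turned into a real
function by sending \<open>\<infinity>\<close> to 0, so its almost sure finiteness is part of the condition.\<close>

definition finite_cost :: "nat \<Rightarrow> ('a \<Rightarrow> real) \<Rightarrow> bool" where
  "finite_cost i h \<longleftrightarrow> ess_bounded (\<gamma> i) h \<and> (AE x in \<mu> i. conj_fun (\<phi> i) (- h x) < \<infinity>) \<and>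
     integrable (\<mu> i) (conj_val i h)"

text \<open>The negative of the dual functional, as a real number; it is meaningful for tuples with finite costs.\<close>

definition cost :: "(nat \<Rightarrow> 'a \<Rightarrow> real) \<Rightarrow> real" where
  "cost f = (\<Sum>i\<in>I. marginal_cost i (f i)) + \<epsilon> * (\<integral>x. plan f x \<partial>P)"

definition finite_costs :: "(nat \<Rightarrow> 'a \<Rightarrow> real) \<Rightarrow> bool" where
  "finite_costs f \<longleftrightarrow> (\<forall>i\<in>I. finite_cost i (f i))"

lemma finite_costs_bounded: "finite_costs f \<Longrightarrow> bounded_tuple f"
  by (auto simp: finite_costs_def bounded_tuple_def finite_cost_def)

lemma ess_bounded_oplus:
  assumes "bounded_tuple f" "J \<subseteq> I" "J \<subseteq> J'" "J' \<subseteq> I"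
  shows "ess_bounded (PiM J' \<gamma>) (oplus J f)"
  unfolding oplus_def[abs_def] using assms
  by (intro ess_bounded_sum ess_bounded_component) (auto simp: bounded_tuple_def)

lemma ess_bounded_c: "ess_bounded P c"
  using c_bounds by (intro ess_boundedI[OF c_measurable, of C] AE_I2) fastforce

lemma ess_bounded_plan: "bounded_tuple f \<Longrightarrow> ess_bounded P (plan f)"
  unfolding plan_def[abs_def]
  by (intro ess_bounded_intros ess_bounded_oplus ess_bounded_c) auto

lemma conj_val_measurable:
  assumes "i \<in> I" "h \<in> borel_measurable (\<gamma> i)"
  shows "conj_val i h \<in> borel_measurable (\<gamma> i)"
proof -
  have "(\<lambda>x. conj_fun (\<phi> i) (- h x)) \<in> borel_measurable (\<gamma> i)"
    using assms(2) by (intro measurable_compose[OF _ conj_fun_borel[OF entropy[OF assms(1)]]]) auto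
  then show ?thesis unfolding conj_val_def[abs_def] by (rule borel_measurable_real_of_ereal)
qed

lemma conj_val_eq:
  "i \<in> I \<Longrightarrow> conj_fun (\<phi> i) (- h x) < \<infinity> \<Longrightarrow> conj_fun (\<phi> i) (- h x) = ereal (conj_val i h x)"
  unfolding conj_val_def by (rule conj_fun_real[OF entropy])

lemma conj_val_ge:
  assumes "i \<in> I" "conj_fun (\<phi> i) (- h x) < \<infinity>"
  shows "- h x \<le> conj_val i h x"
proof -
  have "ereal (- h x) \<le> ereal (conj_val i h x)"
    using conj_fun_ge[OF entropy[OF assms(1)], of "- h x"] conj_val_eq[where h = h, OF assms] by simp
  then show ?thesis by simp
qed

section \<open>A single Sinkhorn step\<close>

definition partition :: "nat \<Rightarrow> (nat \<Rightarrow> 'a \<Rightarrow> real) \<Rightarrow> 'a \<Rightarrow> real" where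
  "partition j f x = (\<integral>y. exp ((oplus (I - {j}) f y - c (y(j := x))) / \<epsilon>) \<partial>PiM (I - {j}) \<gamma>)"

abbreviation skmap :: "nat \<Rightarrow> (nat \<Rightarrow> 'a \<Rightarrow> real) \<Rightarrow> 'a \<Rightarrow> real" where
  "skmap \<equiv> sinkhorn_map I \<epsilon> \<phi> \<mu> \<gamma> c"

text \<open>The negative of the \<open>(c, \<epsilon>)\<close>-transform, the point at which the proximity operator is evaluated.\<close>

definition prox_arg :: "nat \<Rightarrow> (nat \<Rightarrow> 'a \<Rightarrow> real) \<Rightarrow> 'a \<Rightarrow> real" where
  "prox_arg j f x = \<epsilon> * ln (partition j f x) - \<epsilon> * ln (\<sigma> j x)"

lemma skmap_eq: "skmap j f x = - aprox \<epsilon> (conj_fun (\<phi> j)) (prox_arg j f x)"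
  by (simp add: sinkhorn_map_def c_transform_def prox_arg_def partition_def \<sigma>_def)

lemma oplus_update:
  assumes "j \<in> I"
  shows "oplus I (f(j := h)) x = oplus (I - {j}) f x + h (x j)"
proof -
  have "oplus I (f(j := h)) x = (f(j := h)) j (x j) + (\<Sum>i\<in>I - {j}. (f(j := h)) i (x i))"
    unfolding oplus_def by (rule sum.remove[OF finite_I assms])
  also have "(\<Sum>i\<in>I - {j}. (f(j := h)) i (x i)) = oplus (I - {j}) f x"
    unfolding oplus_def by (intro sum.cong) auto
  finally show ?thesis by (simp only: fun_upd_same add.commute)
qed

lemma oplus_slice: "oplus (I - {j}) f (y(j := x)) = oplus (I - {j}) f y"
  unfolding oplus_def by (intro sum.cong) auto

lemma update_in_space:
  "j \<in> I \<Longrightarrow> x \<in> space (\<gamma> j) \<Longrightarrow> y \<in> space (PiM (I - {j}) \<gamma>) \<Longrightarrow> y(j := x) \<in> space P"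
  by (auto simp: space_PiM PiE_iff extensional_def)

text \<open>Since \<open>0 \<le> c \<le> C\<close>, replacing \<open>c\<close> by a constant changes the integrand by a factor in
\<open>[exp (- C / \<epsilon>), 1]\<close>; what is left does not depend on \<open>x\<close>.\<close>

lemma partition_bounds:
  assumes j: "j \<in> I" and f: "bounded_tuple f"
  shows "\<exists>k>0. \<forall>x\<in>space (\<gamma> j). k * exp (- (C / \<epsilon>)) \<le> partition j f x \<and> partition j f x \<le> k"
proof -
  let ?Q = "PiM (I - {j}) \<gamma>"
  let ?o = "oplus (I - {j}) f"
  interpret Q: finite_measure ?Q by (rule finite_PiM) auto
  have o: "ess_bounded ?Q ?o" using f by (intro ess_bounded_oplus) auto
  then obtain B where B: "AE y in ?Q. \<bar>?o y\<bar> \<le> B" by (auto simp: ess_bounded_def)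
  have e: "ess_bounded ?Q (\<lambda>y. exp (?o y / \<epsilon>))" by (intro ess_bounded_intros o)
  define k where "k = (\<integral>y. exp (?o y / \<epsilon>) \<partial>?Q)"
  have "exp (- B / \<epsilon>) \<le> exp (t / \<epsilon>)" if "\<bar>t\<bar> \<le> B" for t
    using that eps_pos divide_right_mono[of "- B" t \<epsilon>] by auto
  with B have "AE y in ?Q. exp (- B / \<epsilon>) \<le> exp (?o y / \<epsilon>)"
    by (auto elim!: eventually_mono)
  then have "(\<integral>y. exp (- B / \<epsilon>) \<partial>?Q) \<le> k"
    unfolding k_def
    by (intro integral_mono_AE Q.ess_bounded_integrable ess_bounded_const e)
  moreover have "0 < (\<integral>y. exp (- B / \<epsilon>) \<partial>?Q)"
    using measure_PiM_pos[of "I - {j}"] by simp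
  ultimately have k: "0 < k" by linarith
  have "k * exp (- (C / \<epsilon>)) \<le> partition j f x \<and> partition j f x \<le> k"
    if x: "x \<in> space (\<gamma> j)" for x
  proof
    have "(\<lambda>y. y(j := x)) \<in> ?Q \<rightarrow>\<^sub>M P"
      using measurable_compose[OF measurable_Pair1'[OF x] update_measurable[OF j]] by simp
    then have cm: "(\<lambda>y. c (y(j := x))) \<in> borel_measurable ?Q"
      by (rule measurable_compose[OF _ c_measurable])
    have cb: "0 \<le> c (y(j := x)) \<and> c (y(j := x)) \<le> C" if "y \<in> space ?Q" for y
      by (rule c_bounds[OF update_in_space[OF j x that]])
    then have "ess_bounded ?Q (\<lambda>y. c (y(j := x)))"
      by (intro ess_boundedI[OF cm, of C] AE_I2) fastforce
    then have ec: "ess_bounded ?Q (\<lambda>y. exp ((?o y - c (y(j := x))) / \<epsilon>))"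
      by (intro ess_bounded_intros o)
    have "(\<integral>y. exp (?o y / \<epsilon>) * exp (- (C / \<epsilon>)) \<partial>?Q) \<le> partition j f x"
      unfolding partition_def
    proof (intro integral_mono Q.ess_bounded_integrable ec ess_bounded_mult[OF e] ess_bounded_const)
      fix y assume "y \<in> space ?Q"
      then have "?o y - C \<le> ?o y - c (y(j := x))" using cb[of y] by simp
      then have "(?o y - C) / \<epsilon> \<le> (?o y - c (y(j := x))) / \<epsilon>"
        using eps_pos by (simp add: divide_right_mono)
      then show "exp (?o y / \<epsilon>) * exp (- (C / \<epsilon>)) \<le> exp ((?o y - c (y(j := x))) / \<epsilon>)"
        by (simp add: exp_add[symmetric] diff_divide_distrib)
    qed
    then show "k * exp (- (C / \<epsilon>)) \<le> partition j f x" by (simp add: k_def)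
    show "partition j f x \<le> k"
      unfolding partition_def k_def
    proof (intro integral_mono Q.ess_bounded_integrable ec e)
      fix y assume "y \<in> space ?Q"
      then show "exp ((?o y - c (y(j := x))) / \<epsilon>) \<le> exp (?o y / \<epsilon>)"
        using cb[of y] eps_pos by (simp add: divide_right_mono)
    qed
  qed
  then show ?thesis using k by blast
qed

lemma partition_pos:
  assumes "j \<in> I" "bounded_tuple f" "x \<in> space (\<gamma> j)"
  shows "0 < partition j f x"
  using partition_bounds[OF assms(1,2)] assms(3)
  by (meson exp_gt_zero mult_pos_pos order_less_le_trans)

lemma oplus_measurable:
  assumes "bounded_tuple f" "J \<subseteq> I"
  shows "oplus J f \<in> borel_measurable P"
  using ess_bounded_oplus[OF assms(1,2,2)] ess_bounded_oplus[OF assms(1), of J I] assms(2)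
  by (auto simp: ess_bounded_def)

lemma prox_arg_measurable:
  assumes j: "j \<in> I" and f: "bounded_tuple f"
  shows "prox_arg j f \<in> borel_measurable (\<gamma> j)"
proof -
  have "(\<lambda>z. exp ((oplus (I - {j}) f z - c z) / \<epsilon>)) \<in> borel_measurable P"
    using oplus_measurable[OF f, of "I - {j}"] c_measurable by measurable
  from marginal_measurable[OF j this] have "partition j f \<in> borel_measurable (\<gamma> j)"
    by (simp add: partition_def[abs_def] oplus_slice)
  then show ?thesis unfolding prox_arg_def[abs_def] by measurable
qed

definition osc_bound :: real where "osc_bound = C + 2 * \<epsilon> * S"

lemma prox_arg_bounds:
  assumes j: "j \<in> I" and f: "bounded_tuple f"
  shows "\<exists>p0. AE x in \<gamma> j. p0 \<le> prox_arg j f x \<and> prox_arg j f x \<le> p0 + osc_bound"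
proof -
  obtain k where k: "0 < k" "\<And>x. x \<in> space (\<gamma> j) \<Longrightarrow>
      k * exp (- (C / \<epsilon>)) \<le> partition j f x \<and> partition j f x \<le> k"
    using partition_bounds[OF j f] by blast
  have "AE x in \<gamma> j. \<epsilon> * ln k - C - \<epsilon> * S \<le> prox_arg j f x \<and>
      prox_arg j f x \<le> \<epsilon> * ln k - C - \<epsilon> * S + osc_bound"
    using AE_space sigma_bounds[OF j]
  proof eventually_elim
    case (elim x)
    note K = k(2)[OF elim(1)] partition_pos[OF j f elim(1)]
    have "ln (k * exp (- (C / \<epsilon>))) \<le> ln (partition j f x)" "ln (partition j f x) \<le> ln k"
      using K k(1) by (auto simp: ln_le_cancel_iff)
    then have "ln k - C / \<epsilon> \<le> ln (partition j f x)" "ln (partition j f x) \<le> ln k"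
      using k(1) by (auto simp: ln_mult)
    then have "\<epsilon> * (ln k - C / \<epsilon>) \<le> \<epsilon> * ln (partition j f x)"
      "\<epsilon> * ln (partition j f x) \<le> \<epsilon> * ln k"
      using eps_pos by (auto intro: mult_left_mono)
    moreover have "\<epsilon> * (ln k - C / \<epsilon>) = \<epsilon> * ln k - C"
      using eps_pos by (simp add: field_simps)
    moreover have "\<bar>\<epsilon> * ln (\<sigma> j x)\<bar> \<le> \<epsilon> * S"
      using elim(2) eps_pos by (simp add: abs_mult)
    ultimately show ?case unfolding prox_arg_def osc_bound_def by linarith
  qed
  then show ?thesis by blast
qed

lemma ess_bounded_prox_arg:
  assumes "j \<in> I" "bounded_tuple f"
  shows "ess_bounded (\<gamma> j) (prox_arg j f)"
proof -
  obtain p0 where "AE x in \<gamma> j. p0 \<le> prox_arg j f x \<and> prox_arg j f x \<le> p0 + osc_bound"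
    using prox_arg_bounds[OF assms] by blast
  then have "AE x in \<gamma> j. \<bar>prox_arg j f x\<bar> \<le> \<bar>p0\<bar> + \<bar>osc_bound\<bar>" by eventually_elim auto
  then show ?thesis by (rule ess_boundedI[OF prox_arg_measurable[OF assms]])
qed

text \<open>Essential oscillation at most \<open>R\<close>, in a form that exhibits a lower bound of the function.\<close>

definition osc_le :: "real \<Rightarrow> nat \<Rightarrow> ('a \<Rightarrow> real) \<Rightarrow> bool" where
  "osc_le R i h \<longleftrightarrow> (\<exists>l. AE x in \<gamma> i. l \<le> h x \<and> h x \<le> l + R)"

text \<open>By \<open>prox_arg_bounds\<close> the argument of the proximity operator has an oscillation that does not depend on
\<open>f\<close>, and a monotone nonexpansive map does not increase oscillations.\<close>

lemma skmap_osc_le: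
  assumes j: "j \<in> I" and f: "bounded_tuple f"
  shows "osc_le osc_bound j (skmap j f)"
proof -
  let ?a = "aprox \<epsilon> (conj_fun (\<phi> j))"
  obtain p0 where "AE x in \<gamma> j. p0 \<le> prox_arg j f x \<and> prox_arg j f x \<le> p0 + osc_bound"
    using prox_arg_bounds[OF assms] by blast
  then have "AE x in \<gamma> j. - ?a (p0 + osc_bound) \<le> skmap j f x \<and> skmap j f x \<le> - ?a (p0 + osc_bound) + osc_bound"
  proof eventually_elim
    case (elim x)
    then show ?case
      using aprox_mono[OF entropy[OF j] eps_pos, of "prox_arg j f x" "p0 + osc_bound"]
        aprox_nonexpansive[OF entropy[OF j] eps_pos, of "prox_arg j f x" "p0 + osc_bound"]
      by (auto simp: skmap_eq)
  qed
  then show ?thesis by (auto simp: osc_le_def)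
qed

lemma skmap_measurable:
  assumes "j \<in> I" "bounded_tuple f"
  shows "skmap j f \<in> borel_measurable (\<gamma> j)"
  unfolding skmap_eq[abs_def]
  using measurable_compose[OF prox_arg_measurable[OF assms] aprox_borel[OF entropy[OF assms(1)] eps_pos]]
  by measurable

lemma osc_le_ess_bounded:
  assumes "h \<in> borel_measurable (\<gamma> i)" "osc_le R i h"
  shows "ess_bounded (\<gamma> i) h"
proof -
  obtain l where "AE x in \<gamma> i. l \<le> h x \<and> h x \<le> l + R"
    using assms(2) by (auto simp: osc_le_def)
  then have "AE x in \<gamma> i. \<bar>h x\<bar> \<le> \<bar>l\<bar> + \<bar>R\<bar>" by eventually_elim auto
  then show ?thesis by (rule ess_boundedI[OF assms(1)])
qed

lemma ess_bounded_skmap: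
  assumes "j \<in> I" "bounded_tuple f"
  shows "ess_bounded (\<gamma> j) (skmap j f)"
  by (rule osc_le_ess_bounded[OF skmap_measurable[OF assms] skmap_osc_le[OF assms]])

lemma bounded_tuple_update:
  "bounded_tuple f \<Longrightarrow> ess_bounded (\<gamma> j) h \<Longrightarrow> bounded_tuple (f(j := h))"
  by (auto simp: bounded_tuple_def)

text \<open>Even if the old component had infinite cost the new one has not: the conjugate is bounded above by
\<open>aprox_conj_le\<close> and below by \<open>conj_fun_ge\<close>.\<close>

lemma finite_cost_skmap:
  assumes j: "j \<in> I" and f: "bounded_tuple f"
  shows "finite_cost j (skmap j f)"
proof -
  let ?a = "aprox \<epsilon> (conj_fun (\<phi> j))"
  have up: "conj_fun (\<phi> j) (- skmap j f x) \<le> ereal (\<epsilon> * exp (prox_arg j f x / \<epsilon>))" for x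
    using aprox_conj_le[OF entropy[OF j] eps_pos, of "prox_arg j f x"] by (simp add: skmap_eq)
  then have fin: "conj_fun (\<phi> j) (- skmap j f x) < \<infinity>" for x
    by (rule order_le_less_trans) simp
  have b: "ess_bounded (\<gamma> j) (skmap j f)" by (rule ess_bounded_skmap[OF assms])
  have "ess_bounded (\<gamma> j) (\<lambda>x. \<bar>skmap j f x\<bar> + \<epsilon> * exp (prox_arg j f x / \<epsilon>))"
    by (intro ess_bounded_intros b ess_bounded_prox_arg[OF assms])
  then obtain B where "AE x in \<gamma> j. \<bar>\<bar>skmap j f x\<bar> + \<epsilon> * exp (prox_arg j f x / \<epsilon>)\<bar> \<le> B"
    by (auto simp: ess_bounded_def)
  then have "AE x in \<gamma> j. \<bar>conj_val j (skmap j f) x\<bar> \<le> B"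
  proof eventually_elim
    case (elim x)
    have "ereal (- skmap j f x) \<le> ereal (conj_val j (skmap j f) x)"
      using conj_fun_ge[OF entropy[OF j], of "- skmap j f x"] conj_val_eq[where h = "skmap j f", OF j fin] by simp
    moreover have "ereal (conj_val j (skmap j f) x) \<le> ereal (\<epsilon> * exp (prox_arg j f x / \<epsilon>))"
      using up conj_val_eq[where h = "skmap j f", OF j fin] by simp
    moreover have "0 \<le> \<epsilon> * exp (prox_arg j f x / \<epsilon>)" using eps_pos by simp
    ultimately show ?case using elim by simp
  qed
  then have "ess_bounded (\<gamma> j) (conj_val j (skmap j f))"
    by (rule ess_boundedI[OF conj_val_measurable[OF j skmap_measurable[OF assms]]])
  then show ?thesis
    using b fin integrable_mu[OF j] by (auto simp: finite_cost_def)
qed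

lemma plan_update_slice:
  assumes "j \<in> I"
  shows "plan (f(j := h)) (y(j := x)) =
    exp (h x / \<epsilon>) * exp ((oplus (I - {j}) f y - c (y(j := x))) / \<epsilon>)"
  unfolding plan_def oplus_update[OF assms] oplus_slice
  by (simp add: exp_add[symmetric] add_divide_distrib[symmetric] diff_divide_distrib algebra_simps)

text \<open>The subgradient of the conjugate at the updated potential provided by \<open>aprox_subgradient\<close>.\<close>

definition slope :: "nat \<Rightarrow> (nat \<Rightarrow> 'a \<Rightarrow> real) \<Rightarrow> 'a \<Rightarrow> real" where
  "slope j f x = exp ((prox_arg j f x + skmap j f x) / \<epsilon>)"

text \<open>As \<open>exp (p / \<epsilon>)\<close> is the quotient of the partition function by \<open>\<sigma>\<^sub>j\<close>, the measure with density \<open>slope\<close> with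
respect to \<open>\<mu>\<^sub>j\<close> is the \<open>j\<close>-th marginal of the updated plan.\<close>

lemma slope_marginal:
  assumes j: "j \<in> I" and f: "bounded_tuple f" and h: "ess_bounded (\<gamma> j) h"
  shows "(\<integral>x. slope j f x * h x \<partial>\<mu> j) = (\<integral>z. plan (f(j := skmap j f)) z * h (z j) \<partial>P)"
proof -
  let ?g = "skmap j f"
  have gb: "ess_bounded (\<gamma> j) ?g" by (rule ess_bounded_skmap[OF j f])
  have sb: "ess_bounded (\<gamma> j) (slope j f)"
    unfolding slope_def[abs_def] by (intro ess_bounded_intros ess_bounded_prox_arg[OF j f] gb)
  have Ib: "integrable P (\<lambda>z. plan (f(j := ?g)) z * h (z j))"
    by (intro integrable_P ess_bounded_intros ess_bounded_plan
        bounded_tuple_update f gb ess_bounded_component[OF subset_refl j h])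
  have "(\<integral>x. slope j f x * h x \<partial>\<mu> j) = (\<integral>x. \<sigma> j x * (slope j f x * h x) \<partial>\<gamma> j)"
    by (intro integral_mu[OF j] ess_bounded_measurable ess_bounded_mult sb h)
  also have "\<dots> = (\<integral>x. (\<integral>y. plan (f(j := ?g)) (y(j := x)) * h ((y(j := x)) j) \<partial>PiM (I - {j}) \<gamma>) \<partial>\<gamma> j)"
  proof (rule integral_cong_AE)
    show "(\<lambda>x. \<sigma> j x * (slope j f x * h x)) \<in> borel_measurable (\<gamma> j)"
      by (intro ess_bounded_measurable ess_bounded_mult sb h ess_bounded_sigma j)
    show "(\<lambda>x. \<integral>y. plan (f(j := ?g)) (y(j := x)) * h ((y(j := x)) j) \<partial>PiM (I - {j}) \<gamma>)
        \<in> borel_measurable (\<gamma> j)"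
      by (rule marginal_measurable[OF j borel_measurable_integrable[OF Ib]])
    show "AE x in \<gamma> j. \<sigma> j x * (slope j f x * h x) =
        (\<integral>y. plan (f(j := ?g)) (y(j := x)) * h ((y(j := x)) j) \<partial>PiM (I - {j}) \<gamma>)"
      using AE_space sigma_bounds[OF j]
    proof eventually_elim
      case (elim x)
      have K: "0 < partition j f x" by (rule partition_pos[OF j f elim(1)])
      have "exp (prox_arg j f x / \<epsilon>) = partition j f x / \<sigma> j x"
        using K elim(2) eps_pos
        by (simp add: prox_arg_def right_diff_distrib[symmetric] exp_diff)
      then have "\<sigma> j x * slope j f x = partition j f x * exp (?g x / \<epsilon>)"
        using elim(2) by (simp add: slope_def add_divide_distrib exp_add)
      then have "\<sigma> j x * (slope j f x * h x) = exp (?g x / \<epsilon>) * h x * partition j f x"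
        by (metis mult.assoc mult.commute)
      also have "\<dots> = (\<integral>y. exp (?g x / \<epsilon>) * h x * exp ((oplus (I - {j}) f y - c (y(j := x))) / \<epsilon>) \<partial>PiM (I - {j}) \<gamma>)"
        unfolding partition_def by simp
      also have "\<dots> = (\<integral>y. plan (f(j := ?g)) (y(j := x)) * h ((y(j := x)) j) \<partial>PiM (I - {j}) \<gamma>)"
        by (intro Bochner_Integration.integral_cong) (auto simp: plan_update_slice[OF j])
      finally show ?case .
    qed
  qed
  also have "\<dots> = (\<integral>z. plan (f(j := ?g)) z * h (z j) \<partial>P)"
    by (rule integral_marginal[OF j Ib])
  finally show ?thesis .
qed

text \<open>Integrating the pointwise subgradient inequality: the \<open>j\<close>-th marginal of the updated plan is
a subgradient of the \<open>j\<close>-th cost at the updated potential.\<close>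

lemma skmap_variational:
  assumes j: "j \<in> I" and f: "bounded_tuple f" and h: "finite_cost j h"
  shows "marginal_cost j (skmap j f) +
      (\<integral>z. plan (f(j := skmap j f)) z * (skmap j f (z j) - h (z j)) \<partial>P) \<le> marginal_cost j h"
proof -
  let ?g = "skmap j f"
  have gb: "ess_bounded (\<gamma> j) ?g" by (rule ess_bounded_skmap[OF j f])
  have hb: "ess_bounded (\<gamma> j) h" using h by (simp add: finite_cost_def)
  have sb: "ess_bounded (\<gamma> j) (slope j f)"
    unfolding slope_def[abs_def] by (intro ess_bounded_intros ess_bounded_prox_arg[OF j f] gb)
  have dg: "finite_cost j ?g" by (rule finite_cost_skmap[OF j f])
  have i1: "integrable (\<mu> j) (conj_val j ?g)" "integrable (\<mu> j) (conj_val j h)"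
    using dg h by (auto simp: finite_cost_def)
  have i2: "integrable (\<mu> j) (\<lambda>x. slope j f x * (?g x - h x))"
    by (intro integrable_mu[OF j] ess_bounded_intros sb gb hb)
  have "marginal_cost j ?g + (\<integral>x. slope j f x * (?g x - h x) \<partial>\<mu> j) =
      (\<integral>x. conj_val j ?g x + slope j f x * (?g x - h x) \<partial>\<mu> j)"
    unfolding marginal_cost_def using i1 i2 by simp
  also have "\<dots> \<le> marginal_cost j h"
    unfolding marginal_cost_def
  proof (rule integral_mono_AE)
    show "integrable (\<mu> j) (\<lambda>x. conj_val j ?g x + slope j f x * (?g x - h x))" using i1 i2 by simp
    show "AE x in \<mu> j. conj_val j ?g x + slope j f x * (?g x - h x) \<le> conj_val j h x"
      using h[unfolded finite_cost_def, THEN conjunct2, THEN conjunct1]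
    proof eventually_elim
      case (elim x)
      have "conj_fun (\<phi> j) (- ?g x) \<le> ereal (conj_val j h x -
          exp ((prox_arg j f x - (- ?g x)) / \<epsilon>) * ((- h x) - (- ?g x)))"
        by (rule aprox_subgradient[OF entropy[OF j] eps_pos])
          (simp_all add: skmap_eq conj_val_eq[where h = h, OF j elim])
      then have "conj_fun (\<phi> j) (- ?g x) \<le> ereal (conj_val j h x - slope j f x * (?g x - h x))"
        by (simp add: slope_def)
      moreover from this have "conj_fun (\<phi> j) (- ?g x) = ereal (conj_val j ?g x)"
        by (intro conj_val_eq[OF j]) (auto elim: order_le_less_trans)
      ultimately show ?case by simp
    qed
  qed (rule i1)
  finally show ?thesis
    using slope_marginal[OF j f ess_bounded_diff[OF gb hb]] by simp
qed

definition tuple_le :: "real \<Rightarrow> (nat \<Rightarrow> 'a \<Rightarrow> real) \<Rightarrow> bool" where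
  "tuple_le M f \<longleftrightarrow> (\<forall>i\<in>I. AE x in \<gamma> i. \<bar>f i x\<bar> \<le> M)"

lemma tuple_le_oplus:
  assumes "tuple_le M f"
  shows "AE x in P. \<bar>oplus I f x\<bar> \<le> real (card I) * M"
proof -
  have "AE x in P. \<forall>i\<in>I. \<bar>f i (x i)\<bar> \<le> M"
    using assms by (intro AE_finite_allI[OF finite_I] AE_component[OF subset_refl])
      (auto simp: tuple_le_def)
  then show ?thesis
  proof eventually_elim
    case (elim x)
    have "\<bar>oplus I f x\<bar> \<le> (\<Sum>i\<in>I. \<bar>f i (x i)\<bar>)" unfolding oplus_def by (rule sum_abs)
    also have "\<dots> \<le> real (card I) * M" using elim by (intro sum_bounded_above) auto
    finally show ?case .
  qed
qed

text \<open>Half the second derivative of \<open>\<epsilon> exp (s / \<epsilon>)\<close> is \<open>exp (s / \<epsilon>) / (2 \<epsilon>)\<close>. For tuples bounded by \<open>M\<close> the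
exponent at one sum minus the distance of the sums is at least \<open>- (3 |I| M + C) / \<epsilon>\<close>.\<close>

definition modulus :: "real \<Rightarrow> real" where
  "modulus M = exp (- ((3 * real (card I) * M + C) / \<epsilon>)) / (2 * \<epsilon>)"

lemma modulus_pos: "0 < modulus M"
  using eps_pos by (simp add: modulus_def)

text \<open>The Bregman distance of the exponential term dominates a multiple of the squared distance
of the sums, uniformly on bounded tuples.\<close>

lemma plan_convex:
  assumes f: "bounded_tuple f" and g: "bounded_tuple g" and M: "tuple_le M f" "tuple_le M g"
  shows "\<epsilon> * (\<integral>x. plan g x \<partial>P) + (\<integral>x. plan g x * (oplus I f x - oplus I g x) \<partial>P)
    + modulus M * (\<integral>x. (oplus I f x - oplus I g x)\<^sup>2 \<partial>P) \<le> \<epsilon> * (\<integral>x. plan f x \<partial>P)"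
proof -
  let ?d = "\<lambda>x. oplus I f x - oplus I g x"
  have ob: "ess_bounded P (oplus I f)" "ess_bounded P (oplus I g)"
    using f g by (auto intro: ess_bounded_oplus)
  have i: "integrable P (plan f)" "integrable P (plan g)"
    "integrable P (\<lambda>x. plan g x * ?d x)" "integrable P (\<lambda>x. (?d x)\<^sup>2)"
    by (intro integrable_P ess_bounded_intros ess_bounded_plan f g ob)+
  have "\<epsilon> * (\<integral>x. plan g x \<partial>P) + (\<integral>x. plan g x * ?d x \<partial>P) + modulus M * (\<integral>x. (?d x)\<^sup>2 \<partial>P)
     = (\<integral>x. \<epsilon> * plan g x + plan g x * ?d x + modulus M * (?d x)\<^sup>2 \<partial>P)"
    using i by simp
  also have "\<dots> \<le> (\<integral>x. \<epsilon> * plan f x \<partial>P)"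
  proof (rule integral_mono_AE)
    show "integrable P (\<lambda>x. \<epsilon> * plan g x + plan g x * ?d x + modulus M * (?d x)\<^sup>2)"
      "integrable P (\<lambda>x. \<epsilon> * plan f x)" using i by auto
    show "AE x in P. \<epsilon> * plan g x + plan g x * ?d x + modulus M * (?d x)\<^sup>2 \<le> \<epsilon> * plan f x"
      using AE_space tuple_le_oplus[OF M(1)] tuple_le_oplus[OF M(2)]
    proof eventually_elim
      case (elim x)
      let ?n = "real (card I) * M"
      define a where "a = (oplus I f x - c x) / \<epsilon>"
      define b where "b = (oplus I g x - c x) / \<epsilon>"
      have ab: "a - b = ?d x / \<epsilon>" by (simp add: a_def b_def diff_divide_distrib)
      have "\<bar>a - b\<bar> = \<bar>?d x\<bar> / \<epsilon>" using eps_pos by (simp add: ab)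
      moreover have "\<bar>?d x\<bar> - (oplus I g x - c x) \<le> 3 * ?n + C"
        using elim c_bounds[OF elim(1)] by linarith
      then have "(\<bar>?d x\<bar> - (oplus I g x - c x)) / \<epsilon> \<le> (3 * ?n + C) / \<epsilon>"
        using eps_pos by (simp add: divide_right_mono)
      ultimately have "- ((3 * ?n + C) / \<epsilon>) \<le> b + - \<bar>a - b\<bar>"
        by (simp add: b_def diff_divide_distrib)
      then have "exp (- ((3 * ?n + C) / \<epsilon>)) \<le> exp b * exp (- \<bar>a - b\<bar>)"
        by (simp add: exp_add[symmetric])
      then have "exp (- ((3 * ?n + C) / \<epsilon>)) / 2 * (a - b)\<^sup>2 \<le> exp b * exp (- \<bar>a - b\<bar>) / 2 * (a - b)\<^sup>2"
        by (intro mult_right_mono divide_right_mono) auto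
      with exp_second_order_bound[of b a]
      have "exp b + exp b * (a - b) + exp (- ((3 * ?n + C) / \<epsilon>)) / 2 * (a - b)\<^sup>2 \<le> exp a"
        by linarith
      then have "\<epsilon> * (exp b + exp b * (a - b) + exp (- ((3 * ?n + C) / \<epsilon>)) / 2 * (a - b)\<^sup>2) \<le> \<epsilon> * exp a"
        using eps_pos by simp
      moreover have "\<epsilon> * (exp b + exp b * (a - b) + exp (- ((3 * ?n + C) / \<epsilon>)) / 2 * (a - b)\<^sup>2) =
         \<epsilon> * exp b + exp b * ?d x + modulus M * (?d x)\<^sup>2"
        unfolding ab modulus_def using eps_pos by (simp add: field_simps power2_eq_square)
      ultimately show ?case by (simp add: plan_def a_def b_def)
    qed
  qed
  finally show ?thesis by simp
qed

lemma cost_update: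
  assumes "j \<in> I"
  shows "cost f - cost (f(j := h)) = marginal_cost j (f j) - marginal_cost j h
    + \<epsilon> * (\<integral>x. plan f x \<partial>P) - \<epsilon> * (\<integral>x. plan (f(j := h)) x \<partial>P)"
proof -
  have "(\<Sum>i\<in>I. marginal_cost i ((f(j := h)) i)) = marginal_cost j h + (\<Sum>i\<in>I - {j}. marginal_cost i (f i))"
    using assms finite_I by (simp add: sum.remove)
  moreover have "(\<Sum>i\<in>I. marginal_cost i (f i)) = marginal_cost j (f j) + (\<Sum>i\<in>I - {j}. marginal_cost i (f i))"
    using assms finite_I by (simp add: sum.remove)
  ultimately show ?thesis by (simp add: cost_def)
qed

lemma finite_costs_skmap:
  "j \<in> I \<Longrightarrow> finite_costs f \<Longrightarrow> finite_costs (f(j := skmap j f))"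
  using finite_cost_skmap[of j f] finite_costs_bounded[of f] by (auto simp: finite_costs_def)

text \<open>The variational inequality, tested against the old component, cancels the linear term of the strong
convexity inequality, because old and new sums differ only in the updated component.\<close>

lemma skmap_decrease:
  assumes j: "j \<in> I" and f: "finite_costs f" and g: "g = f(j := skmap j f)"
    and M: "tuple_le M f" "tuple_le M g"
  shows "modulus M * (\<integral>x. (oplus I g x - oplus I f x)\<^sup>2 \<partial>P) \<le> cost f - cost g"
proof -
  have fb: "bounded_tuple f" by (rule finite_costs_bounded[OF f])
  have gb: "bounded_tuple g" unfolding g by (intro bounded_tuple_update fb ess_bounded_skmap j)
  have d: "oplus I f x - oplus I g x = f j (x j) - skmap j f (x j)" for x
    using oplus_update[OF j, of f "f j" x] oplus_update[OF j, of f "skmap j f" x] by (simp add: g)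
  have "marginal_cost j (skmap j f) + (\<integral>z. plan g z * (skmap j f (z j) - f j (z j)) \<partial>P)
      \<le> marginal_cost j (f j)"
    unfolding g using f j by (intro skmap_variational[OF j fb]) (auto simp: finite_costs_def)
  moreover have "(\<integral>z. plan g z * (skmap j f (z j) - f j (z j)) \<partial>P) =
      - (\<integral>z. plan g z * (oplus I f z - oplus I g z) \<partial>P)"
    unfolding d by (subst Bochner_Integration.integral_minus[symmetric], intro Bochner_Integration.integral_cong)
      (auto simp: algebra_simps)
  moreover have "(\<integral>x. (oplus I g x - oplus I f x)\<^sup>2 \<partial>P) = (\<integral>x. (oplus I f x - oplus I g x)\<^sup>2 \<partial>P)"
    by (simp add: power2_commute)
  ultimately show ?thesis
    using plan_convex[OF fb gb M] cost_update[OF j, of f "skmap j f"] by (simp add: g)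
qed

end

section \<open>A priori bounds from coercivity\<close>

text \<open>Let \<open>s\<close> be the sum of the positive parts over the indices other than \<open>N\<close> and \<open>u = - a\<^sub>N\<close>. Bounding the exponential below by
lines of slope \<open>2 m\<close> and \<open>m / 2\<close> turns the hypothesis into \<open>s + u \<le> b\<^sub>1\<close> and \<open>5 s - u \<le> b\<^sub>2\<close>, which
together bound \<open>s\<close> and \<open>u\<close> on both sides. A line of slope \<open>m\<close> then bounds the remaining negative parts.
The coefficient \<open>3 m\<close> has to exceed the larger slope.\<close>

lemma coercivity_bound:
  fixes m A \<epsilon> K :: real
  assumes fin: "finite I" and N: "N \<in> I" and pos: "0 < m" "0 < A" "0 < \<epsilon>"
  shows "\<exists>B. \<forall>a. 3 * m * (\<Sum>i\<in>I - {N}. max (a i) 0) + m * a N + A * exp (- (\<Sum>i\<in>I. a i) / \<epsilon>) \<le> K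
    \<longrightarrow> (\<forall>i\<in>I. \<bar>a i\<bar> \<le> B)"
proof -
  obtain C2 where C2: "\<And>y. (2 * m) * y - C2 \<le> A * exp (y / \<epsilon>)"
    using exp_dominates_linear[OF pos(2,3), of "2 * m"] pos(1) by auto
  obtain C3 where C3: "\<And>y. (m / 2) * y - C3 \<le> A * exp (y / \<epsilon>)"
    using exp_dominates_linear[OF pos(2,3), of "m / 2"] pos(1) by auto
  obtain C4 where C4: "\<And>y. m * y - C4 \<le> A * exp (y / \<epsilon>)"
    using exp_dominates_linear[OF pos(2,3), of m] pos(1) by auto
  define b1 where "b1 = (K + C2) / m"
  define b2 where "b2 = 2 * (K + C3) / m"
  define b3 where "b3 = (K + C4) / m"
  define B where "B = 3 * \<bar>b1\<bar> + 3 * \<bar>b2\<bar> + \<bar>b3\<bar>"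
  have "\<bar>a i\<bar> \<le> B"
    if a: "3 * m * (\<Sum>i\<in>I - {N}. max (a i) 0) + m * a N + A * exp (- (\<Sum>i\<in>I. a i) / \<epsilon>) \<le> K"
      and i: "i \<in> I" for a i
  proof -
    define s where "s = (\<Sum>i\<in>I - {N}. max (a i) 0)"
    define y where "y = - (\<Sum>i\<in>I. a i)"
    have s0: "0 \<le> s" unfolding s_def by (intro sum_nonneg) auto
    have total: "(\<Sum>i\<in>I. a i) = a N + (\<Sum>i\<in>I - {N}. a i)" by (rule sum.remove[OF fin N])
    have "(\<Sum>i\<in>I - {N}. a i) \<le> s" unfolding s_def by (intro sum_mono) auto
    then have y: "- a N - s \<le> y" unfolding y_def total by simp
    have a': "3 * m * s + m * a N + A * exp (y / \<epsilon>) \<le> K" using a by (simp add: s_def y_def)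
    have "(2 * m) * (- a N - s) \<le> (2 * m) * y" "(m / 2) * (- a N - s) \<le> (m / 2) * y"
      using pos(1) y by (auto intro!: mult_left_mono)
    then have "m * (s - a N) \<le> K + C2" "m * (5 * s + a N) \<le> 2 * (K + C3)"
      using a' C2[of y] C3[of y] by (auto simp: algebra_simps)
    then have 1: "s - a N \<le> b1" and 2: "5 * s + a N \<le> b2"
      using pos(1) by (auto simp: b1_def b2_def pos_le_divide_eq mult.commute)
    have "0 \<le> 3 * m * s" using s0 pos(1) by simp
    then have "m * (y + a N) \<le> K + C4" using a' C4[of y] by (simp add: algebra_simps)
    then have 3: "y + a N \<le> b3"
      using pos(1) by (simp add: b3_def pos_le_divide_eq mult.commute)
    show ?thesis
    proof (cases "i = N")
      case True
      then show ?thesis using 1 2 s0 unfolding B_def by (auto simp: abs_if)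
    next
      case False
      have "max (a i) 0 \<le> s" unfolding s_def
        using fin i False by (intro member_le_sum) auto
      moreover have "(\<Sum>k\<in>I - {N}. a k) = a i + (\<Sum>k\<in>I - {N} - {i}. a k)"
        using fin i False by (intro sum.remove) auto
      moreover have "(\<Sum>k\<in>I - {N} - {i}. a k) \<le> (\<Sum>k\<in>I - {N} - {i}. max (a k) 0)"
        by (intro sum_mono) auto
      moreover have "(\<Sum>k\<in>I - {N} - {i}. max (a k) 0) \<le> s"
        unfolding s_def using fin by (intro sum_mono2) auto
      ultimately have "a i \<le> s" "- a i \<le> y + a N + s" unfolding y_def total by auto
      then show ?thesis using 1 2 3 s0 unfolding B_def by (auto simp: abs_if)
    qed
  qed
  then show ?thesis by blast
qed

context entropic_dual
begin

lemma bounded_tuple_le: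
  assumes "bounded_tuple f"
  shows "\<exists>M. tuple_le M f"
proof -
  have "\<forall>i\<in>I. \<exists>B. AE x in \<gamma> i. \<bar>f i x\<bar> \<le> B"
    using assms by (auto simp: bounded_tuple_def ess_bounded_def)
  then obtain B where B: "\<And>i. i \<in> I \<Longrightarrow> AE x in \<gamma> i. \<bar>f i x\<bar> \<le> B i" by metis
  have "tuple_le (\<Sum>i\<in>I. \<bar>B i\<bar>) f"
    unfolding tuple_le_def
  proof
    fix i assume i: "i \<in> I"
    have "B i \<le> (\<Sum>i\<in>I. \<bar>B i\<bar>)"
      using member_le_sum[of i I "\<lambda>i. \<bar>B i\<bar>"] i finite_I by auto
    with B[OF i] show "AE x in \<gamma> i. \<bar>f i x\<bar> \<le> (\<Sum>i\<in>I. \<bar>B i\<bar>)"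
      by (auto elim!: eventually_mono)
  qed
  then show ?thesis by blast
qed

lemma tuple_le_mono: "tuple_le M f \<Longrightarrow> M \<le> M' \<Longrightarrow> tuple_le M' f"
  unfolding tuple_le_def by (auto elim!: eventually_mono)

lemma osc_le_mono: "osc_le R i h \<Longrightarrow> R \<le> R' \<Longrightarrow> osc_le R' i h"
  unfolding osc_le_def by (fastforce elim!: eventually_mono)

lemma marginal_cost_lower:
  assumes i: "i \<in> I" and h: "finite_cost i h" and b: "AE x in \<gamma> i. b \<le> conj_val i h x"
  shows "measure (\<mu> i) (space (\<mu> i)) * b \<le> marginal_cost i h"
proof -
  interpret m: finite_measure "\<mu> i" by (rule finite_mu[OF i])
  have "(\<integral>x. b \<partial>\<mu> i) \<le> marginal_cost i h"
    unfolding marginal_cost_def using h AE_mu[OF i b]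
    by (intro integral_mono_AE) (auto simp: finite_cost_def)
  then show ?thesis by (simp add: mult.commute)
qed

text \<open>A component with bounded oscillation is determined up to a bounded error by a lower bound
\<open>l\<^sub>i\<close>, so the cost dominates a coercive function of the numbers \<open>a\<^sub>i = - l\<^sub>i - R\<close>, which are lower bounds
of \<open>- f\<^sub>i\<close>. The slope \<open>3 m\<^sub>N / m\<^sub>i\<close> in \<open>conj_fun_coercive\<close> is chosen to meet \<open>coercivity_bound\<close>.\<close>

lemma apriori_bound: "\<exists>M. \<forall>f. finite_costs f \<and> (\<forall>i\<in>I. osc_le R i (f i)) \<and> cost f \<le> K \<longrightarrow> tuple_le M f"
proof -
  define m where "m i = measure (\<mu> i) (space (\<mu> i))" for i
  have m: "0 < m i" if "i \<in> I" for i using measure_mu_pos[OF that] by (simp add: m_def)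
  note mN = m[OF N_in_I]
  have "\<forall>i\<in>I - {N}. \<exists>D. \<forall>q. ereal (3 * m N / m i * max q 0 - D) \<le> conj_fun (\<phi> i) q"
    using m mN by (intro ballI conj_fun_coercive entropy full_domain) (auto simp: less_imp_le)
  then obtain D where D: "\<And>i q. i \<in> I - {N} \<Longrightarrow>
      ereal (3 * m N / m i * max q 0 - D i) \<le> conj_fun (\<phi> i) q" by metis
  define D1 where "D1 = (\<Sum>i\<in>I - {N}. m i * D i)"
  define n where "n = real (card I)"
  define G where "G = measure P (space P)"
  define A where "A = \<epsilon> * G * exp (- ((n * R + C) / \<epsilon>))"
  have A: "0 < A" using eps_pos measure_PiM_pos[of I] by (simp add: A_def G_def)
  obtain B where B: "\<And>a i. 3 * m N * (\<Sum>i\<in>I - {N}. max (a i) 0) + m N * a N +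
      A * exp (- (\<Sum>i\<in>I. a i) / \<epsilon>) \<le> K + D1 \<Longrightarrow> i \<in> I \<Longrightarrow> \<bar>a i\<bar> \<le> B"
    using coercivity_bound[OF finite_I N_in_I mN A eps_pos, of "K + D1"] by blast
  have "tuple_le (B + \<bar>R\<bar>) f"
    if f: "finite_costs f" and osc: "\<forall>i\<in>I. osc_le R i (f i)" and K: "cost f \<le> K" for f
  proof -
    obtain l where l: "\<And>i. i \<in> I \<Longrightarrow> AE x in \<gamma> i. l i \<le> f i x \<and> f i x \<le> l i + R"
      using osc unfolding osc_le_def by metis
    define a where "a i = - l i - R" for i
    have c1: "3 * m N * max (a i) 0 - m i * D i \<le> marginal_cost i (f i)" if i: "i \<in> I - {N}" for i
    proof -
      have iI: "i \<in> I" using i by simp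
      have fi: "finite_cost i (f i)" using f iI by (simp add: finite_costs_def)
      have "AE x in \<gamma> i. 3 * m N / m i * max (a i) 0 - D i \<le> conj_val i (f i) x"
      proof -
        have "AE x in \<gamma> i. conj_fun (\<phi> i) (- f i x) < \<infinity>"
          using fi by (intro AE_gamma_of_AE_mu[OF iI]) (simp add: finite_cost_def)
        with l[OF iI] show ?thesis
        proof eventually_elim
          case (elim x)
          then have fin: "conj_fun (\<phi> i) (- f i x) < \<infinity>" by simp
          have "3 * m N / m i * max (a i) 0 \<le> 3 * m N / m i * max (- f i x) 0"
            using elim m[OF iI] mN by (intro mult_left_mono) (auto simp: a_def)
          moreover have "ereal (3 * m N / m i * max (- f i x) 0 - D i) \<le> ereal (conj_val i (f i) x)"
            using D[OF i, of "- f i x"] conj_val_eq[where h = "f i", OF iI fin] by simp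
          ultimately show ?case by simp
        qed
      qed
      from marginal_cost_lower[OF iI fi this]
      have "m i * (3 * m N / m i * max (a i) 0 - D i) \<le> marginal_cost i (f i)" by (simp add: m_def)
      moreover have "m i * (3 * m N / m i * max (a i) 0 - D i) = 3 * m N * max (a i) 0 - m i * D i"
        using m[OF iI] by (simp add: right_diff_distrib)
      ultimately show ?thesis by simp
    qed
    have c2: "m N * a N \<le> marginal_cost N (f N)"
    proof -
      have fN: "finite_cost N (f N)" using f N_in_I by (simp add: finite_costs_def)
      have "AE x in \<gamma> N. conj_fun (\<phi> N) (- f N x) < \<infinity>"
        using fN by (intro AE_gamma_of_AE_mu[OF N_in_I]) (simp add: finite_cost_def)
      with l[OF N_in_I] have "AE x in \<gamma> N. a N \<le> conj_val N (f N) x"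
      proof eventually_elim
        case (elim x)
        then have fin: "conj_fun (\<phi> N) (- f N x) < \<infinity>" by simp
        show ?case using conj_val_ge[where h = "f N", OF N_in_I fin] elim by (simp add: a_def)
      qed
      from marginal_cost_lower[OF N_in_I fN this] show ?thesis by (simp add: m_def)
    qed
    have c3: "A * exp (- (\<Sum>i\<in>I. a i) / \<epsilon>) \<le> \<epsilon> * (\<integral>x. plan f x \<partial>P)"
    proof -
      let ?k = "exp ((- (\<Sum>i\<in>I. a i) - (n * R + C)) / \<epsilon>)"
      have "AE x in P. \<forall>i\<in>I. l i \<le> f i (x i)"
        using l by (intro AE_finite_allI[OF finite_I] AE_component[OF subset_refl])
          (auto elim!: eventually_mono)
      with AE_space have "AE x in P. ?k \<le> plan f x"
      proof eventually_elim
        case (elim x)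
        have "(\<Sum>i\<in>I. l i) \<le> oplus I f x" unfolding oplus_def using elim by (intro sum_mono) auto
        moreover have "(\<Sum>i\<in>I. l i) = - (\<Sum>i\<in>I. a i) - n * R"
          by (simp add: a_def n_def sum_subtractf sum_negf)
        ultimately have "- (\<Sum>i\<in>I. a i) - (n * R + C) \<le> oplus I f x - c x"
          using c_bounds[OF elim(1)] by simp
        then show ?case unfolding plan_def using eps_pos by (simp add: divide_right_mono)
      qed
      then have "(\<integral>x. ?k \<partial>P) \<le> (\<integral>x. plan f x \<partial>P)"
        by (intro integral_mono_AE integrable_P ess_bounded_const ess_bounded_plan
            finite_costs_bounded f)
      then have "G * ?k \<le> (\<integral>x. plan f x \<partial>P)" by (simp add: G_def mult.commute)
      then have "\<epsilon> * (G * ?k) \<le> \<epsilon> * (\<integral>x. plan f x \<partial>P)" using eps_pos by simp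
      moreover have "?k = exp (- ((n * R + C) / \<epsilon>)) * exp (- (\<Sum>i\<in>I. a i) / \<epsilon>)"
        by (simp add: exp_add[symmetric] diff_divide_distrib)
      ultimately show ?thesis by (simp add: A_def mult.assoc)
    qed
    have "(\<Sum>i\<in>I - {N}. 3 * m N * max (a i) 0 - m i * D i) \<le> (\<Sum>i\<in>I - {N}. marginal_cost i (f i))"
      by (intro sum_mono c1)
    then have "3 * m N * (\<Sum>i\<in>I - {N}. max (a i) 0) - D1 \<le> (\<Sum>i\<in>I - {N}. marginal_cost i (f i))"
      by (simp add: sum_subtractf sum_distrib_left D1_def)
    moreover have "(\<Sum>i\<in>I. marginal_cost i (f i)) = marginal_cost N (f N) + (\<Sum>i\<in>I - {N}. marginal_cost i (f i))"
      by (rule sum.remove[OF finite_I N_in_I])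
    ultimately have "3 * m N * (\<Sum>i\<in>I - {N}. max (a i) 0) + m N * a N + A * exp (- (\<Sum>i\<in>I. a i) / \<epsilon>) \<le> K + D1"
      using c2 c3 K unfolding cost_def by linarith
    note B = B[OF this]
    show ?thesis
      unfolding tuple_le_def
    proof
      fix i assume i: "i \<in> I"
      from l[OF i] show "AE x in \<gamma> i. \<bar>f i x\<bar> \<le> B + \<bar>R\<bar>"
        by eventually_elim (use B[OF i] in \<open>auto simp: a_def\<close>)
    qed
  qed
  then show ?thesis by blast
qed

end

section \<open>From mean square convergence to \<open>L\<^sup>p\<close> convergence\<close>

lemma null_sandwich:
  fixes a b :: "nat \<Rightarrow> real"
  assumes "\<forall>n. 0 \<le> a n" "\<forall>n. a n \<le> b n" "b \<longlonglongrightarrow> 0"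
  shows "a \<longlonglongrightarrow> 0"
  by (rule real_tendsto_sandwich[OF always_eventually[OF assms(1)] always_eventually[OF assms(2)]
        tendsto_const assms(3)])

text \<open>Integrate \<open>|u| \<le> \<delta> + u\<^sup>2 / \<delta>\<close>.\<close>

lemma (in finite_measure) L2_null_imp_L1_null:
  assumes b: "\<And>n. ess_bounded M (u n)" and l: "(\<lambda>n. \<integral>x. (u n x)\<^sup>2 \<partial>M) \<longlonglongrightarrow> 0"
  shows "(\<lambda>n::nat. \<integral>x. \<bar>u n x\<bar> \<partial>M) \<longlonglongrightarrow> 0"
proof (rule LIMSEQ_I)
  fix e :: real assume e: "0 < e"
  define G where "G = measure M (space M)"
  define \<delta> where "\<delta> = e / (2 * (G + 1))"
  have G: "0 \<le> G" by (simp add: G_def)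
  have \<delta>: "0 < \<delta>" using e G by (simp add: \<delta>_def)
  have "0 < e * \<delta> / 2" using e \<delta> by simp
  from LIMSEQ_D[OF l this] obtain n0 where n0: "\<And>n. n \<ge> n0 \<Longrightarrow> \<bar>\<integral>x. (u n x)\<^sup>2 \<partial>M\<bar> < e * \<delta> / 2"
    by auto
  show "\<exists>n0. \<forall>n\<ge>n0. norm ((\<integral>x. \<bar>u n x\<bar> \<partial>M) - 0) < e"
  proof (intro exI[of _ n0] allI impI)
    fix n assume n: "n \<ge> n0"
    have "(\<integral>x. \<bar>u n x\<bar> \<partial>M) \<le> (\<integral>x. \<delta> + (u n x)\<^sup>2 / \<delta> \<partial>M)"
    proof (intro integral_mono ess_bounded_integrable ess_bounded_intros b)
      fix x
      have "2 * \<delta> * \<bar>u n x\<bar> \<le> \<delta>\<^sup>2 + (u n x)\<^sup>2"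
        using sum_squares_bound[of \<delta> "\<bar>u n x\<bar>"] by simp
      then have "\<delta> * \<bar>u n x\<bar> \<le> \<delta>\<^sup>2 + (u n x)\<^sup>2"
        using \<delta> mult_nonneg_nonneg[of \<delta> "\<bar>u n x\<bar>"] by linarith
      then show "\<bar>u n x\<bar> \<le> \<delta> + (u n x)\<^sup>2 / \<delta>"
        using \<delta> by (simp add: field_simps power2_eq_square)
    qed
    also have "\<dots> = \<delta> * G + (\<integral>x. (u n x)\<^sup>2 \<partial>M) / \<delta>"
      unfolding G_def
      by (subst Bochner_Integration.integral_add)
        (auto intro!: ess_bounded_integrable ess_bounded_intros b)
    also have "\<dots> < e"
    proof -
      have "(\<integral>x. (u n x)\<^sup>2 \<partial>M) / \<delta> < e / 2"
        using n0[OF n] \<delta> by (simp add: pos_divide_less_eq mult.commute)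
      moreover have "\<delta> * G \<le> e / 2"
        using G e by (simp add: \<delta>_def field_simps)
      ultimately show ?thesis by linarith
    qed
    finally show "norm ((\<integral>x. \<bar>u n x\<bar> \<partial>M) - 0) < e" by simp
  qed
qed

text \<open>On functions bounded by \<open>B\<close>, \<open>|u|\<^sup>p \<le> B\<^sup>p\<^sup>-\<^sup>1 |u|\<close>; so convergence in \<open>L\<^sup>1\<close> is all that has to be proved.\<close>

lemma (in finite_measure) L1_null_imp_Lp_null:
  assumes b: "\<And>n. ess_bounded M (u n)" and B: "\<And>n. AE x in M. \<bar>u n x\<bar> \<le> B"
    and l: "(\<lambda>n. \<integral>x. \<bar>u n x\<bar> \<partial>M) \<longlonglongrightarrow> 0" and p: "1 \<le> p"
  shows "(\<lambda>n::nat. Lp_norm p M (u n)) \<longlonglongrightarrow> 0"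
proof -
  have [measurable]: "u n \<in> borel_measurable M" for n by (rule ess_bounded_measurable[OF b])
  have AE: "AE x in M. \<bar>u n x\<bar> powr p \<le> \<bar>B\<bar> powr (p - 1) * \<bar>u n x\<bar>" for n
    using B[of n]
  proof eventually_elim
    case (elim x)
    have "\<bar>u n x\<bar> powr p = \<bar>u n x\<bar> powr (p - 1) * \<bar>u n x\<bar>"
      by (cases "u n x = 0") (auto simp: powr_diff)
    also have "\<dots> \<le> \<bar>B\<bar> powr (p - 1) * \<bar>u n x\<bar>"
      using elim p by (intro mult_right_mono powr_mono2) auto
    finally show ?case .
  qed
  have ub: "ess_bounded M (\<lambda>x. \<bar>B\<bar> powr (p - 1) * \<bar>u n x\<bar>)" for n
    by (intro ess_bounded_intros b)
  have "(\<lambda>n. \<integral>x. \<bar>u n x\<bar> powr p \<partial>M) \<longlonglongrightarrow> 0"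
  proof (rule null_sandwich)
    show "\<forall>n. 0 \<le> (\<integral>x. \<bar>u n x\<bar> powr p \<partial>M)" by simp
    show "\<forall>n. (\<integral>x. \<bar>u n x\<bar> powr p \<partial>M) \<le> \<bar>B\<bar> powr (p - 1) * (\<integral>x. \<bar>u n x\<bar> \<partial>M)"
    proof
      fix n
      have "(\<integral>x. \<bar>u n x\<bar> powr p \<partial>M) \<le> (\<integral>x. \<bar>B\<bar> powr (p - 1) * \<bar>u n x\<bar> \<partial>M)"
        by (rule integral_mono_AE'[OF ess_bounded_integrable[OF ub] AE]) auto
      then show "(\<integral>x. \<bar>u n x\<bar> powr p \<partial>M) \<le> \<bar>B\<bar> powr (p - 1) * (\<integral>x. \<bar>u n x\<bar> \<partial>M)" by simp
    qed
    show "(\<lambda>n. \<bar>B\<bar> powr (p - 1) * (\<integral>x. \<bar>u n x\<bar> \<partial>M)) \<longlonglongrightarrow> 0"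
      using tendsto_mult_left[OF l, of "\<bar>B\<bar> powr (p - 1)"] by simp
  qed
  then show ?thesis
    unfolding Lp_norm_def using p
    by (intro tendsto_zero_powrI[OF _ tendsto_const]) (auto intro!: always_eventually)
qed

section \<open>Convergence of the sums of the potentials\<close>

context entropic_dual
begin

lemma plan_lipschitz:
  assumes M: "tuple_le M f" "tuple_le M g"
  shows "AE x in P. \<bar>plan f x - plan g x\<bar> \<le>
    exp (real (card I) * M / \<epsilon>) / \<epsilon> * \<bar>oplus I f x - oplus I g x\<bar>"
  using AE_space tuple_le_oplus[OF M(1)] tuple_le_oplus[OF M(2)]
proof eventually_elim
  case (elim x)
  have exp_diff_le: "\<bar>exp a - exp b\<bar> \<le> exp k * \<bar>a - b\<bar>" if "a \<le> k" "b \<le> k" for a b k :: real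
  proof -
    have *: "exp a - exp b \<le> exp k * \<bar>a - b\<bar>" if "a \<le> k" for a b
    proof -
      have "exp a * (1 + (b - a)) \<le> exp a * exp (b - a)"
        by (intro mult_left_mono exp_ge_add_one_self) auto
      then have "exp a - exp b \<le> exp a * (a - b)" by (simp add: exp_diff algebra_simps)
      also have "\<dots> \<le> exp a * \<bar>a - b\<bar>" by (intro mult_left_mono) auto
      also have "\<dots> \<le> exp k * \<bar>a - b\<bar>" using that by (intro mult_right_mono) auto
      finally show ?thesis .
    qed
    show ?thesis using *[OF that(1), of b] *[OF that(2), of a] by (simp add: abs_minus_commute abs_le_iff)
  qed
  let ?k = "real (card I) * M / \<epsilon>" and ?a = "(oplus I f x - c x) / \<epsilon>" and ?b = "(oplus I g x - c x) / \<epsilon>"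
  have "?a \<le> ?k" "?b \<le> ?k"
    using elim c_bounds[OF elim(1)] eps_pos by (auto intro!: divide_right_mono)
  then have "\<bar>exp ?a - exp ?b\<bar> \<le> exp (?k) * \<bar>?a - ?b\<bar>" by (rule exp_diff_le)
  moreover have "\<bar>?a - ?b\<bar> = \<bar>oplus I f x - oplus I g x\<bar> / \<epsilon>"
    using eps_pos by (simp add: diff_divide_distrib[symmetric])
  ultimately show ?case by (simp add: plan_def)
qed

lemma plan_L1_null:
  assumes f: "\<And>n. bounded_tuple (f n)" "\<And>n. bounded_tuple (g n)"
    and M: "\<And>n. tuple_le M (f n)" "\<And>n. tuple_le M (g n)"
    and l: "(\<lambda>n. \<integral>x. \<bar>oplus I (f n) x - oplus I (g n) x\<bar> \<partial>P) \<longlonglongrightarrow> 0"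
  shows "(\<lambda>n::nat. \<integral>x. \<bar>plan (f n) x - plan (g n) x\<bar> \<partial>P) \<longlonglongrightarrow> 0"
proof (rule null_sandwich)
  let ?L = "exp (real (card I) * M / \<epsilon>) / \<epsilon>"
  show "\<forall>n. 0 \<le> (\<integral>x. \<bar>plan (f n) x - plan (g n) x\<bar> \<partial>P)" by simp
  show "\<forall>n. (\<integral>x. \<bar>plan (f n) x - plan (g n) x\<bar> \<partial>P)
      \<le> ?L * (\<integral>x. \<bar>oplus I (f n) x - oplus I (g n) x\<bar> \<partial>P)"
  proof
    fix n
    have "(\<integral>x. \<bar>plan (f n) x - plan (g n) x\<bar> \<partial>P)
      \<le> (\<integral>x. ?L * \<bar>oplus I (f n) x - oplus I (g n) x\<bar> \<partial>P)"
      by (intro integral_mono_AE plan_lipschitz M integrable_P ess_bounded_intros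
          ess_bounded_plan ess_bounded_oplus f) auto
    then show "(\<integral>x. \<bar>plan (f n) x - plan (g n) x\<bar> \<partial>P)
      \<le> ?L * (\<integral>x. \<bar>oplus I (f n) x - oplus I (g n) x\<bar> \<partial>P)" by simp
  qed
  show "(\<lambda>n. ?L * (\<integral>x. \<bar>oplus I (f n) x - oplus I (g n) x\<bar> \<partial>P)) \<longlonglongrightarrow> 0"
    using tendsto_mult_left[OF l, of ?L] by simp
qed

end

text \<open>A Sinkhorn sequence together with one minimiser \<open>fh\<close> it is compared with.\<close>

locale sinkhorn_iteration = entropic_dual I N \<epsilon> \<phi> \<mu> \<gamma> c S C \<sigma>
  for I :: "nat set" and N :: nat and \<epsilon> :: real and \<phi> :: "nat \<Rightarrow> real \<Rightarrow> ereal"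
    and \<mu> \<gamma> :: "nat \<Rightarrow> 'a measure" and c :: "(nat \<Rightarrow> 'a) \<Rightarrow> real" and S C :: real
    and \<sigma> :: "nat \<Rightarrow> 'a \<Rightarrow> real" +
  fixes f0 fh :: "nat \<Rightarrow> 'a \<Rightarrow> real"
  assumes I_eq: "I = {1..N}"
    and start: "finite_costs f0"
    and opt_finite: "finite_costs fh"
    and opt_minimal: "\<And>g. finite_costs g \<Longrightarrow> cost fh \<le> cost g"
begin

definition iter :: "nat \<Rightarrow> nat \<Rightarrow> 'a \<Rightarrow> real" where
  "iter = sinkhorn_seq N \<epsilon> \<phi> \<mu> \<gamma> c f0"

definition active :: "nat \<Rightarrow> nat" where "active n = n mod N + 1"

lemma active_in: "active n \<in> I"
  using N_in_I mod_less_divisor[of N n] by (simp add: I_eq active_def Suc_le_eq)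

lemma iter_0: "iter 0 = f0"
  by (simp add: iter_def)

lemma iter_Suc: "iter (Suc n) = (iter n)(active n := skmap (active n) (iter n))"
  by (simp add: iter_def active_def Let_def I_eq)

lemma finite_costs_iter: "finite_costs (iter n)"
proof (induction n)
  case (Suc n)
  then show ?case unfolding iter_Suc by (rule finite_costs_skmap[OF active_in])
qed (simp add: start iter_0)

lemmas bounded_iter = finite_costs_bounded[OF finite_costs_iter]
lemmas bounded_opt = finite_costs_bounded[OF opt_finite]

lemma cost_iter_Suc: "cost (iter (Suc n)) \<le> cost (iter n)"
proof -
  obtain A B where "tuple_le A (iter n)" "tuple_le B (iter (Suc n))"
    using bounded_iter bounded_tuple_le by metis
  then obtain M where M: "tuple_le M (iter n)" "tuple_le M (iter (Suc n))"
    using tuple_le_mono max.cobounded1 max.cobounded2 by metis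
  have "0 \<le> modulus M * (\<integral>x. (oplus I (iter (Suc n)) x - oplus I (iter n) x)\<^sup>2 \<partial>P)"
    using modulus_pos[of M] by simp
  also have "\<dots> \<le> cost (iter n) - cost (iter (Suc n))"
    by (rule skmap_decrease[OF active_in finite_costs_iter iter_Suc M])
  finally show ?thesis by simp
qed

lemma cost_iter_le: "cost (iter n) \<le> cost f0"
proof (induction n)
  case (Suc n)
  then show ?case using cost_iter_Suc[of n] by (rule order_trans[rotated])
qed (simp add: iter_0)

lemma iter_osc: "\<exists>R. \<forall>n. \<forall>i\<in>I. osc_le R i (iter n i)"
proof -
  obtain M where M: "tuple_le M f0"
    using bounded_tuple_le[OF finite_costs_bounded[OF start]] by blast
  define R where "R = max osc_bound (2 * M)"
  have "\<forall>i\<in>I. osc_le R i (iter n i)" for n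
  proof (induction n)
    case 0
    show ?case
    proof
      fix i assume "i \<in> I"
      with M have "AE x in \<gamma> i. \<bar>f0 i x\<bar> \<le> M" by (simp add: tuple_le_def)
      then have "AE x in \<gamma> i. - M \<le> f0 i x \<and> f0 i x \<le> - M + 2 * M"
        by eventually_elim auto
      then have "osc_le (2 * M) i (f0 i)" unfolding osc_le_def by blast
      then show "osc_le R i (iter 0 i)" by (auto simp: R_def iter_0 elim: osc_le_mono)
    qed
  next
    case (Suc n)
    have "osc_le R (active n) (skmap (active n) (iter n))"
      using skmap_osc_le[OF active_in bounded_iter] by (rule osc_le_mono) (simp add: R_def)
    then show ?case using Suc unfolding iter_Suc by simp
  qed
  then show ?thesis by blast
qed

definition bnd :: real where
  "bnd = (SOME M. (\<forall>n. tuple_le M (iter n)) \<and> tuple_le M fh)"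

lemma iter_le: "tuple_le bnd (iter n)" and opt_le: "tuple_le bnd fh"
proof -
  obtain R where R: "\<forall>n. \<forall>i\<in>I. osc_le R i (iter n i)" using iter_osc by blast
  obtain M where M: "\<forall>f. finite_costs f \<and> (\<forall>i\<in>I. osc_le R i (f i)) \<and> cost f \<le> cost f0
      \<longrightarrow> tuple_le M f"
    using apriori_bound[of R "cost f0"] by blast
  obtain M' where M': "tuple_le M' fh" using bounded_tuple_le[OF bounded_opt] by blast
  have "\<forall>n. tuple_le M (iter n)" using R M finite_costs_iter cost_iter_le by blast
  with M' have "(\<forall>n. tuple_le (max M M') (iter n)) \<and> tuple_le (max M M') fh"
    using tuple_le_mono[of M _ "max M M'"] tuple_le_mono[of M' _ "max M M'"] by simp
  then have "(\<forall>n. tuple_le bnd (iter n)) \<and> tuple_le bnd fh" unfolding bnd_def by (rule someI)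
  then show "tuple_le bnd (iter n)" "tuple_le bnd fh" by auto
qed

lemma ess_bounded_oplus_I: "bounded_tuple f \<Longrightarrow> ess_bounded P (oplus I f)"
  by (rule ess_bounded_oplus) auto

lemma increments_null:
  "(\<lambda>n. \<integral>x. \<bar>oplus I (iter (Suc n)) x - oplus I (iter n) x\<bar> \<partial>P) \<longlonglongrightarrow> 0"
proof (rule finite_measure.L2_null_imp_L1_null[OF finite_PiM[OF subset_refl]])
  show "ess_bounded P (\<lambda>x. oplus I (iter (Suc n)) x - oplus I (iter n) x)" for n
    by (intro ess_bounded_diff ess_bounded_oplus_I bounded_iter)
  have "decseq (\<lambda>n. cost (iter n))" by (rule decseq_SucI) (rule cost_iter_Suc)
  moreover have "\<forall>n. cost fh \<le> cost (iter n)" using opt_minimal finite_costs_iter by blast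
  ultimately obtain L where L: "(\<lambda>n. cost (iter n)) \<longlonglongrightarrow> L" by (rule decseq_convergent) 
  have "(\<lambda>n. (cost (iter n) - cost (iter (Suc n))) / modulus bnd) \<longlonglongrightarrow> (L - L) / modulus bnd"
    using modulus_pos[of bnd] by (intro tendsto_intros L LIMSEQ_Suc[OF L]) auto
  then have lim: "(\<lambda>n. (cost (iter n) - cost (iter (Suc n))) / modulus bnd) \<longlonglongrightarrow> 0" by simp
  show "(\<lambda>n. \<integral>x. (oplus I (iter (Suc n)) x - oplus I (iter n) x)\<^sup>2 \<partial>P) \<longlonglongrightarrow> 0"
  proof (rule null_sandwich[OF _ _ lim])
    show "\<forall>n. (\<integral>x. (oplus I (iter (Suc n)) x - oplus I (iter n) x)\<^sup>2 \<partial>P)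
        \<le> (cost (iter n) - cost (iter (Suc n))) / modulus bnd"
      using skmap_decrease[OF active_in finite_costs_iter iter_Suc iter_le iter_le] modulus_pos[of bnd]
      by (simp add: pos_le_divide_eq mult.commute)
  qed simp
qed

text \<open>Bounds the change of the pairing of the plan density with a fixed deviation during one step.\<close>

definition drift :: "nat \<Rightarrow> real" where
  "drift n = 2 * \<bar>bnd\<bar> * (\<integral>x. \<bar>plan (iter (Suc n)) x - plan (iter n) x\<bar> \<partial>P)"

lemma drift_nonneg: "0 \<le> drift n"
  by (simp add: drift_def)

lemma drift_null: "drift \<longlonglongrightarrow> 0"
proof -
  have "(\<lambda>n. \<integral>x. \<bar>plan (iter (Suc n)) x - plan (iter n) x\<bar> \<partial>P) \<longlonglongrightarrow> 0"
    by (rule plan_L1_null[OF bounded_iter bounded_iter iter_le iter_le increments_null])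
  from tendsto_mult_left[OF this, of "2 * \<bar>bnd\<bar>"] show ?thesis
    by (simp add: drift_def[abs_def])
qed

definition dev :: "nat \<Rightarrow> nat \<Rightarrow> 'a \<Rightarrow> real" where
  "dev n i x = iter n i x - fh i x"

lemma dev_ess_bounded: "i \<in> I \<Longrightarrow> ess_bounded (\<gamma> i) (dev n i)"
  unfolding dev_def[abs_def] using bounded_iter bounded_opt
  by (intro ess_bounded_diff) (auto simp: bounded_tuple_def)

lemma dev_bound:
  assumes "i \<in> I"
  shows "AE x in \<gamma> i. \<bar>dev n i x\<bar> \<le> 2 * \<bar>bnd\<bar>"
proof -
  have "AE x in \<gamma> i. \<bar>iter n i x\<bar> \<le> bnd" "AE x in \<gamma> i. \<bar>fh i x\<bar> \<le> bnd"
    using iter_le[of n] opt_le assms by (auto simp: tuple_le_def)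
  then show ?thesis by eventually_elim (auto simp: dev_def)
qed

lemma dev_component_ess_bounded: "i \<in> I \<Longrightarrow> ess_bounded P (\<lambda>z. dev n i (z i))"
  by (intro ess_bounded_component dev_ess_bounded) auto

lemma oplus_dev: "oplus I (iter n) z - oplus I fh z = (\<Sum>i\<in>I. dev n i (z i))"
  by (simp add: oplus_def dev_def sum_subtractf)

text \<open>The optimality condition of component \<open>i\<close>, tested against the minimiser, up to an error \<open>r\<close>.\<close>

definition gap_le :: "nat \<Rightarrow> nat \<Rightarrow> real \<Rightarrow> bool" where
  "gap_le i n r \<longleftrightarrow> marginal_cost i (iter n i) + (\<integral>z. plan (iter n) z * dev n i (z i) \<partial>P)
      \<le> marginal_cost i (fh i) + r"

lemma gap_mono: "gap_le i n r \<Longrightarrow> r \<le> r' \<Longrightarrow> gap_le i n r'"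
  by (simp add: gap_le_def)

lemma gap_updated: "gap_le (active n) (Suc n) 0"
  using skmap_variational[OF active_in bounded_iter, of n "fh (active n)"] opt_finite active_in[of n]
  unfolding gap_le_def dev_def iter_Suc by (simp add: finite_costs_def)

text \<open>A component that is not updated keeps its cost and its deviation, and only the plan density in its
optimality condition changes.\<close>

lemma gap_next:
  assumes i: "i \<in> I" and g: "gap_le i n r" and r: "0 \<le> r"
  shows "gap_le i (Suc n) (r + drift n)"
proof (cases "i = active n")
  case True
  show ?thesis
    unfolding True by (rule gap_mono[OF gap_updated]) (use r drift_nonneg in auto)
next
  case False
  have eq: "iter (Suc n) i = iter n i" "dev (Suc n) i = dev n i"
    using False by (auto simp: iter_Suc dev_def fun_eq_iff)
  let ?D = "\<lambda>z. plan (iter (Suc n)) z * dev n i (z i) - plan (iter n) z * dev n i (z i)"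
  note b = ess_bounded_plan[OF bounded_iter] dev_component_ess_bounded[OF i]
  have int: "integrable P (\<lambda>z. plan (iter m) z * dev n i (z i))" for m
    by (intro integrable_P ess_bounded_intros b)
  have "(\<integral>z. plan (iter (Suc n)) z * dev n i (z i) \<partial>P) - (\<integral>z. plan (iter n) z * dev n i (z i) \<partial>P)
      = (\<integral>z. ?D z \<partial>P)"
    using int by simp
  also have "\<dots> \<le> (\<integral>z. 2 * \<bar>bnd\<bar> * \<bar>plan (iter (Suc n)) z - plan (iter n) z\<bar> \<partial>P)"
  proof (rule integral_mono_AE)
    show "integrable P ?D"
      using int by simp
    show "integrable P (\<lambda>z. 2 * \<bar>bnd\<bar> * \<bar>plan (iter (Suc n)) z - plan (iter n) z\<bar>)"
      by (intro integrable_P ess_bounded_intros b)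
    have "AE z in P. \<bar>dev n i (z i)\<bar> \<le> 2 * \<bar>bnd\<bar>"
      by (rule AE_component[OF subset_refl i dev_bound[OF i]])
    then show "AE z in P. ?D z
        \<le> 2 * \<bar>bnd\<bar> * \<bar>plan (iter (Suc n)) z - plan (iter n) z\<bar>"
    proof eventually_elim
      case (elim z)
      let ?e = "plan (iter (Suc n)) z - plan (iter n) z"
      have "?e * dev n i (z i) \<le> \<bar>dev n i (z i)\<bar> * \<bar>?e\<bar>"
        by (metis abs_ge_self abs_mult mult.commute)
      also have "\<dots> \<le> 2 * \<bar>bnd\<bar> * \<bar>?e\<bar>" using elim by (intro mult_right_mono) auto
      finally show ?case by (simp add: algebra_simps)
    qed
  qed
  also have "\<dots> = drift n" by (simp add: drift_def)
  finally show ?thesis using g unfolding gap_le_def eq by simp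
qed

definition window :: "nat \<Rightarrow> real" where
  "window n = (\<Sum>l<N. drift (n + l))"

lemma window_null: "window \<longlonglongrightarrow> 0"
proof -
  have "(\<lambda>n. \<Sum>l<N. drift (n + l)) \<longlonglongrightarrow> (\<Sum>l<N. 0)"
    by (intro tendsto_sum LIMSEQ_ignore_initial_segment drift_null)
  then show ?thesis by (simp add: window_def[abs_def])
qed

text \<open>Among \<open>N\<close> consecutive steps one updates component \<open>i\<close> and resets its error to zero.\<close>

lemma gap_window:
  assumes i: "i \<in> I"
  shows "gap_le i (n + N) (window n)"
proof -
  have N: "0 < N" using i by (auto simp: I_eq)
  \<comment> \<open>the number of steps after \<open>n\<close> until component \<open>i\<close> is due; the summand \<open>N\<close> keeps the
    subtraction of naturals exact\<close>
  define k where "k = (i - 1 + (N - n mod N)) mod N"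
  have kN: "k < N" using N by (simp add: k_def)
  have "(n + k) mod N = (n mod N + (i - 1 + (N - n mod N))) mod N"
    unfolding k_def by (simp only: mod_add_left_eq mod_add_right_eq)
  also have "n mod N + (i - 1 + (N - n mod N)) = i - 1 + N"
    using mod_less_divisor[OF N, of n] by linarith
  also have "(i - 1 + N) mod N = i - 1"
  proof -
    have "i - 1 < N" using i by (auto simp: I_eq)
    then show ?thesis by (simp only: mod_add_self2 mod_less)
  qed
  finally have ik: "active (n + k) = i" using i by (auto simp: I_eq active_def)
  have step: "gap_le i (n + Suc (k + m)) (\<Sum>l<m. drift (n + Suc (k + l)))" for m
  proof (induction m)
    case 0
    show ?case using gap_updated[of "n + k"] unfolding ik by simp
  next
    case (Suc m)
    have "0 \<le> (\<Sum>l<m. drift (n + Suc (k + l)))" by (intro sum_nonneg drift_nonneg)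
    from gap_next[OF i Suc this] show ?case by simp
  qed
  have "gap_le i (n + N) (\<Sum>l<N - Suc k. drift (n + Suc (k + l)))"
    using step[of "N - Suc k"] kN by (simp add: Suc_diff_Suc)
  moreover have "(\<Sum>l<N - Suc k. drift (n + Suc (k + l))) \<le> window n"
  proof -
    have "(\<Sum>l<N - Suc k. drift (n + Suc (k + l))) = (\<Sum>l\<in>(\<lambda>l. Suc (k + l)) ` {..<N - Suc k}. drift (n + l))"
      by (subst sum.reindex) (auto simp: inj_on_def)
    also have "\<dots> \<le> window n"
      unfolding window_def by (intro sum_mono2 drift_nonneg) auto
    finally show ?thesis .
  qed
  ultimately show ?thesis by (rule gap_mono)
qed

text \<open>Summing the approximate optimality conditions over \<open>i\<close> and adding the strong convexity inequality
between the minimiser and the iterate bounds the squared distance of the sums by the errors, because the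
minimiser has the smaller cost.\<close>

lemma oplus_L1_null:
  "(\<lambda>n. \<integral>x. \<bar>oplus I (iter n) x - oplus I fh x\<bar> \<partial>P) \<longlonglongrightarrow> 0"
proof (rule finite_measure.L2_null_imp_L1_null[OF finite_PiM[OF subset_refl]])
  show "ess_bounded P (\<lambda>x. oplus I (iter n) x - oplus I fh x)" for n
    by (intro ess_bounded_diff ess_bounded_oplus_I bounded_iter bounded_opt)
  let ?D = "\<lambda>n. \<integral>x. (oplus I (iter n) x - oplus I fh x)\<^sup>2 \<partial>P"
  have le: "?D (n + N) \<le> real (card I) * window n / modulus bnd" for n
  proof -
    let ?f = "iter (n + N)" and ?E = "plan (iter (n + N))"
    have "(\<Sum>i\<in>I. marginal_cost i (?f i) + (\<integral>z. ?E z * dev (n + N) i (z i) \<partial>P))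
        \<le> (\<Sum>i\<in>I. marginal_cost i (fh i) + window n)"
      using gap_window unfolding gap_le_def by (intro sum_mono) auto
    moreover have "(\<Sum>i\<in>I. (\<integral>z. ?E z * dev (n + N) i (z i) \<partial>P)) =
        - (\<integral>z. ?E z * (oplus I fh z - oplus I ?f z) \<partial>P)"
    proof -
      have "(\<Sum>i\<in>I. (\<integral>z. ?E z * dev (n + N) i (z i) \<partial>P)) =
          (\<integral>z. (\<Sum>i\<in>I. ?E z * dev (n + N) i (z i)) \<partial>P)"
        by (intro Bochner_Integration.integral_sum[symmetric] integrable_P ess_bounded_mult
            ess_bounded_plan bounded_iter dev_component_ess_bounded)
      also have "\<dots> = (\<integral>z. - (?E z * (oplus I fh z - oplus I ?f z)) \<partial>P)"
        by (intro Bochner_Integration.integral_cong refl)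
          (simp add: sum_distrib_left[symmetric] oplus_dev[symmetric] right_diff_distrib)
      finally show ?thesis by simp
    qed
    moreover have "(\<integral>x. (oplus I fh x - oplus I ?f x)\<^sup>2 \<partial>P) = ?D (n + N)"
      by (simp add: power2_commute)
    moreover have "cost fh \<le> cost ?f" by (rule opt_minimal[OF finite_costs_iter])
    moreover note plan_convex[OF bounded_opt bounded_iter opt_le iter_le, of "n + N"]
    ultimately have "modulus bnd * ?D (n + N) \<le> real (card I) * window n"
      unfolding cost_def by (simp add: sum.distrib)
    then show ?thesis using modulus_pos[of bnd] by (simp add: pos_le_divide_eq mult.commute)
  qed
  have lim: "(\<lambda>n. real (card I) * window n / modulus bnd) \<longlonglongrightarrow> 0"
    using tendsto_mult_left[OF window_null, of "real (card I) / modulus bnd"] by simp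
  have "(\<lambda>n. ?D (n + N)) \<longlonglongrightarrow> 0"
  proof (rule null_sandwich[OF _ _ lim])
    show "\<forall>n. ?D (n + N) \<le> real (card I) * window n / modulus bnd" using le by blast
    show "\<forall>n. 0 \<le> ?D (n + N)" by simp
  qed
  then show "?D \<longlonglongrightarrow> 0" by (rule LIMSEQ_offset)
qed

lemma oplus_Lp_null:
  assumes "1 \<le> p"
  shows "(\<lambda>n. Lp_norm p P (\<lambda>x. oplus I (iter n) x - oplus I fh x)) \<longlonglongrightarrow> 0"
proof (rule finite_measure.L1_null_imp_Lp_null[OF finite_PiM[OF subset_refl] _ _ oplus_L1_null assms])
  show "ess_bounded P (\<lambda>x. oplus I (iter n) x - oplus I fh x)" for n
    by (intro ess_bounded_diff ess_bounded_oplus_I bounded_iter bounded_opt)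
  show "AE x in P. \<bar>oplus I (iter n) x - oplus I fh x\<bar> \<le> 2 * real (card I) * bnd" for n
    using tuple_le_oplus[OF iter_le[of n]] tuple_le_oplus[OF opt_le] by eventually_elim simp
qed

end

section \<open>Convergence of the individual potentials\<close>

context entropic_dual
begin

text \<open>The weight that integrating out all coordinates but \<open>j\<close> leaves on the \<open>j\<close>-th marginal.\<close>

definition comass :: "nat \<Rightarrow> real" where
  "comass j = measure (PiM (I - {j}) \<gamma>) (space (PiM (I - {j}) \<gamma>))"

lemma comass_pos: "0 < comass j"
  unfolding comass_def by (rule measure_PiM_pos) auto

lemma integral_component:
  assumes j: "j \<in> I" and h: "ess_bounded (\<gamma> j) h"
  shows "(\<integral>z. h (z j) \<partial>P) = comass j * (\<integral>x. h x \<partial>\<gamma> j)"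
  using integral_marginal[OF j integrable_P[OF ess_bounded_component[OF subset_refl j h]]]
  by (simp add: comass_def mult.commute)

text \<open>For fixed \<open>x\<^sub>j\<close> the average of the sum over the other coordinates is \<open>d\<^sub>j(x\<^sub>j)\<close> plus a constant, and
averaging does not increase the \<open>L\<^sup>1\<close> norm.\<close>

lemma component_deviation:
  assumes d: "bounded_tuple d" and j: "j \<in> I"
  shows "\<exists>\<kappa>. comass j * (\<integral>x. \<bar>d j x - \<kappa>\<bar> \<partial>\<gamma> j)
    \<le> (\<integral>z. \<bar>oplus I d z\<bar> \<partial>P)"
proof -
  let ?R = "PiM (I - {j}) \<gamma>"
  define T where "T = (\<integral>y. oplus (I - {j}) d y \<partial>?R)"
  note Q = comass_pos[of j]
  interpret R: finite_measure ?R by (rule finite_PiM) auto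
  have o: "ess_bounded ?R (oplus (I - {j}) d)" using d by (intro ess_bounded_oplus) auto
  have slice: "oplus I d (y(j := x)) = oplus (I - {j}) d y + d j x" for x y
    using oplus_update[OF j, of d "d j" "y(j := x)"] by (simp add: oplus_slice)
  have dj: "ess_bounded (\<gamma> j) (d j)" using d j by (simp add: bounded_tuple_def)
  have Pint: "integrable P (\<lambda>z. \<bar>oplus I d z\<bar>)"
    by (intro integrable_P ess_bounded_abs ess_bounded_oplus d) auto
  have "(\<integral>x. comass j * \<bar>d j x - (- T / comass j)\<bar> \<partial>\<gamma> j) \<le> (\<integral>x. (\<integral>y. \<bar>oplus I d (y(j := x))\<bar> \<partial>?R) \<partial>\<gamma> j)"
  proof (rule integral_mono)
    show "integrable (\<gamma> j) (\<lambda>x. comass j * \<bar>d j x - (- T / comass j)\<bar>)"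
      by (intro integrable_gamma[OF j] ess_bounded_intros dj)
    show "integrable (\<gamma> j) (\<lambda>x. \<integral>y. \<bar>oplus I d (y(j := x))\<bar> \<partial>?R)"
      by (rule integrable_marginal[OF j Pint])
    fix x
    have "comass j * \<bar>d j x - (- T / comass j)\<bar> = \<bar>comass j * (d j x - (- T / comass j))\<bar>" using Q by (simp add: abs_mult)
    also have "comass j * (d j x - (- T / comass j)) = (\<integral>y. oplus I d (y(j := x)) \<partial>?R)"
      unfolding slice using Q R.ess_bounded_integrable[OF o]
      by (simp add: T_def comass_def[symmetric] distrib_left)
    also have "\<bar>\<dots>\<bar> \<le> (\<integral>y. \<bar>oplus I d (y(j := x))\<bar> \<partial>?R)" by (rule integral_abs_bound)
    finally show "comass j * \<bar>d j x - (- T / comass j)\<bar> \<le> (\<integral>y. \<bar>oplus I d (y(j := x))\<bar> \<partial>?R)" .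
  qed
  also have "\<dots> = (\<integral>z. \<bar>oplus I d z\<bar> \<partial>P)" by (rule integral_marginal[OF j Pint])
  finally show ?thesis by (intro exI[of _ "- T / comass j"]) simp
qed

text \<open>Lower semicontinuity of the \<open>i\<close>-th cost under bounded almost sure convergence, including the
finiteness of the limit: Fatou's lemma for the conjugates, which the bound \<open>\<psi>(q) \<ge> q\<close> makes nonnegative
after adding \<open>B\<close>.\<close>

lemma finite_cost_limit:
  assumes i: "i \<in> I" and h: "\<And>n::nat. finite_cost i (h n)" and B: "\<And>n. AE x in \<gamma> i. \<bar>h n x\<bar> \<le> B"
    and m: "h' \<in> borel_measurable (\<gamma> i)" and l: "AE x in \<gamma> i. (\<lambda>n. h n x) \<longlonglongrightarrow> h' x"
    and k: "\<And>n. marginal_cost i (h n) \<le> k n" "k \<longlonglongrightarrow> K"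
  shows "finite_cost i h'" and "marginal_cost i h' \<le> K"
proof -
  interpret M: finite_measure "\<mu> i" by (rule finite_mu[OF i])
  define b where "b = B * measure (\<mu> i) (space (\<mu> i))"
  define v where "v n x = conj_val i (h n) x + B" for n x
  define w where "w x = e2ennreal (conj_fun (\<phi> i) (- h' x) + ereal B)" for x
  have fin: "AE x in \<mu> i. \<forall>n. conj_fun (\<phi> i) (- h n x) < \<infinity>"
    using h by (subst AE_all_countable) (auto simp: finite_cost_def)
  have Ball: "AE x in \<gamma> i. \<forall>n. \<bar>h n x\<bar> \<le> B" using B by (subst AE_all_countable) auto
  have Bh': "AE x in \<gamma> i. \<bar>h' x\<bar> \<le> B"
    using Ball l
  proof eventually_elim
    case (elim x)
    then show ?case by (intro tendsto_upperbound[OF tendsto_rabs[OF elim(2)]]) auto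
  qed
  have int: "integrable (\<mu> i) (v n)" for n
    unfolding v_def[abs_def] using h by (auto simp: finite_cost_def)
  have v0: "AE x in \<mu> i. \<forall>n. 0 \<le> v n x"
    using fin AE_mu[OF i Ball]
  proof eventually_elim
    case (elim x)
    have "- h n x \<le> conj_val i (h n) x" for n
      using conj_val_ge[where h = "h n" and x = x, OF i] elim by blast
    moreover have "h n x \<le> B" for n using elim(2) abs_le_D1 by blast
    ultimately have "0 \<le> conj_val i (h n) x + B" for n
      using add_mono[of "- h n x" "conj_val i (h n) x" "h n x" B] by simp
    then show ?case unfolding v_def by blast
  qed
  have vn: "(\<integral>\<^sup>+x. ennreal (v n x) \<partial>\<mu> i) = ennreal (marginal_cost i (h n) + b)" for n
  proof -
    have "(\<integral>\<^sup>+x. ennreal (v n x) \<partial>\<mu> i) = ennreal (\<integral>x. v n x \<partial>\<mu> i)"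
      using v0 by (intro nn_integral_eq_integral int) auto
    also have "(\<integral>x. v n x \<partial>\<mu> i) = marginal_cost i (h n) + b"
      unfolding v_def marginal_cost_def b_def using h by (simp add: finite_cost_def mult.commute)
    finally show ?thesis .
  qed
  have "0 \<le> (\<integral>x. v n x \<partial>\<mu> i)" for n
    using v0 by (intro integral_nonneg_AE) auto
  then have "0 \<le> marginal_cost i (h n) + b" for n
    unfolding v_def marginal_cost_def b_def using h by (simp add: finite_cost_def mult.commute)
  then have kb: "0 \<le> k n + b" for n using k(1)[of n] add_right_mono[of "marginal_cost i (h n)" "k n" b] order_trans by blast
  have "0 \<le> K + b"
    by (rule tendsto_lowerbound[OF tendsto_add[OF k(2) tendsto_const]]) (use kb in auto)
  have "AE x in \<mu> i. w x \<le> liminf (\<lambda>n. ennreal (v n x))"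
    using fin AE_mu[OF i l]
  proof eventually_elim
    case (elim x)
    show ?case
      unfolding le_Liminf_iff
    proof (intro allI impI, rule ccontr)
      fix y assume y: "y < w x" and "\<not> (\<forall>\<^sub>F n in sequentially. y < ennreal (v n x))"
      then have inf: "infinite {n. ennreal (v n x) \<le> y}"
        by (simp add: frequently_cofinite[symmetric] cofinite_eq_sequentially not_eventually not_less)
      obtain Y where Y: "y = ennreal Y" "0 \<le> Y"
        using y by (cases y) auto
      obtain r :: "nat \<Rightarrow> nat" where r: "strict_mono r" "\<And>n. r n \<in> {n. ennreal (v n x) \<le> y}"
        using infinite_enumerate[OF inf] by blast
      have "v (r n) x \<le> Y" for n using r(2)[of n] Y by (simp add: ennreal_le_iff)
      then have c: "conj_fun (\<phi> i) (- h (r n) x) \<le> ereal (Y - B)" for n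
        using conj_val_eq[where h = "h (r n)" and x = x, OF i] elim(1) by (simp add: v_def algebra_simps)
      have hr: "(\<lambda>n. - h (r n) x) \<longlonglongrightarrow> - h' x"
        using LIMSEQ_subseq_LIMSEQ[OF elim(2) r(1)] by (intro tendsto_minus) (simp add: o_def)
      have "conj_fun (\<phi> i) (- h' x) \<le> ereal (Y - B)"
        by (rule conj_fun_lsc[OF entropy[OF i] hr tendsto_const c])
      then have "conj_fun (\<phi> i) (- h' x) + ereal B \<le> ereal Y"
        by (cases "conj_fun (\<phi> i) (- h' x)") auto
      then have "w x \<le> y" unfolding w_def Y(1)
        by (metis e2ennreal_ereal e2ennreal_mono)
      with y show False by simp
    qed
  qed
  then have "(\<integral>\<^sup>+x. w x \<partial>\<mu> i) \<le> (\<integral>\<^sup>+x. liminf (\<lambda>n. ennreal (v n x)) \<partial>\<mu> i)"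
    by (rule nn_integral_mono_AE)
  also have "\<dots> \<le> liminf (\<lambda>n. \<integral>\<^sup>+x. ennreal (v n x) \<partial>\<mu> i)"
    using borel_measurable_integrable[OF int] by (intro nn_integral_liminf) auto
  also have "\<dots> \<le> liminf (\<lambda>n. ennreal (k n + b))"
    unfolding vn using k(1) by (intro Liminf_mono always_eventually allI ennreal_leI) auto
  also have "\<dots> = ennreal (K + b)"
    by (intro lim_imp_Liminf tendsto_ennrealI tendsto_intros k) auto
  finally have W: "(\<integral>\<^sup>+x. w x \<partial>\<mu> i) \<le> ennreal (K + b)" .
  have cm: "(\<lambda>x. conj_fun (\<phi> i) (- h' x)) \<in> borel_measurable (\<mu> i)"
    unfolding measurable_mu[OF i] using m
    by (intro measurable_compose[OF _ conj_fun_borel[OF entropy[OF i]]]) auto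
  have wm: "w \<in> borel_measurable (\<mu> i)" unfolding w_def[abs_def] using cm by measurable
  have "AE x in \<mu> i. w x \<noteq> \<infinity>"
    by (rule nn_integral_PInf_AE[OF wm]) (use W in \<open>auto simp: top_unique\<close>)
  then have fin': "AE x in \<mu> i. conj_fun (\<phi> i) (- h' x) < \<infinity>"
    by eventually_elim (auto simp: w_def)
  have wv: "AE x in \<mu> i. w x = ennreal (conj_val i h' x + B) \<and> 0 \<le> conj_val i h' x + B"
    using fin' AE_mu[OF i Bh']
  proof eventually_elim
    case (elim x)
    show ?case
      using conj_val_eq[where h = h', OF i elim(1)] conj_val_ge[where h = h', OF i elim(1)] elim(2)
      by (auto simp: w_def e2ennreal_ereal)
  qed
  have Wv: "(\<integral>\<^sup>+x. ennreal (conj_val i h' x + B) \<partial>\<mu> i) \<le> ennreal (K + b)"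
    using W wv by (subst nn_integral_cong_AE[of _ w]) (auto elim!: eventually_mono)
  have cvm: "conj_val i h' \<in> borel_measurable (\<mu> i)"
    unfolding measurable_mu[OF i] by (rule conj_val_measurable[OF i m])
  have I': "integrable (\<mu> i) (\<lambda>x. conj_val i h' x + B)"
  proof (rule integrableI_nonneg)
    show "AE x in \<mu> i. 0 \<le> conj_val i h' x + B" using wv by auto
    show "(\<integral>\<^sup>+x. ennreal (conj_val i h' x + B) \<partial>\<mu> i) < \<infinity>"
      using Wv by (rule order_le_less_trans) simp
  qed (use cvm in measurable)
  then have I'': "integrable (\<mu> i) (conj_val i h')"
    using Bochner_Integration.integrable_diff[OF I' M.integrable_const[of B]] by simp
  show "finite_cost i h'"
    unfolding finite_cost_def using ess_boundedI[OF m Bh'] fin' I'' by blast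
  have "ennreal (\<integral>x. conj_val i h' x + B \<partial>\<mu> i) \<le> ennreal (K + b)"
    using Wv wv by (subst nn_integral_eq_integral[OF I', symmetric]) auto
  then have "(\<integral>x. conj_val i h' x + B \<partial>\<mu> i) \<le> K + b"
    using \<open>0 \<le> K + b\<close> by (simp add: ennreal_le_iff)
  then show "marginal_cost i h' \<le> K"
    using I'' by (simp add: marginal_cost_def b_def mult.commute)
qed

lemma
  assumes i: "i \<in> I" and h: "finite_cost i h" "finite_cost i h'" and t: "0 < t" "t < 1"
  shows finite_cost_convex: "finite_cost i (\<lambda>x. (1 - t) * h x + t * h' x)"
    and marginal_cost_convex:
      "marginal_cost i (\<lambda>x. (1 - t) * h x + t * h' x) \<le> (1 - t) * marginal_cost i h + t * marginal_cost i h'"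
    and marginal_cost_strict: "strictly_convex (conj_fun (\<phi> i)) \<Longrightarrow> (\<And>x. h x \<noteq> h' x) \<Longrightarrow>
      marginal_cost i (\<lambda>x. (1 - t) * h x + t * h' x) < (1 - t) * marginal_cost i h + t * marginal_cost i h'"
proof -
  interpret M: finite_measure "\<mu> i" by (rule finite_mu[OF i])
  let ?g = "\<lambda>x. (1 - t) * h x + t * h' x"
  let ?c = "\<lambda>x. (1 - t) * conj_val i h x + t * conj_val i h' x"
  have gb: "ess_bounded (\<gamma> i) ?g"
    using h unfolding finite_cost_def by (intro ess_bounded_intros) auto
  have fin: "AE x in \<mu> i. conj_fun (\<phi> i) (- h x) < \<infinity> \<and> conj_fun (\<phi> i) (- h' x) < \<infinity>"
    using h by (auto simp: finite_cost_def)
  have arg: "- ?g x = (1 - t) * (- h x) + t * (- h' x)" for x by simp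
  have up: "AE x in \<mu> i. conj_fun (\<phi> i) (- ?g x) \<le> ereal (?c x)"
    using fin
  proof eventually_elim
    case (elim x)
    show ?case unfolding arg
      by (rule conj_fun_convex[OF entropy[OF i]])
        (use t elim conj_val_eq[where h = h, OF i] conj_val_eq[where h = h', OF i] in auto)
  qed
  then have fg: "AE x in \<mu> i. conj_fun (\<phi> i) (- ?g x) < \<infinity>"
    by eventually_elim (auto elim: order_le_less_trans)
  have ic: "integrable (\<mu> i) ?c" using h by (auto simp: finite_cost_def)
  have le: "AE x in \<mu> i. - ?g x \<le> conj_val i ?g x \<and> conj_val i ?g x \<le> ?c x"
    using up fg
  proof eventually_elim
    case (elim x)
    show ?case
      using conj_val_ge[where h = ?g, OF i elim(2)] conj_val_eq[where h = ?g, OF i elim(2)] elim(1) by simp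
  qed
  have ig: "integrable (\<mu> i) (conj_val i ?g)"
  proof (rule Bochner_Integration.integrable_bound)
    show "integrable (\<mu> i) (\<lambda>x. \<bar>?g x\<bar> + \<bar>?c x\<bar>)"
      using integrable_mu[OF i gb] ic by auto
    show "conj_val i ?g \<in> borel_measurable (\<mu> i)"
      unfolding measurable_mu[OF i] by (rule conj_val_measurable[OF i ess_bounded_measurable[OF gb]])
    show "AE x in \<mu> i. norm (conj_val i ?g x) \<le> norm (\<bar>?g x\<bar> + \<bar>?c x\<bar>)"
      using le by eventually_elim (auto simp: abs_le_iff)
  qed
  show "finite_cost i ?g" unfolding finite_cost_def using gb fg ig by blast
  have c: "(\<integral>x. ?c x \<partial>\<mu> i) = (1 - t) * marginal_cost i h + t * marginal_cost i h'"
    using h by (simp add: marginal_cost_def finite_cost_def)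
  have "marginal_cost i ?g \<le> (\<integral>x. ?c x \<partial>\<mu> i)"
    unfolding marginal_cost_def by (rule integral_mono_AE[OF ig ic]) (use le in auto)
  then show "marginal_cost i ?g \<le> (1 - t) * marginal_cost i h + t * marginal_cost i h'"
    unfolding c .
  assume sc: "strictly_convex (conj_fun (\<phi> i))" and ne: "\<And>x. h x \<noteq> h' x"
  have "AE x in \<mu> i. conj_val i ?g x < ?c x"
    using fin fg
  proof eventually_elim
    case (elim x)
    note e = conj_val_eq[where h = h, OF i conjunct1[OF elim(1)]]
      conj_val_eq[where h = h', OF i conjunct2[OF elim(1)]] conj_val_eq[where h = ?g, OF i elim(2)]
    have "- h x \<in> edom (conj_fun (\<phi> i))" "- h' x \<in> edom (conj_fun (\<phi> i))"
      using e by (auto simp: edom_def)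
    then have "conj_fun (\<phi> i) ((1 - t) * (- h x) + t * (- h' x))
        < ereal (1 - t) * conj_fun (\<phi> i) (- h x) + ereal t * conj_fun (\<phi> i) (- h' x)"
      using sc ne[of x] t unfolding strictly_convex_def by (metis neg_equal_iff_equal)
    then show ?case unfolding arg[symmetric] e by simp
  qed
  then have "marginal_cost i ?g < (\<integral>x. ?c x \<partial>\<mu> i)"
    unfolding marginal_cost_def using measure_mu_pos[OF i]
    by (intro M.integral_less_AE_space[OF ig ic]) (auto simp: measure_def)
  then show "marginal_cost i ?g < (1 - t) * marginal_cost i h + t * marginal_cost i h'"
    unfolding c .
qed

end

context sinkhorn_iteration
begin

definition opt_mass :: real where "opt_mass = (\<integral>x. plan fh x \<partial>P)"

text \<open>The first order condition at the minimiser for constant shifts of one component, along which the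
exponential term is explicit.\<close>

lemma marginal_cost_tangent:
  assumes i: "i \<in> I" and s: "finite_cost i (\<lambda>x. fh i x + s)"
  shows "marginal_cost i (fh i) - s * opt_mass \<le> marginal_cost i (\<lambda>x. fh i x + s)"
proof -
  have fi: "finite_cost i (fh i)" using opt_finite i by (simp add: finite_costs_def)
  have "- (s * opt_mass) \<le> marginal_cost i (\<lambda>x. fh i x + s) - marginal_cost i (fh i)"
  proof (rule tangent_of_exp_bound[OF eps_pos])
    fix \<theta> :: real assume \<theta>: "0 < \<theta>" "\<theta> < 1"
    have eq: "(\<lambda>x. (1 - \<theta>) * fh i x + \<theta> * (fh i x + s)) = (\<lambda>x. fh i x + \<theta> * s)"
      by (auto simp: algebra_simps)
    let ?g = "fh(i := (\<lambda>x. fh i x + \<theta> * s))"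
    have "finite_cost i (\<lambda>x. fh i x + \<theta> * s)"
      using finite_cost_convex[OF i fi s \<theta>] unfolding eq .
    then have "finite_costs ?g" using opt_finite by (simp add: finite_costs_def)
    then have "cost fh \<le> cost ?g" by (rule opt_minimal)
    moreover have "marginal_cost i (\<lambda>x. fh i x + \<theta> * s) \<le>
        (1 - \<theta>) * marginal_cost i (fh i) + \<theta> * marginal_cost i (\<lambda>x. fh i x + s)"
      using marginal_cost_convex[OF i fi s \<theta>] unfolding eq .
    moreover have "plan ?g z = plan fh z * exp (\<theta> * s / \<epsilon>)" for z
    proof -
      have "oplus I ?g z = oplus I fh z + \<theta> * s"
        using oplus_update[OF i, of fh "fh i" z] oplus_update[OF i, of fh "\<lambda>x. fh i x + \<theta> * s" z]
        by simp
      then have "(oplus I ?g z - c z) / \<epsilon> = (oplus I fh z - c z) / \<epsilon> + \<theta> * s / \<epsilon>"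
        by (simp add: add_divide_distrib diff_divide_distrib)
      then show ?thesis unfolding plan_def by (simp only: exp_add)
    qed
    then have "(\<integral>z. plan ?g z \<partial>P) = opt_mass * exp (\<theta> * s / \<epsilon>)"
      by (simp add: opt_mass_def)
    ultimately show "\<epsilon> * opt_mass \<le> \<theta> * (marginal_cost i (\<lambda>x. fh i x + s) - marginal_cost i (fh i))
        + \<epsilon> * opt_mass * exp (\<theta> * s / \<epsilon>)"
      using cost_update[OF i, of fh "\<lambda>x. fh i x + \<theta> * s"]
      by (simp add: opt_mass_def algebra_simps)
  qed
  then show ?thesis by simp
qed

text \<open>Both factors of the pairing converge in \<open>L\<^sup>1\<close>, the plan density to that of the minimiser and the deviation to the constants
\<open>\<kappa>\<close>, and both are bounded.\<close>

lemma pairing_null: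
  assumes i: "i \<in> I" and \<kappa>: "(\<lambda>n. \<integral>x. \<bar>dev (n + N) i x - \<kappa> n\<bar> \<partial>\<gamma> i) \<longlonglongrightarrow> 0"
  shows "(\<lambda>n. (\<integral>z. plan (iter (n + N)) z * dev (n + N) i (z i) \<partial>P) - \<kappa> n * opt_mass) \<longlonglongrightarrow> 0"
proof -
  let ?E = "\<lambda>n. plan (iter (n + N))" and ?F = "plan fh"
  let ?d = "\<lambda>n. dev (n + N) i"
  note Fb = ess_bounded_plan[OF bounded_opt]
  note Eb = ess_bounded_plan[OF bounded_iter]
  note db = dev_ess_bounded[OF i] dev_component_ess_bounded[OF i]
  obtain B where B: "AE z in P. \<bar>?F z\<bar> \<le> B" using Fb by (auto simp: ess_bounded_def)
  have E: "(\<lambda>n. \<integral>z. \<bar>?E n z - ?F z\<bar> \<partial>P) \<longlonglongrightarrow> 0"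
    by (rule plan_L1_null[OF bounded_iter bounded_opt iter_le opt_le
          LIMSEQ_ignore_initial_segment[OF oplus_L1_null]])
  have comp: "(\<integral>z. \<bar>?d n (z i) - \<kappa> n\<bar> \<partial>P) = comass i * (\<integral>x. \<bar>?d n x - \<kappa> n\<bar> \<partial>\<gamma> i)" for n
    by (rule integral_component[OF i, of "\<lambda>x. \<bar>?d n x - \<kappa> n\<bar>"]) (intro ess_bounded_intros db)
  let ?r = "\<lambda>n. 2 * \<bar>bnd\<bar> * (\<integral>z. \<bar>?E n z - ?F z\<bar> \<partial>P) + \<bar>B\<bar> * (comass i * (\<integral>x. \<bar>?d n x - \<kappa> n\<bar> \<partial>\<gamma> i))"
  have "\<bar>(\<integral>z. ?E n z * ?d n (z i) \<partial>P) - \<kappa> n * opt_mass\<bar> \<le>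
      ?r n" for n
  proof -
    have int: "integrable P (\<lambda>z. ?E n z * ?d n (z i))" "integrable P ?F"
      "integrable P (\<lambda>z. \<bar>?E n z - ?F z\<bar>)" "integrable P (\<lambda>z. \<bar>?d n (z i) - \<kappa> n\<bar>)"
      by (intro integrable_P ess_bounded_intros Fb Eb db)+
    have eq: "(\<integral>z. ?E n z * ?d n (z i) \<partial>P) - \<kappa> n * opt_mass = (\<integral>z. ?E n z * ?d n (z i) - \<kappa> n * ?F z \<partial>P)"
      using int by (simp add: opt_mass_def)
    have "\<bar>(\<integral>z. ?E n z * ?d n (z i) \<partial>P) - \<kappa> n * opt_mass\<bar> \<le>
        (\<integral>z. \<bar>?E n z * ?d n (z i) - \<kappa> n * ?F z\<bar> \<partial>P)"
      unfolding eq by (rule integral_abs_bound)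
    also have "\<dots> \<le> (\<integral>z. 2 * \<bar>bnd\<bar> * \<bar>?E n z - ?F z\<bar> + \<bar>B\<bar> * \<bar>?d n (z i) - \<kappa> n\<bar> \<partial>P)"
    proof (rule integral_mono_AE)
      show "integrable P (\<lambda>z. \<bar>?E n z * ?d n (z i) - \<kappa> n * ?F z\<bar>)" using int by auto
      show "integrable P (\<lambda>z. 2 * \<bar>bnd\<bar> * \<bar>?E n z - ?F z\<bar> + \<bar>B\<bar> * \<bar>?d n (z i) - \<kappa> n\<bar>)" using int by auto
      have "AE z in P. \<bar>?d n (z i)\<bar> \<le> 2 * \<bar>bnd\<bar>"
        by (rule AE_component[OF subset_refl i dev_bound[OF i]])
      with B show "AE z in P. \<bar>?E n z * ?d n (z i) - \<kappa> n * ?F z\<bar> \<le>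
          2 * \<bar>bnd\<bar> * \<bar>?E n z - ?F z\<bar> + \<bar>B\<bar> * \<bar>?d n (z i) - \<kappa> n\<bar>"
      proof eventually_elim
        case (elim z)
        have "\<bar>?E n z * ?d n (z i) - \<kappa> n * ?F z\<bar> = \<bar>?d n (z i) * (?E n z - ?F z) + ?F z * (?d n (z i) - \<kappa> n)\<bar>"
          by (simp add: algebra_simps)
        also have "\<dots> \<le> \<bar>?d n (z i)\<bar> * \<bar>?E n z - ?F z\<bar> + \<bar>?F z\<bar> * \<bar>?d n (z i) - \<kappa> n\<bar>"
          unfolding abs_mult[symmetric] by (rule abs_triangle_ineq)
        also have "\<dots> \<le> 2 * \<bar>bnd\<bar> * \<bar>?E n z - ?F z\<bar> + \<bar>B\<bar> * \<bar>?d n (z i) - \<kappa> n\<bar>"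
          using elim by (intro add_mono mult_right_mono) auto
        finally show ?case .
      qed
    qed
    also have "\<dots> = ?r n"
      unfolding comp[symmetric] using int by simp
    finally show ?thesis .
  qed
  then have le: "\<forall>n. norm ((\<integral>z. ?E n z * ?d n (z i) \<partial>P) - \<kappa> n * opt_mass) \<le>
      ?r n"
    unfolding real_norm_def by (rule allI)
  have "(\<lambda>n. ?r n)
      \<longlonglongrightarrow> 2 * \<bar>bnd\<bar> * 0 + \<bar>B\<bar> * (comass i * 0)"
    by (intro tendsto_add tendsto_mult_left E \<kappa>)
  then show ?thesis by (intro Lim_null_comparison[OF always_eventually[OF le]]) simp
qed

text \<open>If the shifts \<open>\<kappa>\<close> did not vanish, a subsequence of the component would converge almost surely to
\<open>h\<^sub>i + \<tau>\<close> with \<open>\<tau> \<noteq> 0\<close>. The optimality conditions of the iterates bound the cost of the limit by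
the tangent at \<open>h\<^sub>i\<close>, so strict convexity puts the cost of the midpoint strictly below the tangent, against
\<open>marginal_cost_tangent\<close>.\<close>

lemma shift_null:
  assumes i: "i \<in> I" and sc: "strictly_convex (conj_fun (\<phi> i))"
    and \<kappa>: "(\<lambda>n. \<integral>x. \<bar>dev (n + N) i x - \<kappa> n\<bar> \<partial>\<gamma> i) \<longlonglongrightarrow> 0"
  shows "\<kappa> \<longlonglongrightarrow> 0"
proof (rule ccontr)
  assume "\<not> \<kappa> \<longlonglongrightarrow> 0"
  then obtain e where e: "0 < e" "\<And>n0. \<exists>n\<ge>n0. e \<le> \<bar>\<kappa> n\<bar>"
    unfolding LIMSEQ_iff by (auto simp: not_less)
  have "infinite {n. e \<le> \<bar>\<kappa> n\<bar>}"
    unfolding infinite_nat_iff_unbounded_le using e(2) by auto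
  from infinite_enumerate[OF this] obtain r :: "nat \<Rightarrow> nat"
    where r: "strict_mono r" "\<And>n. e \<le> \<bar>\<kappa> (r n)\<bar>" by auto
  interpret g: finite_measure "\<gamma> i" by (rule finite_gamma[OF i])
  define G where "G = measure (\<gamma> i) (space (\<gamma> i))"
  have G: "0 < G" using gamma_pos[OF i] by (simp add: G_def)
  obtain D where D: "\<And>n. norm (\<integral>x. \<bar>dev (n + N) i x - \<kappa> n\<bar> \<partial>\<gamma> i) \<le> D"
    using convergent_imp_Bseq[OF convergentI[OF \<kappa>]] by (auto simp: Bseq_def)
  have kb: "\<bar>\<kappa> n\<bar> \<le> 2 * \<bar>bnd\<bar> + D / G" for n
  proof -
    have "(\<integral>x. \<bar>\<kappa> n\<bar> \<partial>\<gamma> i) \<le> (\<integral>x. 2 * \<bar>bnd\<bar> + \<bar>dev (n + N) i x - \<kappa> n\<bar> \<partial>\<gamma> i)"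
    proof (rule integral_mono_AE)
      show "integrable (\<gamma> i) (\<lambda>x. 2 * \<bar>bnd\<bar> + \<bar>dev (n + N) i x - \<kappa> n\<bar>)"
        by (intro integrable_gamma[OF i] ess_bounded_intros dev_ess_bounded[OF i])
      show "AE x in \<gamma> i. \<bar>\<kappa> n\<bar> \<le> 2 * \<bar>bnd\<bar> + \<bar>dev (n + N) i x - \<kappa> n\<bar>"
        using dev_bound[OF i, of "n + N"] by eventually_elim auto
    qed simp
    also have "\<dots> = 2 * \<bar>bnd\<bar> * G + (\<integral>x. \<bar>dev (n + N) i x - \<kappa> n\<bar> \<partial>\<gamma> i)"
      unfolding G_def
      by (subst Bochner_Integration.integral_add)
        (auto intro!: integrable_gamma[OF i] ess_bounded_intros dev_ess_bounded[OF i])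
    also have "\<dots> \<le> 2 * \<bar>bnd\<bar> * G + D" using D[of n] by simp
    finally have "\<bar>\<kappa> n\<bar> * G \<le> 2 * \<bar>bnd\<bar> * G + D" by (simp add: G_def mult.commute)
    then show ?thesis using G by (simp add: field_simps)
  qed
  have kr: "\<kappa> (r n) \<in> {- (2 * \<bar>bnd\<bar> + D / G) .. 2 * \<bar>bnd\<bar> + D / G}" for n
    using kb[of "r n"] unfolding abs_le_iff atLeastAtMost_iff by linarith
  have "\<forall>n. (\<kappa> \<circ> r) n \<in> {- (2 * \<bar>bnd\<bar> + D / G) .. 2 * \<bar>bnd\<bar> + D / G}"
    unfolding comp_apply by (rule allI) (rule kr)
  then obtain s \<tau> where s: "strict_mono s" "(\<kappa> \<circ> r \<circ> s) \<longlonglongrightarrow> \<tau>"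
    using compact_Icc[unfolded compact_def] by blast
  have "e \<le> \<bar>\<tau>\<bar>"
    by (rule tendsto_lowerbound[OF tendsto_rabs[OF s(2)]]) (use r(2) in auto)
  with e(1) have ne: "\<tau> \<noteq> 0" by auto
  define u where "u n x = dev (r (s n) + N) i x - \<kappa> (r (s n))" for n x
  have "(\<lambda>n. \<integral>x. norm (u n x) \<partial>\<gamma> i) \<longlonglongrightarrow> 0"
    using LIMSEQ_subseq_LIMSEQ[OF LIMSEQ_subseq_LIMSEQ[OF \<kappa> r(1)] s(1)] by (simp add: u_def o_def)
  moreover have "integrable (\<gamma> i) (u n)" for n
    unfolding u_def by (intro integrable_gamma[OF i] ess_bounded_intros dev_ess_bounded[OF i])
  ultimately obtain q where q: "strict_mono q" "AE x in \<gamma> i. (\<lambda>n. u (q n) x) \<longlonglongrightarrow> 0"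
    using tendsto_L1_AE_subseq[of "\<gamma> i" u] by blast
  define t where "t n = r (s (q n))" for n
  have kt: "(\<lambda>n. \<kappa> (t n)) \<longlonglongrightarrow> \<tau>"
    using LIMSEQ_subseq_LIMSEQ[OF s(2) q(1)] by (simp add: t_def o_def)
  have tm: "strict_mono t"
    using strict_mono_o[OF r(1) strict_mono_o[OF s(1) q(1)]] by (simp add: t_def[abs_def] o_def)
  have lim: "AE x in \<gamma> i. (\<lambda>n. iter (t n + N) i x) \<longlonglongrightarrow> fh i x + \<tau>"
    using q(2)
  proof eventually_elim
    case (elim x)
    from tendsto_add[OF tendsto_add[OF elim kt] tendsto_const[of "fh i x"]] show ?case
      by (simp add: u_def t_def dev_def add.commute)
  qed
  let ?A = "\<lambda>n. \<integral>z. plan (iter (n + N)) z * dev (n + N) i (z i) \<partial>P"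
  have A: "(\<lambda>n. ?A (t n)) \<longlonglongrightarrow> \<tau> * opt_mass"
    using tendsto_add[OF LIMSEQ_subseq_LIMSEQ[OF pairing_null[OF i \<kappa>] tm] tendsto_mult_right[OF kt, of opt_mass]]
    by (simp add: o_def)
  have W: "(\<lambda>n. window (t n)) \<longlonglongrightarrow> 0"
    using LIMSEQ_subseq_LIMSEQ[OF window_null tm] by (simp add: o_def)
  have fi: "finite_cost i (fh i)" using opt_finite i by (simp add: finite_costs_def)
  have k: "marginal_cost i (iter (t n + N) i) \<le> marginal_cost i (fh i) + window (t n) - ?A (t n)" for n
    using gap_window[OF i, of "t n"] by (simp add: gap_le_def)
  have kl: "(\<lambda>n. marginal_cost i (fh i) + window (t n) - ?A (t n)) \<longlonglongrightarrow> marginal_cost i (fh i) + 0 - \<tau> * opt_mass"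
    by (intro tendsto_intros A W)
  have fm: "(\<lambda>x. fh i x + \<tau>) \<in> borel_measurable (\<gamma> i)"
    using fi by (intro ess_bounded_measurable ess_bounded_intros) (simp add: finite_cost_def)
  have fc: "finite_cost i (iter (t n + N) i)" for n
    using finite_costs_iter i by (simp add: finite_costs_def)
  have bd: "AE x in \<gamma> i. \<bar>iter (t n + N) i x\<bar> \<le> bnd" for n
    using iter_le i by (simp add: tuple_le_def)
  \<comment> \<open>\<open>L\<close>: the limit has cost at most the tangent at \<open>fh i\<close>, evaluated at the shift \<open>\<tau>\<close>\<close>
  note L = finite_cost_limit[OF i fc bd fm lim k kl]
  have half: "(\<lambda>x. (1 - 1 / 2) * fh i x + 1 / 2 * (fh i x + \<tau>)) = (\<lambda>x. fh i x + \<tau> / 2)"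
    by (auto simp: field_simps)
  have "marginal_cost i (\<lambda>x. fh i x + \<tau> / 2) <
      (1 - 1 / 2) * marginal_cost i (fh i) + 1 / 2 * marginal_cost i (\<lambda>x. fh i x + \<tau>)"
    using marginal_cost_strict[OF i fi L(1), of "1 / 2"] sc ne unfolding half by simp
  moreover have "finite_cost i (\<lambda>x. fh i x + \<tau> / 2)"
    using finite_cost_convex[OF i fi L(1), of "1 / 2"] unfolding half by simp
  from marginal_cost_tangent[OF i this]
  have "marginal_cost i (fh i) - \<tau> / 2 * opt_mass \<le> marginal_cost i (\<lambda>x. fh i x + \<tau> / 2)" .
  ultimately show False using L(2) by simp
qed

text \<open>The shifts of all components with strictly convex conjugate vanish in the limit. At most one component
is left, and its shift vanishes because the sum of all shifts does.\<close>

lemma dev_L1_null: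
  assumes J: "J \<subseteq> I" "card J = N - 1" "\<forall>i\<in>J. strictly_convex (conj_fun (\<phi> i))" and i: "i \<in> I"
  shows "(\<lambda>n. \<integral>x. \<bar>dev n i x\<bar> \<partial>\<gamma> i) \<longlonglongrightarrow> 0"
proof -
  note Q = comass_pos
  define e where "e n = (\<integral>z. \<bar>oplus I (iter n) z - oplus I fh z\<bar> \<partial>P)" for n
  have e: "e \<longlonglongrightarrow> 0" unfolding e_def[abs_def] by (rule oplus_L1_null)
  have od: "oplus I (dev n) z = oplus I (iter n) z - oplus I fh z" for n z
    unfolding oplus_dev by (simp add: oplus_def)
  have db: "bounded_tuple (dev n)" for n
    using dev_ess_bounded by (simp add: bounded_tuple_def)
  have "\<exists>\<kappa>. comass k * (\<integral>x. \<bar>dev n k x - \<kappa>\<bar> \<partial>\<gamma> k) \<le> e n" if "k \<in> I" for n k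
    using component_deviation[OF db that, of n] by (simp add: e_def od)
  note ex = this
  define \<kappa> where "\<kappa> n k = (SOME \<kappa>. comass k * (\<integral>x. \<bar>dev n k x - \<kappa>\<bar> \<partial>\<gamma> k) \<le> e n)" for n k
  have \<kappa>: "comass k * (\<integral>x. \<bar>dev n k x - \<kappa> n k\<bar> \<partial>\<gamma> k) \<le> e n" if "k \<in> I" for n k
    unfolding \<kappa>_def by (rule someI_ex[OF ex[OF that]])
  have dk: "(\<lambda>n. \<integral>x. \<bar>dev n k x - \<kappa> n k\<bar> \<partial>\<gamma> k) \<longlonglongrightarrow> 0" if k: "k \<in> I" for k
  proof (rule null_sandwich)
    show "\<forall>n. 0 \<le> (\<integral>x. \<bar>dev n k x - \<kappa> n k\<bar> \<partial>\<gamma> k)" by simp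
    show "\<forall>n. (\<integral>x. \<bar>dev n k x - \<kappa> n k\<bar> \<partial>\<gamma> k) \<le> e n / comass k"
      using \<kappa>[OF k] Q[of k] by (simp add: pos_le_divide_eq mult.commute)
    show "(\<lambda>n. e n / comass k) \<longlonglongrightarrow> 0"
      using tendsto_divide[OF e tendsto_const[of "comass k"]] Q[of k] by simp
  qed
  have shiftJ: "(\<lambda>n. \<kappa> n k) \<longlonglongrightarrow> 0" if "k \<in> J" for k
  proof (rule LIMSEQ_offset)
    have kI: "k \<in> I" and sc: "strictly_convex (conj_fun (\<phi> k))" using that J by auto
    show "(\<lambda>n. \<kappa> (n + N) k) \<longlonglongrightarrow> 0"
      by (rule shift_null[OF kI sc]) (rule LIMSEQ_ignore_initial_segment[OF dk[OF kI]])
  qed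
  have total: "(\<lambda>n. \<Sum>k\<in>I. \<kappa> n k) \<longlonglongrightarrow> 0"
  proof -
    define G where "G = measure P (space P)"
    have G: "0 < G" unfolding G_def by (rule measure_PiM_pos) auto
    have le: "\<bar>\<Sum>k\<in>I. \<kappa> n k\<bar> \<le> (1 + real (card I)) * e n / G" for n
    proof -
      have i1: "integrable P (\<lambda>z. \<bar>oplus I (dev n) z\<bar>)"
        by (intro integrable_P ess_bounded_intros ess_bounded_oplus_I db)
      have i2: "integrable P (\<lambda>z. \<bar>dev n k (z k) - \<kappa> n k\<bar>)" if "k \<in> I" for k
        by (intro integrable_P ess_bounded_intros dev_component_ess_bounded that)
      have "(\<integral>z. \<bar>\<Sum>k\<in>I. \<kappa> n k\<bar> \<partial>P) \<le>
          (\<integral>z. \<bar>oplus I (dev n) z\<bar> + (\<Sum>k\<in>I. \<bar>dev n k (z k) - \<kappa> n k\<bar>) \<partial>P)"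
      proof (rule integral_mono)
        show "integrable P (\<lambda>z. \<bar>oplus I (dev n) z\<bar> + (\<Sum>k\<in>I. \<bar>dev n k (z k) - \<kappa> n k\<bar>))"
          using i1 i2 by auto
        show "integrable P (\<lambda>z. \<bar>\<Sum>k\<in>I. \<kappa> n k\<bar>)"
          by (rule integrable_P[OF ess_bounded_const])
        fix z
        have "(\<Sum>k\<in>I. \<kappa> n k) = oplus I (dev n) z - (\<Sum>k\<in>I. dev n k (z k) - \<kappa> n k)"
          by (simp add: oplus_def sum_subtractf)
        moreover have "\<bar>\<Sum>k\<in>I. dev n k (z k) - \<kappa> n k\<bar> \<le> (\<Sum>k\<in>I. \<bar>dev n k (z k) - \<kappa> n k\<bar>)"
          by (rule sum_abs)
        ultimately show "\<bar>\<Sum>k\<in>I. \<kappa> n k\<bar> \<le> \<bar>oplus I (dev n) z\<bar> + (\<Sum>k\<in>I. \<bar>dev n k (z k) - \<kappa> n k\<bar>)"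
          by linarith
      qed
      also have "\<dots> = (\<integral>z. \<bar>oplus I (dev n) z\<bar> \<partial>P) + (\<Sum>k\<in>I. (\<integral>z. \<bar>dev n k (z k) - \<kappa> n k\<bar> \<partial>P))"
        using i1 i2 by simp
      also have "(\<integral>z. \<bar>oplus I (dev n) z\<bar> \<partial>P) = e n" by (simp add: e_def od)
      also have "(\<Sum>k\<in>I. (\<integral>z. \<bar>dev n k (z k) - \<kappa> n k\<bar> \<partial>P)) \<le> (\<Sum>k\<in>I. e n)"
      proof (rule sum_mono)
        fix k assume k: "k \<in> I"
        have "(\<integral>z. \<bar>dev n k (z k) - \<kappa> n k\<bar> \<partial>P) = comass k * (\<integral>x. \<bar>dev n k x - \<kappa> n k\<bar> \<partial>\<gamma> k)"
          by (rule integral_component[OF k, of "\<lambda>x. \<bar>dev n k x - \<kappa> n k\<bar>"])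
            (intro ess_bounded_intros dev_ess_bounded k)
        then show "(\<integral>z. \<bar>dev n k (z k) - \<kappa> n k\<bar> \<partial>P) \<le> e n" using \<kappa>[OF k, of n] by simp
      qed
      finally have "\<bar>\<Sum>k\<in>I. \<kappa> n k\<bar> * G \<le> (1 + real (card I)) * e n"
        by (simp add: G_def algebra_simps)
      then show ?thesis using G by (simp add: pos_le_divide_eq)
    qed
    have le': "\<forall>n. norm (\<Sum>k\<in>I. \<kappa> n k) \<le> (1 + real (card I)) / G * e n"
      unfolding real_norm_def using le by (simp add: mult.commute)
    have "(\<lambda>n. (1 + real (card I)) / G * e n) \<longlonglongrightarrow> (1 + real (card I)) / G * 0"
      by (intro tendsto_mult_left e)
    then have "(\<lambda>n. (1 + real (card I)) / G * e n) \<longlonglongrightarrow> 0" by simp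
    then show ?thesis by (rule Lim_null_comparison[OF always_eventually[OF le']])
  qed
  have shift: "(\<lambda>n. \<kappa> n i) \<longlonglongrightarrow> 0"
  proof (cases "i \<in> J")
    case False
    have "J = I - {i}"
      using J i False by (intro card_subset_eq) (auto simp: I_eq)
    then have "\<kappa> n i = (\<Sum>k\<in>I. \<kappa> n k) - (\<Sum>k\<in>J. \<kappa> n k)" for n
      using sum.remove[OF finite_I i, of "\<kappa> n"] by simp
    moreover have "(\<lambda>n. (\<Sum>k\<in>I. \<kappa> n k) - (\<Sum>k\<in>J. \<kappa> n k)) \<longlonglongrightarrow> 0 - (\<Sum>k\<in>J. 0)"
      by (intro tendsto_diff total tendsto_sum shiftJ)
    ultimately show ?thesis by simp
  qed (rule shiftJ)
  show ?thesis
  proof (rule null_sandwich)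
    let ?G = "measure (\<gamma> i) (space (\<gamma> i))"
    interpret g: finite_measure "\<gamma> i" by (rule finite_gamma[OF i])
    show "\<forall>n. 0 \<le> (\<integral>x. \<bar>dev n i x\<bar> \<partial>\<gamma> i)" by simp
    show "\<forall>n. (\<integral>x. \<bar>dev n i x\<bar> \<partial>\<gamma> i) \<le> (\<integral>x. \<bar>dev n i x - \<kappa> n i\<bar> \<partial>\<gamma> i) + \<bar>\<kappa> n i\<bar> * ?G"
    proof
      fix n
      have int: "integrable (\<gamma> i) (\<lambda>x. \<bar>dev n i x\<bar>)" "integrable (\<gamma> i) (\<lambda>x. \<bar>dev n i x - \<kappa> n i\<bar>)"
        by (intro integrable_gamma[OF i] ess_bounded_intros dev_ess_bounded i)+
      have "(\<integral>x. \<bar>dev n i x\<bar> \<partial>\<gamma> i) \<le> (\<integral>x. \<bar>dev n i x - \<kappa> n i\<bar> + \<bar>\<kappa> n i\<bar> \<partial>\<gamma> i)"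
        using int by (intro integral_mono) auto
      then show "(\<integral>x. \<bar>dev n i x\<bar> \<partial>\<gamma> i) \<le> (\<integral>x. \<bar>dev n i x - \<kappa> n i\<bar> \<partial>\<gamma> i) + \<bar>\<kappa> n i\<bar> * ?G"
        using int(2) by (simp add: mult.commute)
    qed
    have "(\<lambda>n. (\<integral>x. \<bar>dev n i x - \<kappa> n i\<bar> \<partial>\<gamma> i) + \<bar>\<kappa> n i\<bar> * ?G) \<longlonglongrightarrow> 0 + \<bar>0\<bar> * ?G"
      by (intro tendsto_intros dk i shift)
    then show "(\<lambda>n. (\<integral>x. \<bar>dev n i x - \<kappa> n i\<bar> \<partial>\<gamma> i) + \<bar>\<kappa> n i\<bar> * ?G) \<longlonglongrightarrow> 0" by simp
  qed
qed

end

context sinkhorn_iteration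
begin

lemma dev_tuple_Lp_null:
  assumes J: "J \<subseteq> I" "card J = N - 1" "\<forall>i\<in>J. strictly_convex (conj_fun (\<phi> i))" and p: "1 \<le> p"
  shows "(\<lambda>n. Lp_norm_tuple p I \<gamma> (\<lambda>i x. iter n i x - fh i x)) \<longlonglongrightarrow> 0"
proof -
  have "(\<lambda>n. Lp_norm p (\<gamma> i) (dev n i)) \<longlonglongrightarrow> 0" if i: "i \<in> I" for i
    by (rule finite_measure.L1_null_imp_Lp_null[OF finite_gamma[OF i] dev_ess_bounded[OF i]
          dev_bound[OF i] dev_L1_null[OF J i] p])
  then have "(\<lambda>n. \<Sum>i\<in>I. Lp_norm p (\<gamma> i) (dev n i) powr p) \<longlonglongrightarrow> (\<Sum>i\<in>I. 0)"
    using p by (intro tendsto_sum tendsto_zero_powrI[OF _ tendsto_const])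
      (auto intro!: always_eventually simp: Lp_norm_def)
  then have "(\<lambda>n. (\<Sum>i\<in>I. Lp_norm p (\<gamma> i) (dev n i) powr p) powr (1 / p)) \<longlonglongrightarrow> 0"
    using p by (intro tendsto_zero_powrI[OF _ tendsto_const])
      (auto intro!: always_eventually sum_nonneg)
  then show ?thesis by (simp add: Lp_norm_tuple_def dev_def[abs_def])
qed

end

section \<open>Borel structure of finite products of Polish spaces\<close>

text \<open>The balls with radii \<open>1 / (n + 1)\<close> around a countable dense set form a base.\<close>

lemma polish_second_countable:
  assumes "polish_topology X"
  shows "second_countable X"
proof -
  obtain M d where "Metric_space M d" and X: "X = Metric_space.mtopology M d"
    using assms completely_metrizable_imp_metrizable_space
    unfolding polish_topology_def metrizable_space_def by blast
  then interpret Metric_space M d by simp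
  obtain D where D: "countable D" "D \<subseteq> M" "mtopology closure_of D = M"
    using assms unfolding polish_topology_def separable_space_def X by auto
  let ?B = "(\<lambda>(a, n). mball a (inverse (real (Suc n)))) ` (D \<times> UNIV)"
  have base: "\<exists>V\<in>?B. x \<in> V \<and> V \<subseteq> U" if U: "openin mtopology U" "x \<in> U" for U x
  proof -
    obtain r where r: "0 < r" "mball x r \<subseteq> U" using U openin_mtopology by blast
    have xM: "x \<in> M" using U openin_mtopology by blast
    obtain n where n: "inverse (real (Suc n)) < r / 2"
      using reals_Archimedean[of "r / 2"] r(1) by auto
    define s where "s = inverse (real (Suc n))"
    have s: "0 < s" "s < r / 2" using n by (simp_all add: s_def)
    have "x \<in> mtopology closure_of D" using D(3) xM by simp
    moreover have "x \<in> mball x s" using xM s(1) by (simp only: centre_in_mball_iff)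
    ultimately obtain a where a: "a \<in> D" "a \<in> mball x s"
      unfolding in_closure_of using openin_mball by blast
    have xa: "x \<in> mball a s" using a(2) by (simp add: commute)
    have sub: "mball a s \<subseteq> mball x r"
    proof
      fix y assume y: "y \<in> mball a s"
      have "d x y \<le> d x a + d a y" using y a(2) by (intro triangle) simp_all
      also have "\<dots> < r" using a(2) y s(2) by simp
      finally show "y \<in> mball x r" using xM y by simp
    qed
    have mem: "mball a s \<in> ?B"
      unfolding s_def by (rule image_eqI[where x = "(a, n)"]) (use a(1) in simp_all)
    show ?thesis by (intro bexI[OF _ mem] conjI xa subset_trans[OF sub r(2)])
  qed
  show ?thesis
    unfolding second_countable_def X
  proof (intro exI[of _ ?B] conjI allI impI ballI)
    show "countable ?B" using D(1) by (intro countable_image countable_SIGMA) auto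
    show "openin mtopology V" if "V \<in> ?B" for V using that openin_mball by (auto simp only:)
    show "\<exists>V\<in>?B. x \<in> V \<and> V \<subseteq> U" if "openin mtopology U \<and> x \<in> U" for U x
      using that by (intro base) simp_all
  qed
qed

lemma openin_borel_of: "openin X U \<Longrightarrow> U \<in> sets (borel_of X)"
  unfolding borel_of_def using openin_subset
  by (subst sets_measure_of) auto

lemma space_borel_of: "sets M = sets (borel_of X) \<Longrightarrow> space M = topspace X"
  using sets_eq_imp_space_eq[of M "borel_of X"] by (simp add: borel_of_def space_measure_of_conv)

text \<open>The product \<open>\<sigma>\<close>-algebra contains boxes only; an open set is a countable union of them because boxes
built from countable bases form a countable base of the product. This makes continuous functions on the product measurable
for the product \<open>\<sigma>\<close>-algebra.\<close>

lemma openin_product_in_sets_PiM: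
  assumes fin: "finite I" and sc: "\<And>i. i \<in> I \<Longrightarrow> second_countable (X i)"
    and sets: "\<And>i. i \<in> I \<Longrightarrow> sets (M i) = sets (borel_of (X i))"
    and W: "openin (product_topology X I) W"
  shows "W \<in> sets (PiM I M)"
proof -
  have "\<forall>i\<in>I. \<exists>\<B>. countable \<B> \<and> (\<forall>V\<in>\<B>. openin (X i) V) \<and>
      (\<forall>U x. openin (X i) U \<and> x \<in> U \<longrightarrow> (\<exists>V\<in>\<B>. x \<in> V \<and> V \<subseteq> U))"
    using sc by (simp add: second_countable_def)
  from bchoice[OF this] obtain \<B> where B: "\<forall>i\<in>I. countable (\<B> i) \<and> (\<forall>V\<in>\<B> i. openin (X i) V) \<and>
      (\<forall>U x. openin (X i) U \<and> x \<in> U \<longrightarrow> (\<exists>V\<in>\<B> i. x \<in> V \<and> V \<subseteq> U))" ..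
  have cB: "countable (\<B> i)" if "i \<in> I" for i using bspec[OF B that] by simp
  have oB: "openin (X i) V" if "i \<in> I" "V \<in> \<B> i" for i V using bspec[OF B that(1)] that(2) by simp
  have bB: "\<exists>V\<in>\<B> i. x \<in> V \<and> V \<subseteq> U" if "i \<in> I" "openin (X i) U" "x \<in> U" for i U x
    using bspec[OF B that(1)] that(2,3) by simp
  let ?F = "{V \<in> Pi\<^sub>E I \<B>. Pi\<^sub>E I V \<subseteq> W}"
  have "countable (Pi\<^sub>E I \<B>)" by (rule countable_PiE[OF fin cB])
  then have cF: "countable ?F" by (rule countable_subset[rotated]) auto
  have "W = (\<Union>V\<in>?F. Pi\<^sub>E I V)"
  proof
    show "W \<subseteq> (\<Union>V\<in>?F. Pi\<^sub>E I V)"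
    proof
      fix x assume x: "x \<in> W"
      obtain U where "finite {i \<in> I. U i \<noteq> topspace (X i)} \<and> (\<forall>i\<in>I. openin (X i) (U i)) \<and>
          x \<in> Pi\<^sub>E I U \<and> Pi\<^sub>E I U \<subseteq> W"
        using bspec[OF W[unfolded openin_product_topology_alt] x] ..
      then have U: "\<forall>i\<in>I. openin (X i) (U i)" and UW: "x \<in> Pi\<^sub>E I U" "Pi\<^sub>E I U \<subseteq> W"
        by simp_all
      have "\<forall>i\<in>I. \<exists>V. V \<in> \<B> i \<and> x i \<in> V \<and> V \<subseteq> U i"
        using bB[OF _ bspec[OF U] PiE_mem[OF UW(1)]] by (intro ballI) (simp add: Bex_def)
      from bchoice[OF this] obtain V where V: "\<forall>i\<in>I. V i \<in> \<B> i \<and> x i \<in> V i \<and> V i \<subseteq> U i" ..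
      have "Pi\<^sub>E I (restrict V I) \<subseteq> Pi\<^sub>E I U" using V by (intro PiE_mono) simp
      then have "restrict V I \<in> ?F" using V UW(2) by auto
      moreover have "x \<in> Pi\<^sub>E I (restrict V I)" using V UW(1) by (simp add: PiE_iff)
      ultimately show "x \<in> (\<Union>V\<in>?F. Pi\<^sub>E I V)"
        by (rule UN_I[where B = "Pi\<^sub>E I"])
    qed
  qed auto
  also have "\<dots> \<in> sets (PiM I M)"
  proof (rule sets.countable_UN''[OF cF])
    fix V assume V: "V \<in> ?F"
    have "V i \<in> sets (M i)" if i: "i \<in> I" for i
    proof -
      have "V i \<in> \<B> i" using V i by auto
      from openin_borel_of[OF oB[OF i this]] show ?thesis by (simp only: sets[OF i])
    qed
    then show "Pi\<^sub>E I V \<in> sets (PiM I M)" by (intro sets_PiM_I_finite fin) auto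
  qed
  finally show ?thesis .
qed

lemma continuous_map_borel_measurable_PiM:
  assumes fin: "finite I" and sc: "\<And>i. i \<in> I \<Longrightarrow> second_countable (X i)"
    and sets: "\<And>i. i \<in> I \<Longrightarrow> sets (M i) = sets (borel_of (X i))"
    and c: "continuous_map (product_topology X I) euclideanreal c"
  shows "c \<in> borel_measurable (PiM I M)"
proof (rule borel_measurableI)
  fix U :: "real set" assume "open U"
  then have "openin (product_topology X I) {x \<in> topspace (product_topology X I). c x \<in> U}"
    using c openin_continuous_map_preimage by fastforce
  moreover have "{x \<in> topspace (product_topology X I). c x \<in> U} = c -` U \<inter> space (PiM I M)"
    using space_borel_of[OF sets] by (auto simp: space_PiM PiE_iff extensional_def)
  ultimately show "c -` U \<inter> space (PiM I M) \<in> sets (PiM I M)"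
    using openin_product_in_sets_PiM[OF fin sc sets] by simp
qed

section \<open>The extended real dual functional\<close>

lemma ess_bounded_iff_Linf: "ess_bounded M h \<longleftrightarrow> (\<lambda>x. ereal (h x)) \<in> Linf M"
proof
  assume "ess_bounded M h"
  then show "(\<lambda>x. ereal (h x)) \<in> Linf M" by (auto simp: ess_bounded_def Linf_def)
next
  assume *: "(\<lambda>x. ereal (h x)) \<in> Linf M"
  then have "(\<lambda>x. real_of_ereal (ereal (h x))) \<in> borel_measurable M"
    unfolding Linf_def by (intro borel_measurable_real_of_ereal) auto
  with * show "ess_bounded M h" by (auto simp: ess_bounded_def Linf_def)
qed

text \<open>Test with boxes that have a single factor different from the whole space: the other factors have
positive mass, so a null box for the product has a null factor.\<close>

lemma absolutely_continuous_component:
  assumes fin: "finite I" and j: "j \<in> I"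
    and \<mu>: "\<And>i. i \<in> I \<Longrightarrow> finite_measure (\<mu> i)" and \<gamma>: "\<And>i. i \<in> I \<Longrightarrow> finite_measure (\<gamma> i)"
    and sets: "\<And>i. i \<in> I \<Longrightarrow> sets (\<mu> i) = sets (\<gamma> i)"
    and nz: "\<And>i. i \<in> I \<Longrightarrow> emeasure (\<mu> i) (space (\<mu> i)) \<noteq> 0"
    and ac: "absolutely_continuous (PiM I \<gamma>) (PiM I \<mu>)"
  shows "absolutely_continuous (\<gamma> j) (\<mu> j)"
  unfolding absolutely_continuous_def
proof
  fix A assume A: "A \<in> null_sets (\<gamma> j)"
  let ?B = "\<lambda>i. if i = j then A else space (\<gamma> i)"
  have Bg: "?B i \<in> sets (\<gamma> i)" for i using A by auto
  have Bm: "?B i \<in> sets (\<mu> i)" if "i \<in> I" for i using Bg sets[OF that] by simp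
  have "emeasure (PiM I \<gamma>) (Pi\<^sub>E I ?B) = (\<Prod>i\<in>I. emeasure (\<gamma> i) (?B i))"
    by (rule emeasure_PiM_box[OF fin \<gamma> Bg])
  also have "\<dots> = 0" using A j fin by (auto intro!: prod_zero bexI[of _ j])
  finally have "Pi\<^sub>E I ?B \<in> null_sets (PiM I \<gamma>)"
    using Bg by (intro null_setsI sets_PiM_I_finite fin) auto
  then have "Pi\<^sub>E I ?B \<in> null_sets (PiM I \<mu>)" using ac by (auto simp: absolutely_continuous_def)
  then have "(\<Prod>i\<in>I. emeasure (\<mu> i) (?B i)) = 0"
    using emeasure_PiM_box[OF fin \<mu> Bm] by (simp add: null_sets_def)
  then obtain i where i: "i \<in> I" "emeasure (\<mu> i) (?B i) = 0"
    using fin by (auto simp: prod_zero_iff)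
  have "i = j"
  proof (rule ccontr)
    assume "i \<noteq> j"
    then have "emeasure (\<mu> i) (space (\<mu> i)) = 0"
      using i sets_eq_imp_space_eq[OF sets[OF i(1)]] by simp
    then show False using nz i(1) by blast
  qed
  then show "A \<in> null_sets (\<mu> j)" using i A sets[OF j] by auto
qed

lemma ext_ln_bound:
  assumes "\<bar>ext_ln a\<bar> \<le> ereal C"
  shows "a \<noteq> \<infinity> \<and> 0 < enn2real a \<and> \<bar>ln (enn2real a)\<bar> \<le> C"
proof -
  have "a \<noteq> 0" "a \<noteq> \<infinity>" using assms by (auto simp: ext_ln_def split: if_splits)
  then show ?thesis using assms
    by (cases a) (auto simp: ext_ln_def)
qed

context entropic_dual
begin

lemma bounded_tuple_iff: "bounded_tuple f \<longleftrightarrow> f \<in> Linf_tuples I \<gamma>"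
  by (simp add: bounded_tuple_def Linf_tuples_def ess_bounded_iff_Linf)

text \<open>The negative part of the integrand is integrable, so the extended integral is either \<open>\<infinity>\<close> or an
ordinary Lebesgue integral.\<close>

lemma ext_integral_conj:
  assumes i: "i \<in> I" and h: "ess_bounded (\<gamma> i) h"
  shows "ext_integral (\<mu> i) (\<lambda>x. conj_fun (\<phi> i) (- h x)) =
    (if finite_cost i h then ereal (marginal_cost i h) else \<infinity>)"
proof -
  let ?g = "\<lambda>x. conj_fun (\<phi> i) (- h x)"
  define p where "p = (\<integral>\<^sup>+x. e2ennreal (?g x) \<partial>\<mu> i)"
  define n where "n = (\<integral>\<^sup>+x. e2ennreal (- ?g x) \<partial>\<mu> i)"
  have hm: "h \<in> borel_measurable (\<mu> i)"
    using h by (simp add: measurable_mu[OF i] ess_bounded_def)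
  have gm: "?g \<in> borel_measurable (\<mu> i)"
    using hm by (intro measurable_compose[OF _ conj_fun_borel[OF entropy[OF i]]]) auto
  have cm: "conj_val i h \<in> borel_measurable (\<mu> i)"
    unfolding measurable_mu[OF i] using h by (intro conj_val_measurable i) (simp add: ess_bounded_def)
  have "n \<le> (\<integral>\<^sup>+x. ennreal \<bar>h x\<bar> \<partial>\<mu> i)"
    unfolding n_def
  proof (rule nn_integral_mono)
    fix x
    have "- ?g x \<le> ereal \<bar>h x\<bar>"
    proof -
      have "- ?g x \<le> - ereal (- h x)"
        using conj_fun_ge[OF entropy[OF i], of "- h x"] by (simp only: ereal_minus_le_minus)
      also have "\<dots> \<le> ereal \<bar>h x\<bar>" by simp
      finally show ?thesis .
    qed
    then show "e2ennreal (- ?g x) \<le> ennreal \<bar>h x\<bar>"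
      by (metis e2ennreal_mono e2ennreal_ereal)
  qed
  also have "\<dots> < \<infinity>"
    using integrable_mu[OF i ess_bounded_abs[OF h]] by (simp add: integrable_iff_bounded)
  finally have n: "n < \<infinity>" .
  have val: "e2ennreal (?g x) = ennreal (conj_val i h x) \<and> e2ennreal (- ?g x) = ennreal (- conj_val i h x)"
    if "?g x < \<infinity>" for x
    using conj_val_eq[where h = h, OF i that] by (simp add: e2ennreal_ereal)
  have pn: "p = (\<integral>\<^sup>+x. ennreal (conj_val i h x) \<partial>\<mu> i)" "n = (\<integral>\<^sup>+x. ennreal (- conj_val i h x) \<partial>\<mu> i)"
    if "AE x in \<mu> i. ?g x < \<infinity>"
    unfolding p_def n_def using that val by (auto intro!: nn_integral_cong_AE elim!: eventually_mono)
  have ext: "ext_integral (\<mu> i) ?g = enn2ereal p - enn2ereal n"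
    by (simp add: ext_integral_def p_def n_def)
  show ?thesis
  proof (cases "finite_cost i h")
    case True
    then have fin: "AE x in \<mu> i. ?g x < \<infinity>" and int: "integrable (\<mu> i) (conj_val i h)"
      by (auto simp: finite_cost_def)
    from pn[OF fin] have "marginal_cost i h = enn2real p - enn2real n" and "p < \<infinity>"
      using real_lebesgue_integral_def[OF int] int unfolding marginal_cost_def real_integrable_def
      by (auto simp: less_top)
    then show ?thesis
      using True n unfolding ext by (cases p; cases n) (auto simp: enn2ereal_ennreal)
  next
    case False
    have "p = \<infinity>"
    proof (rule ccontr)
      assume p: "p \<noteq> \<infinity>"
      have "AE x in \<mu> i. e2ennreal (?g x) \<noteq> \<infinity>"
        by (rule nn_integral_PInf_AE) (use gm p in \<open>auto simp: p_def\<close>)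
      then have fin: "AE x in \<mu> i. ?g x < \<infinity>" by eventually_elim auto
      from pn[OF fin] have "integrable (\<mu> i) (conj_val i h)"
        unfolding real_integrable_def using p n cm by auto
      then show False using False fin h by (simp add: finite_cost_def)
    qed
    then show ?thesis using False n unfolding ext by (cases n) auto
  qed
qed

lemma dual_functional_eq:
  assumes f: "f \<in> Linf_tuples I \<gamma>"
  shows "dual_functional I \<epsilon> \<phi> \<mu> \<gamma> c f = (if finite_costs f then ereal (- cost f) else -\<infinity>)"
proof -
  have fb: "ess_bounded (\<gamma> i) (f i)" if "i \<in> I" for i
    using f that by (simp add: Linf_tuples_def ess_bounded_iff_Linf)
  have s: "(\<Sum>i\<in>I. ext_integral (\<mu> i) (\<lambda>x. conj_fun (\<phi> i) (- f i x))) =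
      (\<Sum>i\<in>I. if finite_cost i (f i) then ereal (marginal_cost i (f i)) else \<infinity>)"
    using fb by (intro sum.cong refl ext_integral_conj)
  show ?thesis
  proof (cases "finite_costs f")
    case True
    then have "(\<Sum>i\<in>I. if finite_cost i (f i) then ereal (marginal_cost i (f i)) else \<infinity>) =
        ereal (\<Sum>i\<in>I. marginal_cost i (f i))"
      by (simp add: finite_costs_def)
    then show ?thesis
      using True unfolding dual_functional_def s by (simp add: cost_def plan_def)
  next
    case False
    then have "(\<Sum>i\<in>I. if finite_cost i (f i) then ereal (marginal_cost i (f i)) else \<infinity>) = \<infinity>"
      using finite_I by (auto simp: sum_Pinfty finite_costs_def)
    then show ?thesis using False unfolding dual_functional_def s by simp
  qed
qed

text \<open>Since the dual functional is not \<open>-\<infinity>\<close> at \<open>f0\<close>, it is finite at every maximiser, and maximisers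
of the dual functional are minimisers of the cost.\<close>

lemma dual_optimal_minimal:
  assumes f0: "f0 \<in> Linf_tuples I \<gamma>" "dual_functional I \<epsilon> \<phi> \<mu> \<gamma> c f0 > -\<infinity>"
    and opt: "dual_optimal I \<epsilon> \<phi> \<mu> \<gamma> c fh"
  shows "finite_costs f0" and "finite_costs fh" and "finite_costs g \<Longrightarrow> cost fh \<le> cost g"
proof -
  have fh: "fh \<in> Linf_tuples I \<gamma>" using opt by (simp add: dual_optimal_def)
  have le: "dual_functional I \<epsilon> \<phi> \<mu> \<gamma> c g \<le> dual_functional I \<epsilon> \<phi> \<mu> \<gamma> c fh"
    if g: "g \<in> Linf_tuples I \<gamma>" for g
  proof -
    have "dual_objective I \<epsilon> \<phi> \<mu> \<gamma> c g \<le> dual_objective I \<epsilon> \<phi> \<mu> \<gamma> c fh"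
      using opt g by (auto simp: dual_optimal_def intro: SUP_upper)
    then show ?thesis unfolding dual_objective_def by (simp add: ereal_add_le_add_iff2)
  qed
  show f0c: "finite_costs f0"
    using f0(2) dual_functional_eq[OF f0(1)] by (auto split: if_splits)
  show fhc: "finite_costs fh"
    using le[OF f0(1)] dual_functional_eq[OF f0(1)] dual_functional_eq[OF fh] f0c
    by (auto split: if_splits)
  show "cost fh \<le> cost g" if "finite_costs g"
  proof -
    have g: "g \<in> Linf_tuples I \<gamma>"
      using finite_costs_bounded[OF that] bounded_tuple_iff by blast
    show ?thesis
      using le[OF g] dual_functional_eq[OF g] dual_functional_eq[OF fh] that fhc by simp
  qed
qed

end

section \<open>Convergence of the Sinkhorn sequence\<close>

theorem theorem4p11:
  fixes N :: nat and \<epsilon> :: real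
    and X :: "nat \<Rightarrow> 'a topology"
    and \<mu> \<gamma> :: "nat \<Rightarrow> 'a measure"
    and \<phi> :: "nat \<Rightarrow> real \<Rightarrow> ereal"
    and c :: "(nat \<Rightarrow> 'a) \<Rightarrow> real"
    and f0 :: "nat \<Rightarrow> 'a \<Rightarrow> real"
  assumes "\<epsilon> > 0" and "N \<ge> 1"
    and "\<And>i. i \<in> {1..N} \<Longrightarrow> topspace (X i) \<noteq> {}"
    and "\<And>i. i \<in> {1..N} \<Longrightarrow> compact_space (X i)"
    and "\<And>i. i \<in> {1..N} \<Longrightarrow> polish_topology (X i)"
    and "\<And>i. i \<in> {1..N} \<Longrightarrow> \<mu> i \<in> finite_borel_measures (X i)"
    and "\<And>i. i \<in> {1..N} \<Longrightarrow> support_of (X i) (\<mu> i) = topspace (X i)"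
    and "\<And>i. i \<in> {1..N} \<Longrightarrow> \<gamma> i \<in> finite_borel_measures (X i)"
    and "KL (PiM {1..N} \<mu>) (PiM {1..N} \<gamma>) < \<infinity>"
    and "\<And>i. i \<in> {1..N} \<Longrightarrow> entropy_function (\<phi> i)"
    and "continuous_map (product_topology X {1..N}) euclideanreal c"
    and "\<And>x. x \<in> topspace (product_topology X {1..N}) \<Longrightarrow> c x \<ge> 0"
    and "\<And>i. i \<in> {1..N} \<Longrightarrow> (\<lambda>x. ext_ln (RN_deriv (\<gamma> i) (\<mu> i) x)) \<in> Linf (\<gamma> i)"
    and "\<And>i. i \<in> {1..N - 1} \<Longrightarrow> {0..} \<subseteq> edom (\<phi> i)"
    and "f0 \<in> Linf_tuples {1..N} \<gamma>"
    and "dual_functional {1..N} \<epsilon> \<phi> \<mu> \<gamma> c f0 > -\<infinity>"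
  shows "\<forall>fh. dual_optimal {1..N} \<epsilon> \<phi> \<mu> \<gamma> c fh \<longrightarrow>
     (\<forall>p\<ge>1. (\<lambda>n. Lp_norm p (PiM {1..N} \<gamma>)
          (\<lambda>x. oplus {1..N} (sinkhorn_seq N \<epsilon> \<phi> \<mu> \<gamma> c f0 n) x - oplus {1..N} fh x))
        \<longlonglongrightarrow> 0) \<and>
     ((\<exists>J \<subseteq> {1..N}. card J = N - 1 \<and> (\<forall>i\<in>J. strictly_convex (conj_fun (\<phi> i)))) \<longrightarrow>
        (\<forall>g. dual_optimal {1..N} \<epsilon> \<phi> \<mu> \<gamma> c g \<longrightarrow>
           (\<forall>i\<in>{1..N}. AE x in \<gamma> i. g i x = fh i x)) \<and>
        (\<forall>p\<ge>1. (\<lambda>n. Lp_norm_tuple p {1..N} \<gamma>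
             (\<lambda>i x. sinkhorn_seq N \<epsilon> \<phi> \<mu> \<gamma> c f0 n i x - fh i x))
           \<longlonglongrightarrow> 0))"
proof -
  have pos: "0 < \<epsilon>" and N1: "1 \<le> N" by fact+
  note ne = assms(3) and cpt = assms(4) and pol = assms(5) and fm\<mu> = assms(6) and supp = assms(7)
    and fm\<gamma> = assms(8) and kl = assms(9) and ent = assms(10) and cont = assms(11) and c0 = assms(12)
    and lnb = assms(13) and dom = assms(14) and f0 = assms(15) and Df0 = assms(16)
  let ?I = "{1..N}"
  let ?\<sigma> = "\<lambda>i x. enn2real (RN_deriv (\<gamma> i) (\<mu> i) x)"
  have fin\<mu>: "finite_measure (\<mu> i)" and sets\<mu>: "sets (\<mu> i) = sets (borel_of (X i))" if "i \<in> ?I" for i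
    using fm\<mu>[OF that] by (auto simp: finite_borel_measures_def)
  have fin\<gamma>: "finite_measure (\<gamma> i)" and sets\<gamma>: "sets (\<gamma> i) = sets (borel_of (X i))" if "i \<in> ?I" for i
    using fm\<gamma>[OF that] by (auto simp: finite_borel_measures_def)
  have sets: "sets (\<mu> i) = sets (\<gamma> i)" if "i \<in> ?I" for i
    using sets\<mu>[OF that] sets\<gamma>[OF that] by simp
  have nz\<mu>: "emeasure (\<mu> i) (space (\<mu> i)) \<noteq> 0" if i: "i \<in> ?I" for i
  proof -
    obtain x where "x \<in> support_of (X i) (\<mu> i)" using ne[OF i] unfolding supp[OF i] by blast
    then have "0 < emeasure (\<mu> i) (topspace (X i))" by (auto simp: support_of_def)
    then show ?thesis using space_borel_of[OF sets\<mu>[OF i]] by simp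
  qed
  have ac: "absolutely_continuous (\<gamma> i) (\<mu> i)" if i: "i \<in> ?I" for i
  proof (rule absolutely_continuous_component[OF _ i fin\<mu> fin\<gamma> sets nz\<mu>])
    show "absolutely_continuous (PiM ?I \<gamma>) (PiM ?I \<mu>)"
      using kl by (auto simp: KL_def split: if_splits)
  qed auto
  have "\<forall>i\<in>?I. \<exists>D. AE x in \<gamma> i. \<bar>ext_ln (RN_deriv (\<gamma> i) (\<mu> i) x)\<bar> \<le> ereal D"
    using lnb by (auto simp: Linf_def)
  then obtain D where D: "\<And>i. i \<in> ?I \<Longrightarrow> AE x in \<gamma> i. \<bar>ext_ln (RN_deriv (\<gamma> i) (\<mu> i) x)\<bar> \<le> ereal (D i)"
    by metis
  define S where "S = (\<Sum>i\<in>?I. \<bar>D i\<bar>)"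
  have S: "AE x in \<gamma> i. RN_deriv (\<gamma> i) (\<mu> i) x \<noteq> \<infinity> \<and> 0 < ?\<sigma> i x \<and> \<bar>ln (?\<sigma> i x)\<bar> \<le> S" if i: "i \<in> ?I" for i
  proof -
    have "D i \<le> S" unfolding S_def using member_le_sum[of i ?I "\<lambda>i. \<bar>D i\<bar>"] i by auto
    with D[OF i] show ?thesis
      by (auto elim!: eventually_mono dest!: ext_ln_bound)
  qed
  have dens: "\<mu> i = density (\<gamma> i) (\<lambda>x. ennreal (?\<sigma> i x))" if i: "i \<in> ?I" for i
  proof -
    interpret g: finite_measure "\<gamma> i" by (rule fin\<gamma>[OF i])
    have "\<mu> i = density (\<gamma> i) (RN_deriv (\<gamma> i) (\<mu> i))"
      using g.density_RN_deriv[OF ac[OF i] sets[OF i]] by simp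
    also have "\<dots> = density (\<gamma> i) (\<lambda>x. ennreal (?\<sigma> i x))"
      using S[OF i] by (intro density_cong) (auto elim!: eventually_mono simp: less_top)
    finally show ?thesis .
  qed
  have compact: "compact_space (product_topology X ?I)"
    using cpt by (auto simp: compact_space_product_topology)
  have "compact (c ` topspace (product_topology X ?I))"
    using image_compactin[OF compact[unfolded compact_space_def] cont] by simp
  then have "bounded (c ` topspace (product_topology X ?I))" by (rule compact_imp_bounded)
  then obtain C where "\<forall>y\<in>c ` topspace (product_topology X ?I). norm y \<le> C"
    unfolding bounded_iff by blast
  then have C: "\<bar>c x\<bar> \<le> C" if "x \<in> topspace (product_topology X ?I)" for x
    using that unfolding real_norm_def by (simp only: ball_simps)
  have space: "space (PiM ?I \<gamma>) = topspace (product_topology X ?I)"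
    using space_borel_of[OF sets\<gamma>] by (auto simp: space_PiM PiE_iff extensional_def)
  have dual: "entropic_dual ?I N \<epsilon> \<phi> \<mu> \<gamma> c S C"
  proof (rule entropic_dual.intro)
    show "0 < measure (\<gamma> i) (space (\<gamma> i))" if i: "i \<in> ?I" for i
    proof -
      interpret g: finite_measure "\<gamma> i" by (rule fin\<gamma>[OF i])
      have "space (\<gamma> i) \<notin> null_sets (\<gamma> i)"
        using ac[OF i] nz\<mu>[OF i] sets_eq_imp_space_eq[OF sets[OF i]]
        by (auto simp: absolutely_continuous_def null_sets_def)
      then show ?thesis by (auto simp: null_sets_def g.emeasure_eq_measure zero_less_measure_iff)
    qed
    show "AE x in \<gamma> i. 0 < ?\<sigma> i x \<and> \<bar>ln (?\<sigma> i x)\<bar> \<le> S" if "i \<in> ?I" for i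
      using S[OF that] by (auto elim!: eventually_mono)
    show "c \<in> borel_measurable (PiM ?I \<gamma>)"
      by (rule continuous_map_borel_measurable_PiM[OF _ polish_second_countable[OF pol] sets\<gamma> cont]) auto
    show "0 \<le> c x \<and> c x \<le> C" if "x \<in> space (PiM ?I \<gamma>)" for x
      using that C[of x] c0[of x] unfolding space by auto
    show "{0..} \<subseteq> edom (\<phi> i)" if "i \<in> ?I - {N}" for i
      using that by (intro dom) auto
    show "finite ?I" "N \<in> ?I" "0 < \<epsilon>" using pos N1 by simp_all
    show "finite_measure (\<gamma> i)" if "i \<in> ?I" for i by (rule fin\<gamma>[OF that])
    show "\<mu> i = density (\<gamma> i) (\<lambda>x. ennreal (?\<sigma> i x))" if "i \<in> ?I" for i by (rule dens[OF that])
    show "entropy_function (\<phi> i)" if "i \<in> ?I" for i by (rule ent[OF that])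
  qed
  then interpret E: entropic_dual ?I N \<epsilon> \<phi> \<mu> \<gamma> c S C ?\<sigma> .
  note min = E.dual_optimal_minimal[OF f0 Df0]
  have iteration: "sinkhorn_iteration ?I N \<epsilon> \<phi> \<mu> \<gamma> c S C f0 g"
    if g: "dual_optimal ?I \<epsilon> \<phi> \<mu> \<gamma> c g" for g
    by (intro sinkhorn_iteration.intro dual sinkhorn_iteration_axioms.intro refl min[OF g])
  show ?thesis
  proof (intro allI impI conjI ballI; (elim exE conjE)?)
    fix fh p
    assume opt: "dual_optimal ?I \<epsilon> \<phi> \<mu> \<gamma> c fh" and p: "1 \<le> (p::real)"
    then interpret s: sinkhorn_iteration ?I N \<epsilon> \<phi> \<mu> \<gamma> c S C ?\<sigma> f0 fh by (intro iteration)
    show "(\<lambda>n. Lp_norm p (PiM ?I \<gamma>)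
          (\<lambda>x. oplus ?I (sinkhorn_seq N \<epsilon> \<phi> \<mu> \<gamma> c f0 n) x - oplus ?I fh x)) \<longlonglongrightarrow> 0"
      using s.oplus_Lp_null[OF p] unfolding s.iter_def .
  next
    fix fh g i J
    assume opt: "dual_optimal ?I \<epsilon> \<phi> \<mu> \<gamma> c fh" "dual_optimal ?I \<epsilon> \<phi> \<mu> \<gamma> c g" and i: "i \<in> ?I"
      and J: "J \<subseteq> ?I" "card J = N - 1" "\<forall>i\<in>J. strictly_convex (conj_fun (\<phi> i))"
    interpret s: sinkhorn_iteration ?I N \<epsilon> \<phi> \<mu> \<gamma> c S C ?\<sigma> f0 fh by (rule iteration[OF opt(1)])
    interpret t: sinkhorn_iteration ?I N \<epsilon> \<phi> \<mu> \<gamma> c S C ?\<sigma> f0 g by (rule iteration[OF opt(2)])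
    have int: "integrable (\<gamma> i) (\<lambda>x. \<bar>s.dev n i x\<bar>)" "integrable (\<gamma> i) (\<lambda>x. \<bar>t.dev n i x\<bar>)" for n
      using E.integrable_gamma[OF i] s.dev_ess_bounded[OF i] t.dev_ess_bounded[OF i] by auto
    have diff: "g i x - fh i x = s.dev n i x - t.dev n i x" for n x
      by (simp add: s.dev_def t.dev_def s.iter_def t.iter_def)
    have gf: "integrable (\<gamma> i) (\<lambda>x. \<bar>g i x - fh i x\<bar>)"
      unfolding diff[of _ 0]
      using E.integrable_gamma[OF i] s.dev_ess_bounded[OF i] t.dev_ess_bounded[OF i] by auto
    have le: "(\<integral>x. \<bar>g i x - fh i x\<bar> \<partial>\<gamma> i) \<le> (\<integral>x. \<bar>s.dev n i x\<bar> \<partial>\<gamma> i) + (\<integral>x. \<bar>t.dev n i x\<bar> \<partial>\<gamma> i)" for n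
    proof -
      have "(\<integral>x. \<bar>g i x - fh i x\<bar> \<partial>\<gamma> i) \<le> (\<integral>x. \<bar>s.dev n i x\<bar> + \<bar>t.dev n i x\<bar> \<partial>\<gamma> i)"
        using gf int[of n] by (intro integral_mono) (auto simp: diff[of _ n])
      then show ?thesis using int[of n] by simp
    qed
    have lim: "(\<lambda>n. (\<integral>x. \<bar>s.dev n i x\<bar> \<partial>\<gamma> i) + (\<integral>x. \<bar>t.dev n i x\<bar> \<partial>\<gamma> i)) \<longlonglongrightarrow> 0 + 0"
      by (intro tendsto_add s.dev_L1_null[OF J i] t.dev_L1_null[OF J i])
    have "(\<integral>x. \<bar>g i x - fh i x\<bar> \<partial>\<gamma> i) \<le> 0 + 0"
      by (rule LIMSEQ_le_const[OF lim]) (use le in blast)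
    moreover have "0 \<le> (\<integral>x. \<bar>g i x - fh i x\<bar> \<partial>\<gamma> i)" by simp
    ultimately have "(\<integral>x. \<bar>g i x - fh i x\<bar> \<partial>\<gamma> i) = 0" by linarith
    then have "AE x in \<gamma> i. \<bar>g i x - fh i x\<bar> = 0"
      using integral_nonneg_eq_0_iff_AE[OF gf] by simp
    then show "AE x in \<gamma> i. g i x = fh i x" by eventually_elim simp
  next
    fix fh J p
    assume opt: "dual_optimal ?I \<epsilon> \<phi> \<mu> \<gamma> c fh" and p: "1 \<le> (p::real)"
      and J: "J \<subseteq> ?I" "card J = N - 1" "\<forall>i\<in>J. strictly_convex (conj_fun (\<phi> i))"
    interpret s: sinkhorn_iteration ?I N \<epsilon> \<phi> \<mu> \<gamma> c S C ?\<sigma> f0 fh by (rule iteration[OF opt])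
    show "(\<lambda>n. Lp_norm_tuple p ?I \<gamma> (\<lambda>i x. sinkhorn_seq N \<epsilon> \<phi> \<mu> \<gamma> c f0 n i x - fh i x)) \<longlonglongrightarrow> 0"
      using s.dev_tuple_Lp_null[OF J p] unfolding s.iter_def .
  qed
qed

end
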